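(* Let $G$ be a finite connected graph on the vertex set $\{1,\ldots,d\}$ without loops and multiple edges, and let $K$ be a field. Then the following conditions are equivalent: (i) $K[A_G^\pm]$ is normal; (ii) $I_{A_G^\pm}$ has a squarefree initial ideal (i.e. there is a monomial order with respect to which the initial ideal of $I_{A_G^\pm}$ is generated by squarefree monomials); (iii) $A_G$ is a unimodular matrix (after deleting a redundant row if $G$ is bipartite); (iv) any two odd cycles of $G$ possess a common vertex.
   Context: Let $e_1,\ldots,e_n$ be the edges of $G$ and let $\mathbf{e}_1,\ldots,\mathbf{e}_d$ be the canonical unit coordinate vectors of $\mathbb{R}^d$. For an edge $e=\{i,j\}$ put $\rho(e)=\mathbf{e}_i+\mathbf{e}_j$. $A_G\in\mathbb{Z}^{d\times n}$ is the matrix with columns $\rho(e_1),\ldots,\rho(e_n)$. (If $G$ is connected, $A_G$ has rank $d$ when $G$ is nonbipartite and rank $d-1$ when $G$ is bipartite; in the latter case one row is redundant.) An integer matrix $A \in \mathbb{Z}^{r\times n}$ of rank $r$ is called unimodular if all nonzero maximal ($r \times r$) minors of $A$ have the same absolute value. For $A \in \mathbb{Z}^{d\times n}$ with columns $\mathbf{a}_1,\ldots,\mathbf{a}_n$, the centrally symmetric configuration $A^\pm \in \mathbb{Z}^{(d+1)\times(2n+1)}$ is the matrix whose columns are $$\begin{bmatrix}\mathbf{0}\\1\end{bmatrix},\ \begin{bmatrix}\mathbf{a}_1\\1\end{bmatrix},\ldots,\begin{bmatrix}\mathbf{a}_n\\1\end{bmatrix},\ \begin{bmatrix}-\mathbf{a}_1\\1\end{bmatrix},\ldots,\begin{bmatrix}-\mathbf{a}_n\\1\end{bmatrix}.$$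 For an integer matrix $C\in\mathbb{Z}^{e\times m}$ with columns $\mathbf{c}_1,\ldots,\mathbf{c}_m$ lying on a hyperplane not passing through the origin, the toric ring $K[C]$ is the $K$-subalgebra of the Laurent polynomial ring $K[t_1^{\pm1},\ldots,t_e^{\pm1}]$ generated by $\mathbf{t}^{\mathbf{c}_1},\ldots,\mathbf{t}^{\mathbf{c}_m}$, where $\mathbf{t}^{\mathbf{c}}=t_1^{c_1}\cdots t_e^{c_e}$, and the toric ideal $I_C\subset K[x_1,\ldots,x_m]$ is the kernel of the surjective $K$-algebra homomorphism $K[x_1,\ldots,x_m]\to K[C]$, $x_i\mapsto\mathbf{t}^{\mathbf{c}_i}$. The ring $K[C]$ is normal if and only if $\mathbb{Z}_{\ge0}C=\mathbb{Z}C\cap\mathbb{Q}_{\ge0}C$, where $\mathbb{Z}_{\ge 0}C$, $\mathbb{Z}C$, $\mathbb{Q}_{\ge 0}C$ are the sets of combinations of the columns of $C$ with coefficients in $\mathbb{Z}_{\ge0}$, $\mathbb{Z}$, $\mathbb{Q}_{\ge0}$ respectively. *)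

theory Defs
  imports
    "HOL-Library.Poly_Mapping"
    "HOL-Computational_Algebra.Polynomial"
    "HOL-Computational_Algebra.Fraction_Field"
    "Jordan_Normal_Form.DL_Rank"
    "Jordan_Normal_Form.DL_Submatrix"
begin

section \<open>Graphs\<close>

definition simple_graph :: "nat set \<Rightarrow> nat set set \<Rightarrow> bool" where
  "simple_graph V E \<longleftrightarrow> finite V \<and> (\<forall>e\<in>E. e \<subseteq> V \<and> card e = 2)"

definition connected_graph :: "nat set \<Rightarrow> nat set set \<Rightarrow> bool" where
  "connected_graph V E \<longleftrightarrow> V \<noteq> {} \<and> (\<forall>u\<in>V. \<forall>v\<in>V. (u, v) \<in> {(a, b). {a, b} \<in> E}\<^sup>*)"

definition bipartite_graph :: "nat set \<Rightarrow> nat set set \<Rightarrow> bool" where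
  "bipartite_graph V E \<longleftrightarrow>
     (\<exists>X Y. X \<union> Y = V \<and> X \<inter> Y = {} \<and> (\<forall>e\<in>E. \<exists>x\<in>X. \<exists>y\<in>Y. e = {x, y}))"

definition is_cycle :: "nat set set \<Rightarrow> nat list \<Rightarrow> bool" where
  "is_cycle E c \<longleftrightarrow> 3 \<le> length c \<and> distinct c \<and>
     (\<forall>i<length c. {c ! i, c ! (Suc i mod length c)} \<in> E)"

definition odd_cycle :: "nat set set \<Rightarrow> nat list \<Rightarrow> bool" where
  "odd_cycle E c \<longleftrightarrow> is_cycle E c \<and> odd (length c)"


section \<open>Integer matrices\<close>

text \<open>Vertices are numbered from 1 but vector entries from 0, so vertex \<open>Suc k\<close> belongs to
  coordinate \<open>k\<close>. For an edge \<open>{i, j}\<close> with \<open>i \<noteq> j\<close> this 0/1 vector is the sum of the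
  unit vectors of \<open>i\<close> and \<open>j\<close>.\<close>

definition edge_vec :: "nat \<Rightarrow> nat set \<Rightarrow> int vec" where
  "edge_vec d e = vec d (\<lambda>k. if Suc k \<in> e then 1 else 0)"

definition edge_matrix :: "nat \<Rightarrow> nat set list \<Rightarrow> int mat" where
  "edge_matrix d es = mat_of_cols d (map (edge_vec d) es)"

definition mat_rank :: "int mat \<Rightarrow> nat" where
  "mat_rank A = vec_space.rank (dim_row A) (map_mat rat_of_int A)"

definition unimodular :: "int mat \<Rightarrow> bool" where
  "unimodular A \<longleftrightarrow> mat_rank A = dim_row A \<and>
     (\<forall>J J'. J \<subseteq> {..<dim_col A} \<and> card J = dim_row A \<and>
             J' \<subseteq> {..<dim_col A} \<and> card J' = dim_row A \<and>
             det (submatrix A {..<dim_row A} J) \<noteq> 0 \<and>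
             det (submatrix A {..<dim_row A} J') \<noteq> 0 \<longrightarrow>
             \<bar>det (submatrix A {..<dim_row A} J)\<bar> = \<bar>det (submatrix A {..<dim_row A} J')\<bar>)"

definition delete_row :: "int mat \<Rightarrow> nat \<Rightarrow> int mat" where
  "delete_row A i = submatrix A ({..<dim_row A} - {i}) {..<dim_col A}"

definition redundant_row :: "int mat \<Rightarrow> nat \<Rightarrow> bool" where
  "redundant_row A i \<longleftrightarrow> i < dim_row A \<and> mat_rank (delete_row A i) = mat_rank A"

definition centrally_symmetric :: "int mat \<Rightarrow> int mat" where
  "centrally_symmetric A =
     mat_of_cols (Suc (dim_row A))
       (map (\<lambda>a. a @\<^sub>v vec_of_list [1])
         (0\<^sub>v (dim_row A) # cols A @ map uminus (cols A)))"


section \<open>Normal domains\<close>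

text \<open>Here \<open>R\<close> is a subring of an ambient integral domain, and its field of fractions is taken
  inside the field of fractions of the ambient domain.\<close>

definition embed_fract :: "'a::idom \<Rightarrow> 'a fract" where
  "embed_fract a = Fraction_Field.Fract a 1"

definition fraction_field_of :: "'a::idom set \<Rightarrow> 'a fract set" where
  "fraction_field_of R = {Fraction_Field.Fract a b | a b. a \<in> R \<and> b \<in> R \<and> b \<noteq> 0}"

definition integral_over :: "'a::comm_ring_1 set \<Rightarrow> 'a \<Rightarrow> bool" where
  "integral_over R z \<longleftrightarrow> (\<exists>p. lead_coeff p = 1 \<and> (\<forall>i. coeff p i \<in> R) \<and> poly p z = 0)"

definition normal_domain :: "'a::idom set \<Rightarrow> bool" where
  "normal_domain R \<longleftrightarrow>
     (\<forall>z\<in>fraction_field_of R. integral_over (embed_fract ` R) z \<longrightarrow> z \<in> embed_fract ` R)"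


section \<open>Toric rings\<close>

text \<open>A monomial is its finitely supported exponent function, and a (Laurent) polynomial maps
  monomials to coefficients; the product is convolution. The variables are indexed by all natural
  numbers, from 0; the toric ring of \<open>C\<close> only involves the first \<open>dim_row C\<close> of them.\<close>

type_synonym 'k laurent = "(nat \<Rightarrow>\<^sub>0 int) \<Rightarrow>\<^sub>0 'k"
type_synonym 'k mpoly = "(nat \<Rightarrow>\<^sub>0 nat) \<Rightarrow>\<^sub>0 'k"

definition laurent_monomial :: "int vec \<Rightarrow> 'k::field laurent" where
  "laurent_monomial c = Poly_Mapping.single (\<Sum>i<dim_vec c. Poly_Mapping.single i (c $ i)) 1"

definition subalgebra :: "'k::field laurent set \<Rightarrow> bool" where
  "subalgebra R \<longleftrightarrow> (\<forall>a. Poly_Mapping.single 0 a \<in> R) \<and>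
     (\<forall>f\<in>R. \<forall>g\<in>R. f + g \<in> R \<and> f * g \<in> R)"

definition toric_ring :: "int mat \<Rightarrow> 'k::field laurent set" where
  "toric_ring C = subalgebra hull (laurent_monomial ` set (cols C))"


section \<open>Toric ideals and initial ideals\<close>

text \<open>\<open>polys m\<close> is the polynomial ring in the variables with index below \<open>m\<close>.\<close>

definition monomials :: "nat \<Rightarrow> (nat \<Rightarrow>\<^sub>0 nat) set" where
  "monomials m = {u. Poly_Mapping.keys u \<subseteq> {..<m}}"

definition polys :: "nat \<Rightarrow> 'k::field mpoly set" where
  "polys m = {f. Poly_Mapping.keys f \<subseteq> monomials m}"

definition poly_ideal :: "nat \<Rightarrow> 'k::field mpoly set \<Rightarrow> bool" where
  "poly_ideal m I \<longleftrightarrow> I \<subseteq> polys m \<and> 0 \<in> I \<and>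
     (\<forall>f\<in>I. \<forall>g\<in>I. f + g \<in> I) \<and> (\<forall>f\<in>polys m. \<forall>g\<in>I. f * g \<in> I)"

definition toric_hom :: "int mat \<Rightarrow> 'k::field mpoly \<Rightarrow> 'k laurent" where
  "toric_hom C f = (\<Sum>u\<in>Poly_Mapping.keys f.
     Poly_Mapping.single 0 (Poly_Mapping.lookup f u) *
     (\<Prod>i\<in>Poly_Mapping.keys u. laurent_monomial (col C i) ^ Poly_Mapping.lookup u i))"

definition toric_ideal :: "int mat \<Rightarrow> 'k::field mpoly set" where
  "toric_ideal C = {f \<in> polys (dim_col C). toric_hom C f = 0}"

text \<open>\<open>(u, v) \<in> r\<close> reads as \<open>u \<le> v\<close>; the monomial 1 is \<open>0\<close>, and products of monomials are sums
  of exponents.\<close>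

definition monomial_order :: "nat \<Rightarrow> (nat \<Rightarrow>\<^sub>0 nat) rel \<Rightarrow> bool" where
  "monomial_order m r \<longleftrightarrow> linear_order_on (monomials m) r \<and>
     (\<forall>u\<in>monomials m. (0, u) \<in> r) \<and>
     (\<forall>u v. \<forall>w\<in>monomials m. (u, v) \<in> r \<longrightarrow> (u + w, v + w) \<in> r)"

definition initial_monomial :: "(nat \<Rightarrow>\<^sub>0 nat) rel \<Rightarrow> 'k::field mpoly \<Rightarrow> (nat \<Rightarrow>\<^sub>0 nat)" where
  "initial_monomial r f =
     (THE u. u \<in> Poly_Mapping.keys f \<and> (\<forall>v\<in>Poly_Mapping.keys f. (v, u) \<in> r))"

definition monomial_ideal :: "nat \<Rightarrow> (nat \<Rightarrow>\<^sub>0 nat) set \<Rightarrow> 'k::field mpoly set" where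
  "monomial_ideal m U = poly_ideal m hull ((\<lambda>u. Poly_Mapping.single u 1) ` U)"

definition initial_ideal ::
    "nat \<Rightarrow> (nat \<Rightarrow>\<^sub>0 nat) rel \<Rightarrow> 'k::field mpoly set \<Rightarrow> 'k mpoly set" where
  "initial_ideal m r I = monomial_ideal m (initial_monomial r ` (I - {0}))"

definition squarefree_monomial :: "(nat \<Rightarrow>\<^sub>0 nat) \<Rightarrow> bool" where
  "squarefree_monomial u \<longleftrightarrow> (\<forall>i. Poly_Mapping.lookup u i \<le> 1)"

definition has_squarefree_initial_ideal :: "nat \<Rightarrow> 'k::field mpoly set \<Rightarrow> bool" where
  "has_squarefree_initial_ideal m I \<longleftrightarrow>
     (\<exists>r. monomial_order m r \<and>
       (\<exists>U \<subseteq> monomials m. (\<forall>u\<in>U. squarefree_monomial u) \<and>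
          initial_ideal m r I = monomial_ideal m U))"

end

theory Submission
  imports Defs
begin

text \<open>Throughout, \<open>A\<close> is the edge matrix, \<open>C\<close> the centrally symmetric configuration and \<open>S\<close> the semigroup
generated by the columns of \<open>C\<close>. Two combinatorial properties mediate between the four conditions.
The semigroup \<open>S\<close> is \<^emph>\<open>normal\<close> if a difference \<open>b\<close> of elements of \<open>S\<close> lies in \<open>S\<close> as soon as some
positive multiple of \<open>b\<close> does. The matrix \<open>A\<close> is \<^emph>\<open>unit conformal\<close> if for every nonzero integer vector
\<open>w\<close> of its kernel the kernel contains a nonzero vector whose entries are \<open>0\<close> or the sign of the
corresponding entry of \<open>w\<close>. The implications are
(iv) \<open>\<Longrightarrow>\<close> unit conformal \<open>\<Longrightarrow>\<close> (ii) \<open>\<Longrightarrow>\<close> \<open>S\<close> normal \<open>\<Longrightarrow>\<close> (iv), the equivalence of (i) with the normality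
of \<open>S\<close>, and unit conformal \<open>\<Longrightarrow>\<close> (iii) \<open>\<Longrightarrow>\<close> (iv).

\<^item> (iv) implies unit conformal. A kernel vector weights the edges with sum \<open>0\<close> at every vertex, so a
vertex entered through a positive edge can be left through a negative one and vice versa. This
yields closed walks with alternating signs. A shortest one uses no edge twice: between two uses of
an edge lie two closed walks of odd length without common vertices, and each contains an odd cycle
(\<open>shortest_alternating_edges_distinct\<close>). Its signed edge set is the vector sought.

\<^item> Unit conformal implies (ii). Monomials of equal multidegree differ by a kernel vector, and the part
of the monomial without the variable of the zero column is a convex function of its signed exponent
vector. Hence, if a monomial can be lowered within its multidegree, one \<open>0, \<plusminus>1\<close> vector already lowers
it (\<open>conformal_exchange\<close>); the effect of such a step depends on the signs of the exponent vector
only, so the squarefree monomial with the same signs can be lowered too.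

\<^item> (ii) implies that \<open>S\<close> is normal. If the initial ideal is squarefree, every monomial supported on a
standard monomial is standard, and standard monomials are determined by their multidegrees. So an
identity between multiples of elements of \<open>S\<close> lifts to an identity between exponent vectors, where
one can divide by integers (\<open>squarefree_imp_normal_semigroup\<close>).

\<^item> \<open>S\<close> is normal if and only if the ring is. For the difficult direction, a fraction \<open>a / b\<close> that is
integral over the ring is almost integral. This forces the quotient of the leading terms of \<open>a\<close> and
\<open>b\<close> into the ring, and subtracting it makes \<open>a\<close> smaller; as the height bounds a finite part of \<open>S\<close>,
the division of \<open>a\<close> by \<open>b\<close> terminates (\<open>almost_integral_divides\<close>).

\<^item> Normality implies (iv). For disjoint odd cycles \<open>c\<close> and \<open>c'\<close>, the difference of the indicator vectors
of their vertex sets, at height half the number of their vertices, is half the signed sum of the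
edges. It is an integer combination of edges because \<open>G\<close> is connected. In a representation by
elements of \<open>S\<close> every summand would be an edge inside \<open>c\<close> or a negative edge inside \<open>c'\<close>, which
is impossible as \<open>c\<close> has odd length (\<open>normal_semigroup_imp_odd_cycles_meet\<close>).

\<^item> Unimodularity. In a unit conformal matrix of full rank, each column is an integer combination of any
column basis, so all maximal minors divide each other. Conversely, the edges of two disjoint odd
cycles extend to a column basis; in a unimodular matrix the vector above would be an integer
combination of that basis, whereas its coefficients are \<open>\<plusminus>1/2\<close>. For bipartite graphs (iii) and (iv)
both hold, since there are no odd cycles.\<close>

section \<open>Toric rings and toric ideals in terms of exponents\<close>

definition multidegree :: "(nat \<Rightarrow> (nat \<Rightarrow>\<^sub>0 int)) \<Rightarrow> nat \<Rightarrow> (nat \<Rightarrow>\<^sub>0 nat) \<Rightarrow> (nat \<Rightarrow>\<^sub>0 int)" where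
  "multidegree \<gamma> m u = (\<Sum>i<m. of_nat (Poly_Mapping.lookup u i) * \<gamma> i)"

definition semigroup_of :: "(nat \<Rightarrow> (nat \<Rightarrow>\<^sub>0 int)) \<Rightarrow> nat \<Rightarrow> (nat \<Rightarrow>\<^sub>0 int) set" where
  "semigroup_of \<gamma> m = multidegree \<gamma> m ` monomials m"

definition column_exponent :: "int mat \<Rightarrow> nat \<Rightarrow> (nat \<Rightarrow>\<^sub>0 int)" where
  "column_exponent C j =
     (\<Sum>i<dim_vec (col C j). Poly_Mapping.single i (col C j $ i))"

lemma lookup_of_nat_mult:
  "Poly_Mapping.lookup (of_nat n * (g :: nat \<Rightarrow>\<^sub>0 int)) k = of_nat n * Poly_Mapping.lookup g k"
  by (induction n) (simp_all add: algebra_simps lookup_add)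

lemma lookup_column_exponent:
  assumes "j < dim_col C"
  shows "Poly_Mapping.lookup (column_exponent C j) i = (if i < dim_row C then C $$ (i, j) else 0)"
proof -
  have "Poly_Mapping.lookup (column_exponent C j) i
      = (\<Sum>k<dim_row C. (col C j $ k when k = i))"
    unfolding column_exponent_def by (simp add: lookup_sum lookup_single)
  also have "\<dots> = (\<Sum>k<dim_row C. (if i = k then col C j $ k else 0))"
    by (intro sum.cong refl) (auto simp: when_def)
  also have "\<dots> = (if i < dim_row C then col C j $ i else 0)"
    by (subst sum.delta') auto
  finally show ?thesis using assms by simp
qed

lemma monomials_iff: "u \<in> monomials m \<longleftrightarrow> (\<forall>i. Poly_Mapping.lookup u i \<noteq> 0 \<longrightarrow> i < m)"
  by (auto simp: monomials_def in_keys_iff subset_eq)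

lemma zero_in_monomials [simp]: "0 \<in> monomials m"
  by (simp add: monomials_def)

lemma add_in_monomials [simp]:
  "u \<in> monomials m \<Longrightarrow> v \<in> monomials m \<Longrightarrow> u + v \<in> monomials m"
  unfolding monomials_def using keys_add[of u v] by blast

lemma diff_in_monomials [simp]: "u \<in> monomials m \<Longrightarrow> u - v \<in> monomials m"
  by (auto simp: monomials_iff lookup_minus)

lemma single_in_monomials [simp]: "i < m \<Longrightarrow> Poly_Mapping.single i n \<in> monomials m"
  by (auto simp: monomials_def split: if_splits)

lemma lookup_outside_monomials: "u \<in> monomials m \<Longrightarrow> \<not> i < m \<Longrightarrow> Poly_Mapping.lookup u i = 0"
  by (auto simp: monomials_def in_keys_iff)

lemma monomials_eqI:
  "u \<in> monomials m \<Longrightarrow> v \<in> monomials m \<Longrightarrow>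
   (\<And>i. i < m \<Longrightarrow> Poly_Mapping.lookup u i = Poly_Mapping.lookup v i) \<Longrightarrow> u = v"
  by (rule poly_mapping_eqI) (metis lookup_outside_monomials)

lemma multidegree_zero [simp]: "multidegree \<gamma> m 0 = 0"
  by (simp add: multidegree_def)

lemma multidegree_add: "multidegree \<gamma> m (u + v) = multidegree \<gamma> m u + multidegree \<gamma> m v"
  by (simp add: multidegree_def lookup_add algebra_simps sum.distrib)

lemma multidegree_of_nat_mult:
  "multidegree \<gamma> m (of_nat n * u) = of_nat n * multidegree \<gamma> m u"
  by (induction n) (simp_all add: algebra_simps multidegree_add)

lemma lookup_of_nat_mult_nat:
  "Poly_Mapping.lookup (of_nat n * (g :: nat \<Rightarrow>\<^sub>0 nat)) k = n * Poly_Mapping.lookup g k"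
  by (induction n) (simp_all add: algebra_simps lookup_add)

lemma of_nat_mult_in_monomials [simp]: "u \<in> monomials m \<Longrightarrow> of_nat n * u \<in> monomials m"
  by (auto simp: monomials_iff lookup_of_nat_mult_nat)

lemma multidegree_single: "i < m \<Longrightarrow> multidegree \<gamma> m (Poly_Mapping.single i 1) = \<gamma> i"
proof -
  assume "i < m"
  have "multidegree \<gamma> m (Poly_Mapping.single i 1) = (\<Sum>j<m. if i = j then \<gamma> j else 0)"
    unfolding multidegree_def by (intro sum.cong refl) (auto simp: lookup_single when_def)
  also have "\<dots> = \<gamma> i" using \<open>i < m\<close> by (subst sum.delta') auto
  finally show ?thesis .
qed

lemma zero_in_semigroup [simp]: "0 \<in> semigroup_of \<gamma> m"
  unfolding semigroup_of_def by (metis multidegree_zero zero_in_monomials image_eqI)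

lemma add_in_semigroup [simp]:
  "a \<in> semigroup_of \<gamma> m \<Longrightarrow> b \<in> semigroup_of \<gamma> m \<Longrightarrow> a + b \<in> semigroup_of \<gamma> m"
  unfolding semigroup_of_def by (auto simp: multidegree_add[symmetric])

lemma of_nat_mult_in_semigroup [simp]:
  "a \<in> semigroup_of \<gamma> m \<Longrightarrow> of_nat n * a \<in> semigroup_of \<gamma> m"
  by (induction n) (simp_all add: algebra_simps)

lemma generator_in_semigroup [simp]: "i < m \<Longrightarrow> \<gamma> i \<in> semigroup_of \<gamma> m"
  unfolding semigroup_of_def by (metis multidegree_single single_in_monomials image_eqI)

lemma sum_of_terms:
  fixes f :: "'a \<Rightarrow>\<^sub>0 'b::comm_monoid_add"
  shows "f = (\<Sum>k\<in>Poly_Mapping.keys f. Poly_Mapping.single k (Poly_Mapping.lookup f k))"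
proof (rule poly_mapping_eqI)
  fix i
  have "(\<Sum>k\<in>Poly_Mapping.keys f. Poly_Mapping.lookup f k when k = i)
      = (\<Sum>k\<in>Poly_Mapping.keys f. if i = k then Poly_Mapping.lookup f k else 0)"
    by (intro sum.cong refl) (auto simp: when_def)
  then show "Poly_Mapping.lookup f i = Poly_Mapping.lookup
      (\<Sum>k\<in>Poly_Mapping.keys f. Poly_Mapping.single k (Poly_Mapping.lookup f k)) i"
    by (simp add: lookup_sum lookup_single sum.delta in_keys_iff)
qed

lemma laurent_monomial_power:
  "(Poly_Mapping.single (g :: nat \<Rightarrow>\<^sub>0 int) (1::'k::field)) ^ n = Poly_Mapping.single (of_nat n * g) 1"
  by (induction n) (simp_all add: mult_single algebra_simps)

lemma laurent_monomial_prod: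
  "finite K \<Longrightarrow> (\<Prod>i\<in>K. Poly_Mapping.single (h i :: nat \<Rightarrow>\<^sub>0 int) (1::'k::field))
     = Poly_Mapping.single (\<Sum>i\<in>K. h i) 1"
  by (induction K rule: finite_induct) (simp_all add: mult_single)

lemma laurent_monomial_col: "laurent_monomial (col C j) = Poly_Mapping.single (column_exponent C j) 1"
  by (simp add: laurent_monomial_def column_exponent_def)

text \<open>Each monomial is mapped to a Laurent monomial, so the homomorphism merely adds up coefficients along
the fibres of the multidegree.\<close>

lemma toric_hom_eq:
  fixes f :: "'k::field mpoly"
  assumes "f \<in> polys (dim_col C)"
  shows "toric_hom C f = (\<Sum>u\<in>Poly_Mapping.keys f.
    Poly_Mapping.single (multidegree (column_exponent C) (dim_col C) u) (Poly_Mapping.lookup f u))"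
  unfolding toric_hom_def
proof (intro sum.cong refl)
  fix u assume "u \<in> Poly_Mapping.keys f"
  then have u: "Poly_Mapping.keys u \<subseteq> {..<dim_col C}"
    using assms by (auto simp: polys_def monomials_def)
  have "(\<Sum>i\<in>Poly_Mapping.keys u. of_nat (Poly_Mapping.lookup u i) * column_exponent C i)
      = multidegree (column_exponent C) (dim_col C) u"
    unfolding multidegree_def
    by (intro sum.mono_neutral_left) (use u in \<open>auto simp: in_keys_iff\<close>)
  then have "(\<Prod>i\<in>Poly_Mapping.keys u. laurent_monomial (col C i) ^ Poly_Mapping.lookup u i)
     = (Poly_Mapping.single (multidegree (column_exponent C) (dim_col C) u) 1 :: 'k laurent)"
    by (simp add: laurent_monomial_col laurent_monomial_power laurent_monomial_prod)
  then show "Poly_Mapping.single 0 (Poly_Mapping.lookup f u) *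
      (\<Prod>i\<in>Poly_Mapping.keys u. laurent_monomial (col C i) ^ Poly_Mapping.lookup u i)
      = Poly_Mapping.single (multidegree (column_exponent C) (dim_col C) u) (Poly_Mapping.lookup f u)"
    by (simp add: mult_single)
qed

text \<open>The polynomials with exponents in the semigroup form a subalgebra; conversely, every monomial with
such an exponent is a product of powers of the generators.\<close>

lemma toric_ring_eq:
  "(toric_ring C :: 'k::field laurent set)
     = {f. Poly_Mapping.keys f \<subseteq> semigroup_of (column_exponent C) (dim_col C)}"
    (is "_ = ?R")
  unfolding toric_ring_def
proof (rule hull_unique)
  show "laurent_monomial ` set (cols C) \<subseteq> ?R"
    by (auto simp: cols_def laurent_monomial_col)
  show "subalgebra ?R"
    unfolding subalgebra_def
  proof (intro conjI ballI allI)
    fix f g :: "'k laurent" assume "f \<in> ?R" "g \<in> ?R"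
    then show "f + g \<in> ?R"
      using keys_add[of f g] by auto
    show "f * g \<in> ?R"
    proof clarify
      fix w assume "w \<in> Poly_Mapping.keys (f * g)"
      then obtain a b where "a \<in> Poly_Mapping.keys f" "b \<in> Poly_Mapping.keys g" "w = a + b"
        using keys_mult[of f g] by auto
      then show "w \<in> semigroup_of (column_exponent C) (dim_col C)"
        using \<open>f \<in> ?R\<close> \<open>g \<in> ?R\<close>
        by (metis add_in_semigroup mem_Collect_eq subsetD)
    qed
  qed auto
  fix T :: "'k laurent set"
  assume T: "laurent_monomial ` set (cols C) \<subseteq> T" "subalgebra T"
  have const: "Poly_Mapping.single 0 a \<in> T" for a using T(2) by (simp add: subalgebra_def)
  have add: "f \<in> T \<Longrightarrow> g \<in> T \<Longrightarrow> f + g \<in> T" for f g using T(2) by (simp add: subalgebra_def)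
  have mult: "f \<in> T \<Longrightarrow> g \<in> T \<Longrightarrow> f * g \<in> T" for f g using T(2) by (simp add: subalgebra_def)
  have gen: "Poly_Mapping.single (column_exponent C j) 1 \<in> T" if "j < dim_col C" for j
    using T(1) that by (auto simp: cols_def laurent_monomial_col[symmetric])
  have pow: "Poly_Mapping.single (of_nat n * column_exponent C j) 1 \<in> T" if "j < dim_col C" for j n
  proof (induction n)
    case (Suc n)
    from mult[OF gen[OF that] Suc] show ?case by (simp add: mult_single algebra_simps)
  qed (simp add: const del: single_one)
  have part: "Poly_Mapping.single (\<Sum>i<n. of_nat (Poly_Mapping.lookup u i) * column_exponent C i) 1 \<in> T"
    if "n \<le> dim_col C" for n u
    using that
  proof (induction n)
    case (Suc n)
    from mult[OF Suc.IH pow[of n "Poly_Mapping.lookup u n"]] Suc.prems show ?case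
      by (simp add: mult_single)
  qed (simp add: const del: single_one)
  show "?R \<subseteq> T"
  proof
    fix f assume "f \<in> ?R"
    then have *: "Poly_Mapping.single k c \<in> T" if "k \<in> Poly_Mapping.keys f" for k c
    proof -
      obtain u where "k = multidegree (column_exponent C) (dim_col C) u"
        using \<open>f \<in> ?R\<close> \<open>k \<in> Poly_Mapping.keys f\<close> by (auto simp: semigroup_of_def)
      with part[of "dim_col C" u] have "Poly_Mapping.single k 1 \<in> T" by (simp add: multidegree_def)
      from mult[OF const[of c] this] show ?thesis by (simp add: mult_single)
    qed
    have "(\<Sum>k\<in>K. Poly_Mapping.single k (Poly_Mapping.lookup f k)) \<in> T"
      if "finite K" "K \<subseteq> Poly_Mapping.keys f" for K
      using that
    proof (induction K rule: finite_induct)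
      case empty
      show ?case using const[of 0] by simp
    next
      case (insert x F)
      then show ?case using * add by auto
    qed
    from this[of "Poly_Mapping.keys f"] show "f \<in> T" by (simp flip: sum_of_terms)
  qed
qed

lemma toric_ideal_iff:
  fixes f :: "'k::field mpoly"
  shows "f \<in> toric_ideal C \<longleftrightarrow> f \<in> polys (dim_col C) \<and>
    (\<forall>g. (\<Sum>u | u \<in> Poly_Mapping.keys f \<and> multidegree (column_exponent C) (dim_col C) u = g.
        Poly_Mapping.lookup f u) = 0)"
proof -
  have "toric_hom C f = 0 \<longleftrightarrow>
      (\<forall>g. (\<Sum>u | u \<in> Poly_Mapping.keys f \<and> multidegree (column_exponent C) (dim_col C) u = g.
        Poly_Mapping.lookup f u) = 0)" if "f \<in> polys (dim_col C)"
    unfolding toric_hom_eq[OF that] poly_mapping_eq_iff fun_eq_iff lookup_sum lookup_single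
      lookup_zero when_def
    by (subst sum.inter_filter[symmetric]) simp_all
  then show ?thesis by (auto simp: toric_ideal_def)
qed

section \<open>Initial ideals of toric ideals\<close>

lemma monomial_order_dest:
  assumes "monomial_order m r"
  shows "u \<in> monomials m \<Longrightarrow> (u, u) \<in> r"
    and "(u, v) \<in> r \<Longrightarrow> (v, u) \<in> r \<Longrightarrow> u = v"
    and "(u, v) \<in> r \<Longrightarrow> (v, w) \<in> r \<Longrightarrow> (u, w) \<in> r"
    and "u \<in> monomials m \<Longrightarrow> v \<in> monomials m \<Longrightarrow> (u, v) \<in> r \<or> (v, u) \<in> r"
    and "u \<in> monomials m \<Longrightarrow> (0, u) \<in> r"
    and "w \<in> monomials m \<Longrightarrow> (u, v) \<in> r \<Longrightarrow> (u + w, v + w) \<in> r"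
    and "r \<subseteq> monomials m \<times> monomials m"
proof -
  from assms have "linear_order_on (monomials m) r" by (simp add: monomial_order_def)
  then have *: "refl_on (monomials m) r" "trans r" "antisym r" "total_on (monomials m) r"
    "r \<subseteq> monomials m \<times> monomials m"
    by (auto simp: linear_order_on_def partial_order_on_def preorder_on_def)
  show r: "u \<in> monomials m \<Longrightarrow> (u, u) \<in> r" for u using *(1) by (rule refl_onD)
  show "(u, v) \<in> r \<Longrightarrow> (v, u) \<in> r \<Longrightarrow> u = v" using *(3) by (rule antisymD)
  show "(u, v) \<in> r \<Longrightarrow> (v, w) \<in> r \<Longrightarrow> (u, w) \<in> r" using *(2) by (rule transD)
  show "u \<in> monomials m \<Longrightarrow> v \<in> monomials m \<Longrightarrow> (u, v) \<in> r \<or> (v, u) \<in> r"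
    using *(4) r by (metis total_on_def)
  show "r \<subseteq> monomials m \<times> monomials m" by fact
qed (use assms in \<open>auto simp: monomial_order_def\<close>)

lemma finite_linear_order_greatest:
  assumes "finite K" "K \<noteq> {}" "K \<subseteq> monomials m" "monomial_order m r"
  shows "\<exists>u\<in>K. \<forall>v\<in>K. (v, u) \<in> r"
  using assms(1-3)
proof (induction K rule: finite_ne_induct)
  case (singleton x)
  then show ?case using monomial_order_dest(1)[OF assms(4)] by auto
next
  case (insert x F)
  then obtain u where u: "u \<in> F" "\<forall>v\<in>F. (v, u) \<in> r" by auto
  have "(x, u) \<in> r \<or> (u, x) \<in> r" and x: "(x, x) \<in> r"
    using monomial_order_dest(1)[OF assms(4), of x] monomial_order_dest(4)[OF assms(4), of x u]
      insert.prems u by auto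
  from this(1) show ?case
  proof
    assume "(x, u) \<in> r"
    with u show ?thesis by auto
  next
    assume "(u, x) \<in> r"
    with u x monomial_order_dest(3)[OF assms(4)] show ?thesis by (intro bexI[of _ x]) blast+
  qed
qed

lemma finite_linear_order_least:
  assumes "finite K" "K \<noteq> {}" "K \<subseteq> monomials m" "monomial_order m r"
  shows "\<exists>u\<in>K. \<forall>v\<in>K. (u, v) \<in> r"
  using assms(1-3)
proof (induction K rule: finite_ne_induct)
  case (singleton x)
  then show ?case using monomial_order_dest(1)[OF assms(4)] by auto
next
  case (insert x F)
  then obtain u where u: "u \<in> F" "\<forall>v\<in>F. (u, v) \<in> r" by auto
  have "(u, x) \<in> r \<or> (x, u) \<in> r" and x: "(x, x) \<in> r"
    using monomial_order_dest(1)[OF assms(4), of x] monomial_order_dest(4)[OF assms(4), of x u]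
      insert.prems u by auto
  from this(1) show ?case
  proof
    assume "(u, x) \<in> r"
    with u show ?thesis by auto
  next
    assume "(x, u) \<in> r"
    with u x monomial_order_dest(3)[OF assms(4)] show ?thesis by (intro bexI[of _ x]) blast+
  qed
qed

lemma initial_monomial:
  assumes r: "monomial_order m r" and f: "f \<in> polys m" "f \<noteq> 0"
  shows "initial_monomial r f \<in> Poly_Mapping.keys f"
    and "v \<in> Poly_Mapping.keys f \<Longrightarrow> (v, initial_monomial r f) \<in> r"
proof -
  have "\<exists>u\<in>Poly_Mapping.keys f. \<forall>v\<in>Poly_Mapping.keys f. (v, u) \<in> r"
    using f by (intro finite_linear_order_greatest[OF _ _ _ r])
      (auto simp: polys_def poly_mapping_eq_iff fun_eq_iff in_keys_iff)
  then obtain u where u: "u \<in> Poly_Mapping.keys f \<and> (\<forall>v\<in>Poly_Mapping.keys f. (v, u) \<in> r)" by blast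
  have "initial_monomial r f \<in> Poly_Mapping.keys f \<and>
      (\<forall>v\<in>Poly_Mapping.keys f. (v, initial_monomial r f) \<in> r)"
    unfolding initial_monomial_def
    using u by (rule theI) (use u monomial_order_dest(2)[OF r] in blast)
  then show "initial_monomial r f \<in> Poly_Mapping.keys f"
    and "v \<in> Poly_Mapping.keys f \<Longrightarrow> (v, initial_monomial r f) \<in> r" by auto
qed

lemma single_in_polys [simp]: "u \<in> monomials m \<Longrightarrow> Poly_Mapping.single u c \<in> polys m"
  by (auto simp: polys_def)

lemma monomial_ideal_subset:
  assumes "\<And>u. u \<in> U \<Longrightarrow> \<exists>u'\<in>U'. \<exists>v\<in>monomials m. u = u' + v"
  shows "(monomial_ideal m U :: 'k::field mpoly set) \<subseteq> monomial_ideal m U'"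
  unfolding monomial_ideal_def
proof (subst (2) hull_def, rule Inter_greatest, clarify)
  fix T f assume T: "poly_ideal m T" "(\<lambda>u. Poly_Mapping.single u (1::'k)) ` U' \<subseteq> T"
    and f: "f \<in> poly_ideal m hull (\<lambda>u. Poly_Mapping.single u (1::'k)) ` U"
  have "(\<lambda>u. Poly_Mapping.single u (1::'k)) ` U \<subseteq> T"
  proof clarify
    fix u assume "u \<in> U"
    from assms[OF this] obtain u' v where u': "u' \<in> U'" "v \<in> monomials m" "u = u' + v" by auto
    have "Poly_Mapping.single v (1::'k) * Poly_Mapping.single u' 1 \<in> T"
      using T u' by (auto simp: poly_ideal_def)
    then show "Poly_Mapping.single u (1::'k) \<in> T"
      using u' by (simp add: mult_single add.commute)
  qed
  from hull_minimal[where S = "poly_ideal m", OF this T(1)] f show "f \<in> T" by blast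
qed

lemma monomial_in_monomial_ideal:
  assumes "U \<subseteq> monomials m"
  shows "Poly_Mapping.single w (1::'k::field) \<in> monomial_ideal m U \<longleftrightarrow>
    (\<exists>u\<in>U. \<exists>v\<in>monomials m. w = u + v)" (is "?l \<longleftrightarrow> ?r")
proof
  let ?J = "{f \<in> polys m. \<forall>w\<in>Poly_Mapping.keys f. \<exists>u\<in>U. \<exists>v\<in>monomials m. w = u + v} :: 'k mpoly set"
  have "poly_ideal m ?J"
    unfolding poly_ideal_def
  proof (intro conjI ballI)
    fix f g :: "'k mpoly" assume fg: "f \<in> ?J" "g \<in> ?J"
    from fg have "\<exists>u\<in>U. \<exists>v\<in>monomials m. w = u + v" "w \<in> monomials m"
      if "w \<in> Poly_Mapping.keys f \<union> Poly_Mapping.keys g" for w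
      using that by (auto simp: polys_def)
    then show "f + g \<in> ?J" using keys_add[of f g] by (auto simp: polys_def)
  next
    fix f g :: "'k mpoly" assume fg: "f \<in> polys m" "g \<in> ?J"
    have "\<exists>u\<in>U. \<exists>v\<in>monomials m. w = u + v" if "w \<in> Poly_Mapping.keys (f * g)" for w
    proof -
      from that keys_mult[of f g] obtain a b
        where ab: "a \<in> Poly_Mapping.keys f" "b \<in> Poly_Mapping.keys g" "w = a + b" by auto
      with fg obtain u v where "u \<in> U" "v \<in> monomials m" "b = u + v" by auto
      with ab fg have "w = u + (v + a)" "v + a \<in> monomials m" by (auto simp: polys_def ac_simps)
      with \<open>u \<in> U\<close> show ?thesis by blast
    qed
    moreover from this have "f * g \<in> polys m" using assms by (force simp: polys_def)
    ultimately show "f * g \<in> ?J" by blast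
  qed (auto simp: polys_def)
  moreover have "(\<lambda>u. Poly_Mapping.single u (1::'k)) ` U \<subseteq> ?J"
  proof (rule image_subsetI)
    fix u assume "u \<in> U"
    then have "\<exists>u'\<in>U. \<exists>v\<in>monomials m. u = u' + v"
      by (intro bexI[of _ u] bexI[of _ 0]) auto
    then show "Poly_Mapping.single u (1::'k) \<in> ?J"
      using assms \<open>u \<in> U\<close> by auto
  qed
  ultimately have "monomial_ideal m U \<subseteq> ?J" unfolding monomial_ideal_def by (intro hull_minimal)
  then show "?l \<Longrightarrow> ?r" by auto
next
  assume ?r
  then have "monomial_ideal m {w} \<subseteq> (monomial_ideal m U :: 'k mpoly set)"
    by (intro monomial_ideal_subset) auto
  then show ?l by (auto simp: monomial_ideal_def intro: hull_inc)
qed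

text \<open>A monomial that is not the least one of its multidegree. These are the monomials of the initial ideal
of the toric ideal, described without reference to the field.\<close>

definition nonstandard ::
    "(nat \<Rightarrow> (nat \<Rightarrow>\<^sub>0 int)) \<Rightarrow> nat \<Rightarrow> (nat \<Rightarrow>\<^sub>0 nat) rel \<Rightarrow> (nat \<Rightarrow>\<^sub>0 nat) \<Rightarrow> bool" where
  "nonstandard \<gamma> m r w \<longleftrightarrow> w \<in> monomials m \<and>
     (\<exists>v\<in>monomials m. multidegree \<gamma> m v = multidegree \<gamma> m w \<and> v \<noteq> w \<and> (v, w) \<in> r)"

lemma nonstandard_add:
  assumes "monomial_order m r" "nonstandard \<gamma> m r u" "v \<in> monomials m"
  shows "nonstandard \<gamma> m r (u + v)"
proof -
  obtain w where "u \<in> monomials m" "w \<in> monomials m" "multidegree \<gamma> m w = multidegree \<gamma> m u"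
    "w \<noteq> u" "(w, u) \<in> r" using assms(2) by (auto simp: nonstandard_def)
  then show ?thesis using assms(3) monomial_order_dest(6)[OF assms(1)]
    unfolding nonstandard_def by (auto intro!: bexI[of _ "w + v"] simp: multidegree_add)
qed

text \<open>The coefficients of an element of the toric ideal sum to zero over each multidegree, so its initial
monomial is accompanied by a smaller monomial of the same multidegree. Conversely, two monomials of
equal multidegree give a binomial in the toric ideal.\<close>

lemma initial_toric_iff_nonstandard:
  fixes C
  defines "\<gamma> \<equiv> column_exponent C" and "m \<equiv> dim_col C"
  assumes r: "monomial_order m r"
  shows "(\<exists>u\<in>initial_monomial r ` (toric_ideal C - {0 :: 'k::field mpoly}).
      \<exists>v\<in>monomials m. w = u + v) \<longleftrightarrow> nonstandard \<gamma> m r w" (is "?l \<longleftrightarrow> ?r")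
proof
  assume ?l
  then obtain f :: "'k mpoly" and v where f: "f \<in> toric_ideal C" "f \<noteq> 0" "v \<in> monomials m"
    "w = initial_monomial r f + v" by auto
  let ?u = "initial_monomial r f"
  have fp: "f \<in> polys m" using f by (simp add: toric_ideal_def m_def)
  note im = initial_monomial[OF r fp f(2)]
  let ?F = "{u. u \<in> Poly_Mapping.keys f \<and> multidegree \<gamma> m u = multidegree \<gamma> m ?u}"
  have "(\<Sum>u\<in>?F. Poly_Mapping.lookup f u) = 0"
    using f(1) unfolding toric_ideal_iff \<gamma>_def m_def by blast
  moreover have "?F = {?u} \<Longrightarrow> (\<Sum>u\<in>?F. Poly_Mapping.lookup f u) \<noteq> 0"
    using im(1) by (simp add: in_keys_iff)
  ultimately obtain v' where v': "v' \<in> ?F" "v' \<noteq> ?u" using im(1) by blast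
  have "nonstandard \<gamma> m r ?u"
    unfolding nonstandard_def using v' im fp by (auto simp: polys_def)
  then show ?r using nonstandard_add[OF r _ f(3)] f(4) by simp
next
  assume ?r
  then obtain v where v: "w \<in> monomials m" "v \<in> monomials m" "multidegree \<gamma> m v = multidegree \<gamma> m w"
    "v \<noteq> w" "(v, w) \<in> r" by (auto simp: nonstandard_def)
  let ?f = "Poly_Mapping.single w 1 + Poly_Mapping.single v (-1) :: 'k mpoly"
  have lk: "Poly_Mapping.lookup ?f u = (if u = w then 1 else if u = v then -1 else 0)" for u
    using v(4) by (simp add: lookup_add lookup_single when_def)
  have keys: "Poly_Mapping.keys ?f = {v, w}"
    unfolding keys.rep_eq lk using v(4) by auto
  have fp: "?f \<in> polys m" using keys v by (auto simp: polys_def)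
  have "(\<Sum>u | u \<in> Poly_Mapping.keys ?f \<and> multidegree \<gamma> m u = g. Poly_Mapping.lookup ?f u) = 0" for g
  proof -
    have "{u. u \<in> Poly_Mapping.keys ?f \<and> multidegree \<gamma> m u = g}
        = (if multidegree \<gamma> m w = g then {v, w} else {})"
      unfolding keys using v(3) by auto
    then show ?thesis using v(4) by (simp add: lk)
  qed
  then have fI: "?f \<in> toric_ideal C" unfolding toric_ideal_iff using fp by (simp add: m_def \<gamma>_def)
  have "?f \<noteq> 0" using keys by (metis keys_zero insert_not_empty)
  then have "initial_monomial r ?f = w"
    using initial_monomial[OF r fp] monomial_order_dest(2)[OF r] v(4,5)
    unfolding keys by (metis insert_iff singletonD)
  then show ?l using fI \<open>?f \<noteq> 0\<close>
    by (intro bexI[of _ w] bexI[of _ 0] image_eqI[of _ _ ?f]) auto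
qed

text \<open>A monomial ideal is determined by its monomials, which for the initial ideal are the nonstandard ones.
It is generated by squarefree monomials if and only if each of them has a squarefree divisor of the
same kind.\<close>

lemma squarefree_initial_ideal_iff:
  fixes C
  defines "\<gamma> \<equiv> column_exponent C" and "m \<equiv> dim_col C"
  shows "has_squarefree_initial_ideal m (toric_ideal C :: 'k::field mpoly set) \<longleftrightarrow>
    (\<exists>r. monomial_order m r \<and> (\<forall>w. nonstandard \<gamma> m r w \<longrightarrow>
      (\<exists>u v. v \<in> monomials m \<and> w = u + v \<and> squarefree_monomial u \<and> nonstandard \<gamma> m r u)))"
    (is "_ \<longleftrightarrow> (\<exists>r. _ \<and> ?P r)")
proof -
  have "(\<exists>U \<subseteq> monomials m. (\<forall>u\<in>U. squarefree_monomial u) \<and>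
          initial_ideal m r (toric_ideal C :: 'k mpoly set) = monomial_ideal m U) \<longleftrightarrow> ?P r" (is "?l = _")
    if r: "monomial_order m r" for r
  proof
    let ?I = "initial_monomial r ` (toric_ideal C - {0 :: 'k mpoly})"
    have I: "?I \<subseteq> monomials m"
      using initial_monomial(1)[OF r] by (fastforce simp: toric_ideal_def m_def polys_def)
    note ns = initial_toric_iff_nonstandard[where C = C and 'k = 'k, folded \<gamma>_def m_def, OF r]
    {
      assume ?l
      then obtain U where U: "U \<subseteq> monomials m" "\<forall>u\<in>U. squarefree_monomial u"
        "monomial_ideal m ?I = (monomial_ideal m U :: 'k mpoly set)"
        by (auto simp: initial_ideal_def)
      have iff: "nonstandard \<gamma> m r w \<longleftrightarrow> (\<exists>u\<in>U. \<exists>v\<in>monomials m. w = u + v)" for w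
      proof -
        have "nonstandard \<gamma> m r w \<longleftrightarrow> Poly_Mapping.single w (1::'k) \<in> monomial_ideal m ?I"
          unfolding monomial_in_monomial_ideal[OF I] by (rule ns[symmetric])
        then show ?thesis unfolding U(3) monomial_in_monomial_ideal[OF U(1)] .
      qed
      show "?P r"
      proof (intro allI impI)
        fix w assume "nonstandard \<gamma> m r w"
        then obtain u v where uv: "u \<in> U" "v \<in> monomials m" "w = u + v" using iff by blast
        moreover have "nonstandard \<gamma> m r u"
          using iff[of u] uv(1) by (metis add.right_neutral zero_in_monomials)
        ultimately show "\<exists>u v. v \<in> monomials m \<and> w = u + v \<and> squarefree_monomial u \<and>
            nonstandard \<gamma> m r u" using U(2) by blast
      qed
    }
    {
      assume P: "?P r"
      let ?U = "{u. squarefree_monomial u \<and> nonstandard \<gamma> m r u}"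
      have "(monomial_ideal m ?I :: 'k mpoly set) = monomial_ideal m ?U"
      proof (intro equalityI monomial_ideal_subset)
        fix w assume "w \<in> ?I"
        then have "nonstandard \<gamma> m r w"
          using ns[of w] by (metis add.right_neutral zero_in_monomials)
        with P show "\<exists>u'\<in>?U. \<exists>v\<in>monomials m. w = u' + v" by blast
      next
        fix w assume "w \<in> ?U"
        then show "\<exists>u'\<in>?I. \<exists>v\<in>monomials m. w = u' + v" using ns[of w] by blast
      qed
      moreover have "?U \<subseteq> monomials m" by (auto simp: nonstandard_def)
      ultimately show ?l unfolding initial_ideal_def by blast
    }
  qed
  then show ?thesis unfolding has_squarefree_initial_ideal_def by blast
qed

section \<open>Squarefree initial ideals and normal semigroups\<close>

text \<open>Normality of the semigroup: it contains every element of its group that lies in its cone. Elements of the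
group are written as differences, and those of the cone are described by clearing denominators.\<close>

definition normal_semigroup :: "(nat \<Rightarrow> (nat \<Rightarrow>\<^sub>0 int)) \<Rightarrow> nat \<Rightarrow> bool" where
  "normal_semigroup \<gamma> m \<longleftrightarrow> (\<forall>p\<in>semigroup_of \<gamma> m. \<forall>q\<in>semigroup_of \<gamma> m. \<forall>k>0.
     of_nat k * (p - q) \<in> semigroup_of \<gamma> m \<longrightarrow> p - q \<in> semigroup_of \<gamma> m)"

lemma nat_seq_incseq_subseq:
  fixes s :: "nat \<Rightarrow> nat"
  shows "\<exists>\<phi>. strict_mono \<phi> \<and> incseq (\<lambda>n. s (\<phi> n))"
proof -
  obtain \<phi> where \<phi>: "strict_mono (\<phi> :: nat \<Rightarrow> nat)" "monoseq (\<lambda>n. s (\<phi> n))"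
    using seq_monosub by blast
  show ?thesis
  proof (cases "incseq (\<lambda>n. s (\<phi> n))")
    case False
    with \<phi>(2) have dec: "decseq (\<lambda>n. s (\<phi> n))" by (simp add: monoseq_iff)
    define N where "N = (ARG_MIN (\<lambda>n. s (\<phi> n)) n. True)"
    have min: "s (\<phi> N) \<le> s (\<phi> n)" for n unfolding N_def by (rule arg_min_nat_le) simp
    have "s (\<phi> (n + N)) = s (\<phi> N)" for n
      using min[of "n + N"] decseqD[OF dec, of N "n + N"] by simp
    moreover have "strict_mono (\<lambda>n. \<phi> (n + N))" using \<phi>(1) by (simp add: strict_mono_def)
    ultimately show ?thesis by (intro exI[of _ "\<lambda>n. \<phi> (n + N)"]) (simp add: incseq_def)
  qed (use \<phi>(1) in blast)
qed

lemma Dickson_subseq: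
  fixes f :: "nat \<Rightarrow> nat \<Rightarrow> nat"
  shows "\<exists>\<phi>. strict_mono \<phi> \<and> (\<forall>i<m. incseq (\<lambda>n. f (\<phi> n) i))"
proof (induction m)
  case 0
  show ?case by (auto intro!: exI[of _ id] simp: strict_mono_def)
next
  case (Suc m)
  then obtain \<phi> where \<phi>: "strict_mono \<phi>" "\<forall>i<m. incseq (\<lambda>n. f (\<phi> n) i)" by blast
  obtain \<psi> where \<psi>: "strict_mono \<psi>" "incseq (\<lambda>n. f (\<phi> (\<psi> n)) m)"
    using nat_seq_incseq_subseq[of "\<lambda>n. f (\<phi> n) m"] by blast
  have "incseq (\<lambda>n. f (\<phi> (\<psi> n)) i)" if "i < m" for i
    using \<phi>(2) that strict_mono_mono[OF \<psi>(1)] unfolding incseq_def mono_def by blast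
  then have "\<forall>i<Suc m. incseq (\<lambda>n. f (\<phi> (\<psi> n)) i)" using \<psi>(2) by (auto simp: less_Suc_eq)
  moreover have "strict_mono (\<lambda>n. \<phi> (\<psi> n))" using \<phi>(1) \<psi>(1) by (simp add: strict_mono_def)
  ultimately show ?case by blast
qed

text \<open>Dickson's lemma: infinitely many monomials include two of which one divides the other.\<close>

lemma Dickson:
  fixes f :: "nat \<Rightarrow> nat \<Rightarrow>\<^sub>0 nat"
  assumes "infinite T" "\<And>n. n \<in> T \<Longrightarrow> f n \<in> monomials m"
  shows "\<exists>a\<in>T. \<exists>b\<in>T. a < b \<and> (\<exists>w\<in>monomials m. f b = f a + w)"
proof -
  obtain \<phi> where \<phi>: "strict_mono \<phi>"
    "\<forall>i<m. incseq (\<lambda>n. Poly_Mapping.lookup (f (enumerate T (\<phi> n))) i)"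
    using Dickson_subseq[of m "\<lambda>n. Poly_Mapping.lookup (f (enumerate T n))"] by blast
  define a b where "a = enumerate T (\<phi> 0)" and "b = enumerate T (\<phi> 1)"
  have ab: "a \<in> T" "b \<in> T" unfolding a_def b_def using assms(1) by (simp_all add: enumerate_in_set)
  have "a < b" unfolding a_def b_def using assms(1) \<phi>(1)
    by (intro enumerate_mono) (auto simp: strict_mono_def)
  have "Poly_Mapping.lookup (f a) i \<le> Poly_Mapping.lookup (f b) i" for i
    using \<phi>(2) assms(2)[OF ab(1)] unfolding a_def b_def
    by (cases "i < m") (auto simp: incseq_def lookup_outside_monomials)
  then have "f b = f a + (f b - f a)"
    by (intro poly_mapping_eqI) (simp add: lookup_add lookup_minus)
  then show ?thesis using ab \<open>a < b\<close> assms(2)[OF ab(2)] diff_in_monomials by blast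
qed

lemma finite_bounded_monomials:
  "finite {u \<in> monomials m. (\<Sum>i<m. Poly_Mapping.lookup u i) \<le> h}" (is "finite ?M")
proof (rule inj_on_finite[where f = "\<lambda>u. restrict (Poly_Mapping.lookup u) {..<m}"])
  show "inj_on (\<lambda>u. restrict (Poly_Mapping.lookup u) {..<m}) ?M"
  proof (rule inj_onI)
    fix u v assume "u \<in> ?M" "v \<in> ?M"
      "restrict (Poly_Mapping.lookup u) {..<m} = restrict (Poly_Mapping.lookup v) {..<m}"
    then show "u = v" by (intro monomials_eqI[of _ m]) (auto simp: restrict_def fun_eq_iff, metis)
  qed
  show "(\<lambda>u. restrict (Poly_Mapping.lookup u) {..<m}) ` ?M \<subseteq> {..<m} \<rightarrow>\<^sub>E {..h}"
  proof (intro image_subsetI)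
    fix u assume u: "u \<in> ?M"
    have "Poly_Mapping.lookup u i \<le> h" if "i < m" for i
      using u member_le_sum[of i "{..<m}" "Poly_Mapping.lookup u"] that by auto
    then show "restrict (Poly_Mapping.lookup u) {..<m} \<in> {..<m} \<rightarrow>\<^sub>E {..h}" by auto
  qed
  show "finite ({..<m} \<rightarrow>\<^sub>E {..h})" by (intro finite_PiE) auto
qed

lemma lookup_height_multidegree:
  assumes "\<And>i. i < m \<Longrightarrow> Poly_Mapping.lookup (\<gamma> i) ht = 1"
  shows "Poly_Mapping.lookup (multidegree \<gamma> m u) ht = int (\<Sum>i<m. Poly_Mapping.lookup u i)"
  unfolding multidegree_def by (simp add: lookup_sum lookup_of_nat_mult assms)

text \<open>The coordinate \<open>ht\<close> of the multidegree is the total degree, which bounds all exponents.\<close>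

lemma finite_fibre:
  assumes "\<And>i. i < m \<Longrightarrow> Poly_Mapping.lookup (\<gamma> i) ht = 1"
  shows "finite {u \<in> monomials m. multidegree \<gamma> m u = g}"
  by (rule finite_subset[OF _ finite_bounded_monomials[of m "nat (Poly_Mapping.lookup g ht)"]])
    (use lookup_height_multidegree[of m \<gamma> ht, OF assms] in \<open>auto simp del: of_nat_sum\<close>)

definition standard ::
    "(nat \<Rightarrow> (nat \<Rightarrow>\<^sub>0 int)) \<Rightarrow> nat \<Rightarrow> (nat \<Rightarrow>\<^sub>0 nat) rel \<Rightarrow> (nat \<Rightarrow>\<^sub>0 nat) \<Rightarrow> bool" where
  "standard \<gamma> m r w \<longleftrightarrow> w \<in> monomials m \<and> \<not> nonstandard \<gamma> m r w"

lemma standard_exists: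
  assumes ht: "\<And>i. i < m \<Longrightarrow> Poly_Mapping.lookup (\<gamma> i) ht = 1"
    and r: "monomial_order m r" and g: "g \<in> semigroup_of \<gamma> m"
  shows "\<exists>w. standard \<gamma> m r w \<and> multidegree \<gamma> m w = g"
proof -
  let ?F = "{u \<in> monomials m. multidegree \<gamma> m u = g}"
  have "?F \<noteq> {}" using g by (auto simp: semigroup_of_def)
  with finite_linear_order_least[OF finite_fibre[of m \<gamma>, OF ht] _ _ r]
  obtain w where "w \<in> ?F" "\<forall>v\<in>?F. (w, v) \<in> r" by blast
  then show ?thesis using monomial_order_dest(2)[OF r]
    by (intro exI[of _ w]) (auto simp: standard_def nonstandard_def)
qed

lemma standard_unique:
  assumes "monomial_order m r" "standard \<gamma> m r w" "standard \<gamma> m r w'"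
    and "multidegree \<gamma> m w = multidegree \<gamma> m w'"
  shows "w = w'"
  using assms monomial_order_dest(4)[OF assms(1), of w w']
  by (auto simp: standard_def nonstandard_def)

text \<open>Nonstandardness is inherited from a squarefree divisor, and whether a squarefree monomial divides
depends on the support only.\<close>

lemma standard_if_supported:
  assumes r: "monomial_order m r"
    and sf: "\<forall>w. nonstandard \<gamma> m r w \<longrightarrow>
      (\<exists>u v. v \<in> monomials m \<and> w = u + v \<and> squarefree_monomial u \<and> nonstandard \<gamma> m r u)"
    and w: "standard \<gamma> m r w" and w': "w' \<in> monomials m"
    and supp: "Poly_Mapping.keys w' \<subseteq> Poly_Mapping.keys w"
  shows "standard \<gamma> m r w'"
proof (rule ccontr)
  assume "\<not> ?thesis"
  with w' sf obtain u v where uv: "w' = u + v" "squarefree_monomial u" "nonstandard \<gamma> m r u"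
    unfolding standard_def by blast
  have "Poly_Mapping.lookup u i \<le> Poly_Mapping.lookup w i" for i
  proof (cases "Poly_Mapping.lookup u i = 0")
    case False
    then have "i \<in> Poly_Mapping.keys w'" by (simp add: uv in_keys_iff lookup_add)
    with supp have "i \<in> Poly_Mapping.keys w" by blast
    then have "Poly_Mapping.lookup w i \<noteq> 0" by (simp add: in_keys_iff)
    moreover have "Poly_Mapping.lookup u i \<le> 1" using uv(2) by (simp add: squarefree_monomial_def)
    ultimately show ?thesis by linarith
  qed simp
  then have "w = u + (w - u)" by (intro poly_mapping_eqI) (simp add: lookup_add lookup_minus)
  moreover have "w - u \<in> monomials m" using w by (simp add: standard_def)
  ultimately show False using nonstandard_add[OF r uv(3)] w by (metis standard_def)
qed

text \<open>Let \<open>b = p - q\<close> with \<open>k b \<in> S\<close>, and let \<open>a\<close> be the product of all variables. Among the standard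
monomials \<open>f N\<close> of multidegree \<open>N k b + deg a\<close> infinitely many have the same support, so by Dickson's
lemma \<open>\<sigma> = f N\<^sub>1\<close> divides some \<open>f N\<^sub>2\<close> with the same support, and the quotient \<open>\<beta>\<close> has multidegree \<open>K b\<close>
with \<open>K > 0\<close>. Since \<open>a\<close> involves every variable, \<open>b + n deg \<sigma>\<close> lies in \<open>S\<close> for large \<open>n\<close>. Let \<open>c\<close> be
its standard monomial. Then \<open>K c\<close> and \<open>\<beta> + K n \<sigma>\<close> are standard of the same multidegree, hence equal, so
\<open>n \<sigma>\<close> divides \<open>c\<close> and the quotient has multidegree \<open>b\<close>.\<close>

theorem squarefree_imp_normal_semigroup:
  assumes ht: "\<And>i. i < m \<Longrightarrow> Poly_Mapping.lookup (\<gamma> i) ht = 1"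
    and r: "monomial_order m r"
    and sf: "\<forall>w. nonstandard \<gamma> m r w \<longrightarrow>
      (\<exists>u v. v \<in> monomials m \<and> w = u + v \<and> squarefree_monomial u \<and> nonstandard \<gamma> m r u)"
  shows "normal_semigroup \<gamma> m"
  unfolding normal_semigroup_def
proof (intro ballI allI impI)
  fix p q k
  assume p: "p \<in> semigroup_of \<gamma> m" and q: "q \<in> semigroup_of \<gamma> m" and "k > 0"
    and kb: "of_nat k * (p - q) \<in> semigroup_of \<gamma> m"
  let ?deg = "multidegree \<gamma> m" and ?S = "semigroup_of \<gamma> m"
  define b where "b = p - q"
  define a where "a = (\<Sum>i<m. Poly_Mapping.single i (1::nat))"
  have lka: "Poly_Mapping.lookup a i = (if i < m then 1 else 0)" for i
    unfolding a_def by (simp add: lookup_sum lookup_single when_def sum.delta')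
  have am: "a \<in> monomials m" by (simp add: monomials_iff lka)
  have "\<exists>w. standard \<gamma> m r w \<and> ?deg w = of_nat N * (of_nat k * b) + ?deg a" for N
  proof (rule standard_exists[of m \<gamma> ht, OF ht r])
    have "?deg a \<in> ?S" using am by (simp add: semigroup_of_def)
    then show "of_nat N * (of_nat k * b) + ?deg a \<in> ?S"
      using kb unfolding b_def by (simp del: of_nat_mult)
  qed
  then obtain f where f: "\<And>N. standard \<gamma> m r (f N)"
    "\<And>N. ?deg (f N) = of_nat N * (of_nat k * b) + ?deg a" by metis
  have "finite (range (\<lambda>N. Poly_Mapping.keys (f N)))"
    by (rule finite_subset[of _ "Pow {..<m}"])
      (use f(1) in \<open>auto simp: standard_def monomials_def\<close>)
  from pigeonhole_infinite[OF infinite_UNIV_nat this] obtain N0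
    where T: "infinite {N. Poly_Mapping.keys (f N) = Poly_Mapping.keys (f N0)}" by auto
  obtain N1 N2 \<beta> where N: "N1 < N2" "\<beta> \<in> monomials m" "f N2 = f N1 + \<beta>"
    "Poly_Mapping.keys (f N2) = Poly_Mapping.keys (f N1)"
    using Dickson[OF T, of f m] f(1) by (auto simp: standard_def)
  define \<sigma> where "\<sigma> = f N1"
  have \<sigma>: "standard \<gamma> m r \<sigma>" "\<sigma> \<in> monomials m" using f(1) by (auto simp: \<sigma>_def standard_def)
  define K where "K = (N2 - N1) * k"
  have "K > 0" using N(1) \<open>k > 0\<close> by (simp add: K_def)
  have Kb: "?deg \<beta> = of_nat K * b"
  proof -
    have "?deg \<beta> = ?deg (f N2) - ?deg (f N1)" by (simp add: N(3) multidegree_add)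
    then show ?thesis using N(1) by (simp add: f(2) K_def of_nat_diff left_diff_distrib mult.assoc)
  qed
  have \<beta>_supp: "Poly_Mapping.keys \<beta> \<subseteq> Poly_Mapping.keys \<sigma>"
    using N(3,4) by (auto simp: \<sigma>_def in_keys_iff lookup_add set_eq_iff)
  obtain uq where uq: "uq \<in> monomials m" "q = ?deg uq" using q by (auto simp: semigroup_of_def)
  (* this n exceeds every exponent of uq, so that uq divides the n-th power of a *)
  define n where "n = (\<Sum>i<m. Poly_Mapping.lookup uq i)"
  have le_n: "Poly_Mapping.lookup uq i \<le> n" if "i < m" for i
    unfolding n_def using member_le_sum[of i "{..<m}" "Poly_Mapping.lookup uq"] that by auto
  have "of_nat n * a = uq + (of_nat n * a - uq)"
    by (rule poly_mapping_eqI)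
      (use le_n uq(1) in \<open>auto simp: lookup_add lookup_minus lookup_of_nat_mult_nat lka lookup_outside_monomials\<close>)
  then have "of_nat n * ?deg a = q + ?deg (of_nat n * a - uq)"
    unfolding uq(2) by (metis multidegree_add multidegree_of_nat_mult)
  moreover have "?deg (of_nat n * a - uq) \<in> ?S" using am by (simp add: semigroup_of_def)
  ultimately have nq: "of_nat n * ?deg a - q \<in> ?S" by simp
  have "b + of_nat n * ?deg \<sigma>
      = p + (of_nat n * ?deg a - q) + of_nat n * (of_nat N1 * (of_nat k * b))"
    unfolding \<sigma>_def f(2) by (simp add: algebra_simps b_def)
  also have "\<dots> \<in> ?S"
    using p nq kb unfolding b_def by simp
  finally obtain c where c: "standard \<gamma> m r c" "?deg c = b + of_nat n * ?deg \<sigma>"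
    using standard_exists[of m \<gamma> ht, OF ht r] by blast
  have cm: "c \<in> monomials m" using c(1) by (simp add: standard_def)
  have "of_nat K * c = \<beta> + of_nat (K * n) * \<sigma>"
  proof (rule standard_unique[OF r])
    show "standard \<gamma> m r (of_nat K * c)"
      by (rule standard_if_supported[OF r sf c(1)]) (auto simp: cm in_keys_iff lookup_of_nat_mult_nat)
    show "standard \<gamma> m r (\<beta> + of_nat (K * n) * \<sigma>)"
    proof (rule standard_if_supported[OF r sf \<sigma>(1)])
      have "Poly_Mapping.keys (of_nat (K * n) * \<sigma>) \<subseteq> Poly_Mapping.keys \<sigma>"
        by (auto simp: in_keys_iff lookup_of_nat_mult_nat simp del: of_nat_mult)
      then show "Poly_Mapping.keys (\<beta> + of_nat (K * n) * \<sigma>) \<subseteq> Poly_Mapping.keys \<sigma>"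
        using \<beta>_supp keys_add[of \<beta> "of_nat (K * n) * \<sigma>"] by blast
      show "\<beta> + of_nat (K * n) * \<sigma> \<in> monomials m"
        using N(2) \<sigma>(2) by (simp del: of_nat_mult)
    qed
    show "?deg (of_nat K * c) = ?deg (\<beta> + of_nat (K * n) * \<sigma>)"
      unfolding multidegree_add multidegree_of_nat_mult c(2) Kb by (simp add: algebra_simps)
  qed
  then have "K * Poly_Mapping.lookup c i = Poly_Mapping.lookup \<beta> i + K * n * Poly_Mapping.lookup \<sigma> i" for i
    by (metis lookup_add lookup_of_nat_mult_nat)
  then have "K * (n * Poly_Mapping.lookup \<sigma> i) \<le> K * Poly_Mapping.lookup c i" for i
    by (metis le_add2 mult.assoc)
  then have le: "n * Poly_Mapping.lookup \<sigma> i \<le> Poly_Mapping.lookup c i" for i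
    using \<open>K > 0\<close> by simp
  have "c = of_nat n * \<sigma> + (c - of_nat n * \<sigma>)"
    by (rule poly_mapping_eqI) (simp add: lookup_add lookup_minus lookup_of_nat_mult_nat le)
  then have "b = ?deg (c - of_nat n * \<sigma>)"
    using c(2) by (metis multidegree_add multidegree_of_nat_mult add.commute add_left_cancel)
  then show "p - q \<in> ?S" using cm by (simp add: semigroup_of_def b_def)
qed

section \<open>Normal semigroups and normal toric rings\<close>

definition semigroup_ring :: "(nat \<Rightarrow>\<^sub>0 int) set \<Rightarrow> 'k::field laurent set" where
  "semigroup_ring S = {f. Poly_Mapping.keys f \<subseteq> S}"

lemma lookup_single_mult:
  fixes f :: "(nat \<Rightarrow>\<^sub>0 int) \<Rightarrow>\<^sub>0 'k::field"
  shows "Poly_Mapping.lookup (Poly_Mapping.single \<kappa> c * f) (\<kappa> + g) = c * Poly_Mapping.lookup f g"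
proof -
  have "Poly_Mapping.single \<kappa> c * f
      = (\<Sum>t\<in>Poly_Mapping.keys f. Poly_Mapping.single (\<kappa> + t) (c * Poly_Mapping.lookup f t))"
    by (subst (1) sum_of_terms[of f]) (simp add: sum_distrib_left mult_single)
  then show ?thesis
    by (simp add: lookup_sum lookup_single when_def sum.delta in_keys_iff)
qed

section \<open>Leading terms\<close>

text \<open>Exponents are ordered lexicographically, and exchanging the coordinates \<open>0\<close> and \<open>ht\<close> lets coordinate
\<open>ht\<close>, the height, be compared before all others.\<close>

definition height_first :: "nat \<Rightarrow> (nat \<Rightarrow>\<^sub>0 int) \<Rightarrow> (nat \<Rightarrow>\<^sub>0 int)" where
  "height_first ht = Poly_Mapping.map_key (\<lambda>i. if i = 0 then ht else if i = ht then 0 else i)"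

lemma inj_exchange: "inj (\<lambda>i::nat. if i = 0 then ht else if i = ht then 0 else i)"
  by (auto simp: inj_def)

lemma lookup_height_first:
  "Poly_Mapping.lookup (height_first ht g) i
     = Poly_Mapping.lookup g (if i = 0 then ht else if i = ht then 0 else i)"
  unfolding height_first_def by (simp add: map_key.rep_eq[OF inj_exchange] o_def inj_exchange)

lemma height_first_add: "height_first ht (g + h) = height_first ht g + height_first ht h"
  by (rule poly_mapping_eqI) (simp add: lookup_add lookup_height_first)

lemma height_first_inject: "height_first ht g = height_first ht h \<longleftrightarrow> g = h"
proof
  assume *: "height_first ht g = height_first ht h"
  show "g = h"
  proof (rule poly_mapping_eqI)
    fix i
    have "Poly_Mapping.lookup (height_first ht g) (if i = 0 then ht else if i = ht then 0 else i)
        = Poly_Mapping.lookup (height_first ht h) (if i = 0 then ht else if i = ht then 0 else i)"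
      by (simp add: *)
    then show "Poly_Mapping.lookup g i = Poly_Mapping.lookup h i"
      by (simp add: lookup_height_first split: if_splits)
  qed
qed simp

lemma height_first_mono:
  assumes "height_first ht g \<le> height_first ht h"
  shows "Poly_Mapping.lookup g ht \<le> Poly_Mapping.lookup h ht"
proof (cases "height_first ht g = height_first ht h")
  case False
  with assms have "height_first ht g < height_first ht h" by simp
  then obtain k where
    k: "Poly_Mapping.lookup (height_first ht g) k < Poly_Mapping.lookup (height_first ht h) k"
    "\<And>k'. k' < k \<Longrightarrow> Poly_Mapping.lookup (height_first ht g) k' = Poly_Mapping.lookup (height_first ht h) k'"
    by (auto simp: less_poly_mapping.rep_eq less_fun_def)
  then have "Poly_Mapping.lookup (height_first ht g) 0 \<le> Poly_Mapping.lookup (height_first ht h) 0"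
    by (cases "k = 0") (auto simp: less_imp_le)
  then show ?thesis by (simp add: lookup_height_first)
qed (simp add: height_first_inject)

definition leading :: "nat \<Rightarrow> 'k::field laurent \<Rightarrow> (nat \<Rightarrow>\<^sub>0 int) \<Rightarrow> bool" where
  "leading ht f \<kappa> \<longleftrightarrow> \<kappa> \<in> Poly_Mapping.keys f \<and>
     (\<forall>k\<in>Poly_Mapping.keys f. height_first ht k \<le> height_first ht \<kappa>)"

lemma leading_exists:
  assumes "f \<noteq> 0"
  shows "\<exists>\<kappa>. leading ht f \<kappa>"
proof -
  have ne: "Poly_Mapping.keys f \<noteq> {}"
    using assms by (auto simp: poly_mapping_eq_iff fun_eq_iff in_keys_iff)
  let ?M = "Max (height_first ht ` Poly_Mapping.keys f)"
  have "?M \<in> height_first ht ` Poly_Mapping.keys f" using ne by (intro Max_in) auto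
  then obtain \<kappa> where "\<kappa> \<in> Poly_Mapping.keys f" "height_first ht \<kappa> = ?M" by auto
  then show ?thesis unfolding leading_def by (intro exI[of _ \<kappa>]) auto
qed

lemma leading_unique: "leading ht f \<kappa> \<Longrightarrow> leading ht f \<kappa>' \<Longrightarrow> \<kappa> = \<kappa>'"
  unfolding leading_def by (metis height_first_inject order_antisym)

lemma leading_mult:
  fixes f g :: "'k::field laurent"
  assumes f: "leading ht f \<kappa>" and g: "leading ht g \<mu>"
  shows "leading ht (f * g) (\<kappa> + \<mu>)"
proof -
  define f1 where "f1 = f - Poly_Mapping.single \<kappa> (Poly_Mapping.lookup f \<kappa>)"
  have lk1: "Poly_Mapping.lookup f1 k = (if k = \<kappa> then 0 else Poly_Mapping.lookup f k)" for k
    by (simp add: f1_def lookup_minus lookup_single when_def)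
  have lower: "height_first ht k < height_first ht \<kappa>" if "k \<in> Poly_Mapping.keys f1" for k
    using that f unfolding leading_def
    by (metis height_first_inject in_keys_iff lk1 order_le_imp_less_or_eq)
  have "\<kappa> + \<mu> \<notin> Poly_Mapping.keys (f1 * g)"
  proof
    assume "\<kappa> + \<mu> \<in> Poly_Mapping.keys (f1 * g)"
    then obtain a b where ab: "a \<in> Poly_Mapping.keys f1" "b \<in> Poly_Mapping.keys g" "\<kappa> + \<mu> = a + b"
      using keys_mult[of f1 g] by blast
    have "height_first ht (a + b) < height_first ht (\<kappa> + \<mu>)"
      unfolding height_first_add using lower[OF ab(1)] g ab(2)
      by (intro add_less_le_mono) (auto simp: leading_def)
    with ab(3) show False by simp
  qed
  then have "Poly_Mapping.lookup (f1 * g) (\<kappa> + \<mu>) = 0" by (simp add: in_keys_iff)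
  moreover have "f * g = f1 * g + Poly_Mapping.single \<kappa> (Poly_Mapping.lookup f \<kappa>) * g"
    by (simp add: f1_def algebra_simps)
  ultimately have "Poly_Mapping.lookup (f * g) (\<kappa> + \<mu>)
      = Poly_Mapping.lookup f \<kappa> * Poly_Mapping.lookup g \<mu>"
    by (simp add: lookup_add lookup_single_mult)
  then have "\<kappa> + \<mu> \<in> Poly_Mapping.keys (f * g)" using f g by (simp add: leading_def in_keys_iff)
  moreover have "height_first ht k \<le> height_first ht (\<kappa> + \<mu>)" if k: "k \<in> Poly_Mapping.keys (f * g)" for k
  proof -
    obtain a b where "a \<in> Poly_Mapping.keys f" "b \<in> Poly_Mapping.keys g" "k = a + b"
      using keys_mult[of f g] k by blast
    then show ?thesis using f g by (auto simp: leading_def height_first_add intro: add_mono)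
  qed
  ultimately show ?thesis by (simp add: leading_def)
qed

lemma leading_power:
  assumes "leading ht f \<kappa>"
  shows "leading ht (f ^ n) (of_nat n * \<kappa>)"
proof (induction n)
  case 0
  show ?case by (simp add: leading_def)
next
  case (Suc n)
  from leading_mult[OF assms Suc] show ?case by (simp add: algebra_simps)
qed

section \<open>Almost integral fractions\<close>

lemma semigroup_ring_closed:
  fixes f g :: "'k::field laurent" and m :: nat and \<gamma>
  defines "R \<equiv> semigroup_ring (semigroup_of \<gamma> m)"
  shows "f \<in> R \<Longrightarrow> g \<in> R \<Longrightarrow> f + g \<in> R"
    and "f \<in> R \<Longrightarrow> g \<in> R \<Longrightarrow> f * g \<in> R"
    and "f \<in> R \<Longrightarrow> - f \<in> R"
    and "f \<in> R \<Longrightarrow> f ^ n \<in> R"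
    and "of_nat n \<in> R" and "0 \<in> R" and "1 \<in> R"
    and "\<kappa> \<in> semigroup_of \<gamma> m \<Longrightarrow> Poly_Mapping.single \<kappa> c \<in> R"
proof -
  show add: "f \<in> R \<Longrightarrow> g \<in> R \<Longrightarrow> f + g \<in> R" for f g :: "'k laurent"
    unfolding R_def semigroup_ring_def using keys_add[of f g] by auto
  show mult: "f \<in> R \<Longrightarrow> g \<in> R \<Longrightarrow> f * g \<in> R" for f g :: "'k laurent"
  proof -
    assume *: "f \<in> R" "g \<in> R"
    have "w \<in> semigroup_of \<gamma> m" if w: "w \<in> Poly_Mapping.keys (f * g)" for w
    proof -
      obtain a b where "a \<in> Poly_Mapping.keys f" "b \<in> Poly_Mapping.keys g" "w = a + b"
        using keys_mult[of f g] w by blast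
      with * show ?thesis unfolding R_def semigroup_ring_def
        by (metis add_in_semigroup mem_Collect_eq subsetD)
    qed
    then show "f * g \<in> R" unfolding R_def semigroup_ring_def by blast
  qed
  show "f \<in> R \<Longrightarrow> - f \<in> R" by (auto simp: R_def semigroup_ring_def in_keys_iff)
  show mono: "\<kappa> \<in> semigroup_of \<gamma> m \<Longrightarrow> Poly_Mapping.single \<kappa> c \<in> R" for \<kappa> c
    by (auto simp: R_def semigroup_ring_def)
  show zero: "0 \<in> R" by (simp add: R_def semigroup_ring_def)
  show one: "1 \<in> R" using mono[OF zero_in_semigroup, of 1] by simp
  show "f \<in> R \<Longrightarrow> f ^ n \<in> R" by (induction n) (auto intro: mult one)
  show "of_nat n \<in> R" by (induction n) (auto intro: add one zero)
qed

lemma semigroup_ring_sum: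
  assumes "\<And>i. i \<in> I \<Longrightarrow> f i \<in> semigroup_ring (semigroup_of \<gamma> m)"
  shows "(\<Sum>i\<in>I. f i) \<in> (semigroup_ring (semigroup_of \<gamma> m) :: 'k::field laurent set)"
  using assms
  by (induction I rule: infinite_finite_induct) (auto intro: semigroup_ring_closed)

text \<open>An exponent that is smaller in this order has at most the same height, and only finitely many elements
of the semigroup have bounded height. This makes the division by leading terms terminate.\<close>

lemma finite_semigroup_below:
  assumes ht: "\<And>i. i < m \<Longrightarrow> Poly_Mapping.lookup (\<gamma> i) ht = 1"
  shows "finite {s \<in> semigroup_of \<gamma> m. height_first ht s \<le> height_first ht \<kappa>}"
proof (rule finite_subset)
  let ?h = "nat (Poly_Mapping.lookup \<kappa> ht)"
  show "{s \<in> semigroup_of \<gamma> m. height_first ht s \<le> height_first ht \<kappa>}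
      \<subseteq> multidegree \<gamma> m ` {u \<in> monomials m. (\<Sum>i<m. Poly_Mapping.lookup u i) \<le> ?h}"
  proof
    fix s assume "s \<in> {s \<in> semigroup_of \<gamma> m. height_first ht s \<le> height_first ht \<kappa>}"
    then obtain u where u: "u \<in> monomials m" "s = multidegree \<gamma> m u"
      "Poly_Mapping.lookup s ht \<le> Poly_Mapping.lookup \<kappa> ht"
      using height_first_mono by (auto simp: semigroup_of_def)
    then have "int (\<Sum>i<m. Poly_Mapping.lookup u i) \<le> Poly_Mapping.lookup \<kappa> ht"
      using lookup_height_multidegree[of m \<gamma> ht, OF ht] by simp
    then have "(\<Sum>i<m. Poly_Mapping.lookup u i) \<le> ?h" by linarith
    then show "s \<in> multidegree \<gamma> m ` {u \<in> monomials m. (\<Sum>i<m. Poly_Mapping.lookup u i) \<le> ?h}"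
      using u by blast
  qed
qed (simp add: finite_bounded_monomials)

text \<open>By Dickson's lemma two of the given elements have representations of which one is contained in the
other; their difference is a multiple of \<open>\<kappa>\<close>.\<close>

lemma multiple_in_semigroup:
  assumes "\<And>k. \<eta> + of_nat k * \<kappa> \<in> semigroup_of \<gamma> m"
  shows "\<exists>l>0. of_nat l * \<kappa> \<in> semigroup_of \<gamma> m"
proof -
  have "\<exists>u\<in>monomials m. multidegree \<gamma> m u = \<eta> + of_nat k * \<kappa>" for k
    using assms[of k] by (force simp: semigroup_of_def)
  then obtain u where u: "\<And>k. u k \<in> monomials m" "\<And>k. multidegree \<gamma> m (u k) = \<eta> + of_nat k * \<kappa>"
    by metis
  obtain a b w where w: "a < b" "w \<in> monomials m" "u b = u a + w"
    using Dickson[OF infinite_UNIV_nat, of u m] u(1) by auto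
  have "multidegree \<gamma> m w = multidegree \<gamma> m (u b) - multidegree \<gamma> m (u a)"
    by (simp add: w multidegree_add)
  then have "multidegree \<gamma> m w = of_nat (b - a) * \<kappa>"
    using w(1) by (simp add: u(2) of_nat_diff left_diff_distrib)
  then show ?thesis using w unfolding semigroup_of_def
    by (intro exI[of _ "b - a"]) (metis imageI zero_less_diff)
qed

text \<open>The condition says that \<open>g (a / b)\<^sup>k\<close> lies in the ring for all \<open>k\<close>. By the binomial theorem it
passes from \<open>a / b\<close> to \<open>a / b - e\<close>.\<close>

lemma almost_integral_subtract:
  fixes a b g e :: "'k::field laurent" and m :: nat and \<gamma>
  defines "R \<equiv> semigroup_ring (semigroup_of \<gamma> m)"
  assumes "e \<in> R" and *: "\<And>k. \<exists>h\<in>R. g * a ^ k = b ^ k * h"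
  shows "\<exists>h\<in>R. g * (a - e * b) ^ k = b ^ k * h"
proof -
  obtain h where h: "\<And>k. h k \<in> R" "\<And>k. g * a ^ k = b ^ k * h k" using * by metis
  let ?h = "\<Sum>j\<le>k. of_nat (k choose j) * h j * (- e) ^ (k - j)"
  have "g * (a - e * b) ^ k = g * (a + (- e * b)) ^ k" by simp
  also have "\<dots> = (\<Sum>j\<le>k. of_nat (k choose j) * (g * a ^ j) * ((- e) ^ (k - j) * b ^ (k - j)))"
    unfolding binomial_ring power_mult_distrib by (simp add: sum_distrib_left ac_simps)
  also have "\<dots> = (\<Sum>j\<le>k. b ^ k * (of_nat (k choose j) * h j * (- e) ^ (k - j)))"
  proof (intro sum.cong refl)
    fix j assume "j \<in> {..k}"
    then have "b ^ k = b ^ j * b ^ (k - j)" by (simp flip: power_add)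
    then show "of_nat (k choose j) * (g * a ^ j) * ((- e) ^ (k - j) * b ^ (k - j))
        = b ^ k * (of_nat (k choose j) * h j * (- e) ^ (k - j))"
      by (simp add: h(2) ac_simps)
  qed
  also have "\<dots> = b ^ k * ?h" by (simp add: sum_distrib_left)
  finally have "g * (a - e * b) ^ k = b ^ k * ?h" .
  moreover have "?h \<in> R"
    unfolding R_def using h(1) \<open>e \<in> R\<close> unfolding R_def
    by (intro semigroup_ring_sum semigroup_ring_closed)
  ultimately show ?thesis by blast
qed

text \<open>Comparing leading exponents in \<open>g a\<^sup>k = b\<^sup>k h\<close>, with \<open>\<kappa>\<close> the difference of those of \<open>a\<close> and \<open>b\<close>, shows
that \<open>\<eta> + k \<kappa>\<close> lies in the semigroup for all \<open>k\<close>. Hence so does a multiple of \<open>\<kappa>\<close>, and by normality \<open>\<kappa>\<close>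
itself. Subtracting the corresponding multiple of \<open>b\<close> cancels the leading term of \<open>a\<close> and preserves
the hypotheses; the induction is on the number of elements of the semigroup up to that term.\<close>

lemma almost_integral_divides:
  fixes a b g :: "'k::field laurent" and m :: nat and \<gamma>
  defines "R \<equiv> semigroup_ring (semigroup_of \<gamma> m)"
  assumes ht: "\<And>i. i < m \<Longrightarrow> Poly_Mapping.lookup (\<gamma> i) ht = 1"
    and normal: "normal_semigroup \<gamma> m"
    and a: "a \<in> R" and b: "b \<in> R" "b \<noteq> 0" and g: "g \<in> R" "g \<noteq> 0"
    and ai: "\<And>k. \<exists>h\<in>R. g * a ^ k = b ^ k * h"
  shows "\<exists>c\<in>R. a = c * b"
proof -
  let ?S = "semigroup_of \<gamma> m"
  let ?below = "\<lambda>\<kappa>. {s \<in> ?S. height_first ht s \<le> height_first ht \<kappa>}"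
  obtain \<beta> where \<beta>: "leading ht b \<beta>" using leading_exists[OF b(2)] by blast
  obtain \<eta> where \<eta>: "leading ht g \<eta>" using leading_exists[OF g(2)] by blast
  have "\<exists>c\<in>R. a = c * b" if "leading ht a \<alpha>" for \<alpha>
    using that a ai
  proof (induction "card (?below \<alpha>)" arbitrary: a \<alpha> rule: less_induct)
    case less
    note \<alpha> = less.prems(1)
    define \<kappa> where "\<kappa> = \<alpha> - \<beta>"
    have "\<eta> + of_nat k * \<kappa> \<in> ?S" for k
    proof -
      obtain h where h: "h \<in> R" "g * a ^ k = b ^ k * h" using less.prems(3) by blast
      have l1: "leading ht (g * a ^ k) (\<eta> + of_nat k * \<alpha>)"
        by (intro leading_mult leading_power \<eta> \<alpha>)
      then have "h \<noteq> 0" using h(2) by (auto simp: leading_def)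
      then obtain \<theta> where \<theta>: "leading ht h \<theta>" using leading_exists by blast
      have "leading ht (b ^ k * h) (of_nat k * \<beta> + \<theta>)"
        by (intro leading_mult leading_power \<beta> \<theta>)
      with l1 h(2) leading_unique have "\<eta> + of_nat k * \<alpha> = of_nat k * \<beta> + \<theta>" by metis
      then have "\<eta> + of_nat k * \<kappa> = \<theta>" by (simp add: \<kappa>_def algebra_simps)
      moreover have "\<theta> \<in> ?S" using h(1) \<theta> by (auto simp: R_def semigroup_ring_def leading_def)
      ultimately show ?thesis by simp
    qed
    then obtain l where l: "l > 0" "of_nat l * \<kappa> \<in> ?S" using multiple_in_semigroup by blast
    have \<alpha>S: "\<alpha> \<in> ?S" and \<beta>S: "\<beta> \<in> ?S"
      using less.prems(2) b(1) \<alpha> \<beta> by (auto simp: R_def semigroup_ring_def leading_def)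
    with normal l have \<kappa>S: "\<kappa> \<in> ?S" unfolding normal_semigroup_def \<kappa>_def by blast
    define e where "e = Poly_Mapping.single \<kappa> (Poly_Mapping.lookup a \<alpha> / Poly_Mapping.lookup b \<beta>)"
    have eR: "e \<in> R" unfolding R_def e_def using \<kappa>S by (rule semigroup_ring_closed)
    define a' where "a' = a - e * b"
    have a'R: "a' \<in> R"
      unfolding a'_def diff_conv_add_uminus R_def
      using less.prems(2) eR b(1) unfolding R_def by (intro semigroup_ring_closed)
    have \<beta>0: "Poly_Mapping.lookup b \<beta> \<noteq> 0" and \<alpha>0: "Poly_Mapping.lookup a \<alpha> \<noteq> 0"
      using \<beta> \<alpha> by (auto simp: leading_def in_keys_iff)
    have "Poly_Mapping.lookup (e * b) \<alpha> = Poly_Mapping.lookup a \<alpha>"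
      using lookup_single_mult[of \<kappa> "Poly_Mapping.lookup a \<alpha> / Poly_Mapping.lookup b \<beta>" b \<beta>] \<beta>0
      by (simp add: e_def \<kappa>_def)
    then have notin: "\<alpha> \<notin> Poly_Mapping.keys a'" by (simp add: a'_def in_keys_iff lookup_minus)
    have "leading ht e \<kappa>" using \<alpha>0 \<beta>0 by (simp add: e_def leading_def)
    from leading_mult[OF this \<beta>] have leb: "leading ht (e * b) \<alpha>" by (simp add: \<kappa>_def)
    have le: "height_first ht k \<le> height_first ht \<alpha>" if "k \<in> Poly_Mapping.keys a'" for k
    proof -
      have "k \<in> Poly_Mapping.keys a \<or> k \<in> Poly_Mapping.keys (e * b)"
        using that by (auto simp: a'_def in_keys_iff lookup_minus)
      then show ?thesis using \<alpha> leb by (auto simp: leading_def)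
    qed
    have "\<exists>c\<in>R. a' = c * b"
    proof (cases "a' = 0")
      case True
      then show ?thesis unfolding R_def by (intro bexI[of _ 0] semigroup_ring_closed) simp
    next
      case False
      then obtain \<alpha>' where \<alpha>': "leading ht a' \<alpha>'" using leading_exists by blast
      then have "\<alpha>' \<in> Poly_Mapping.keys a'" "\<alpha>' \<noteq> \<alpha>" using notin by (auto simp: leading_def)
      then have lt: "height_first ht \<alpha>' < height_first ht \<alpha>"
        using le height_first_inject by (metis order_le_imp_less_or_eq)
      have "\<alpha> \<in> ?below \<alpha>" "\<alpha> \<notin> ?below \<alpha>'" using lt \<alpha>S by auto
      moreover have "?below \<alpha>' \<subseteq> ?below \<alpha>" using lt by auto
      ultimately have "?below \<alpha>' \<subset> ?below \<alpha>" by blast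
      then have "card (?below \<alpha>') < card (?below \<alpha>)"
        using finite_semigroup_below[of m \<gamma> ht \<alpha>, OF ht] by (simp add: psubset_card_mono)
      moreover have "\<exists>h\<in>R. g * a' ^ k = b ^ k * h" for k
        using almost_integral_subtract[of e \<gamma> m g a b k] eR less.prems(3)
        unfolding R_def a'_def by blast
      ultimately show ?thesis using less.hyps[OF _ \<alpha>' a'R] by blast
    qed
    then obtain c where "c \<in> R" "a' = c * b" by blast
    then have "a = (c + e) * b" by (simp add: a'_def algebra_simps)
    moreover have "c + e \<in> R"
      using \<open>c \<in> R\<close> eR unfolding R_def by (rule semigroup_ring_closed)
    ultimately show ?case by blast
  qed
  then show ?thesis
  proof (cases "a = 0")
    case True
    then show ?thesis unfolding R_def by (intro bexI[of _ 0] semigroup_ring_closed) simp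
  qed (use leading_exists in blast)
qed

section \<open>Embedding into the fraction field\<close>

lemma embed_fract_simps:
  fixes a b :: "'a::idom"
  shows "embed_fract (a + b) = embed_fract a + embed_fract b"
  and "embed_fract (a * b) = embed_fract a * embed_fract b"
  and "embed_fract (- a) = - embed_fract a"
  and "embed_fract (0 :: 'a) = 0" and "embed_fract (1 :: 'a) = 1"
  and "embed_fract (a ^ n) = embed_fract a ^ n"
proof -
  show mult: "embed_fract (a * b) = embed_fract a * embed_fract b" for a b :: 'a
    by (simp add: embed_fract_def)
  show one: "embed_fract (1 :: 'a) = 1" by (simp add: embed_fract_def One_fract_def)
  show "embed_fract (a ^ n) = embed_fract a ^ n" by (induction n) (simp_all add: mult one)
qed (simp_all add: embed_fract_def Zero_fract_def)

lemma embed_fract_sum: "embed_fract (\<Sum>i\<in>I. f i) = (\<Sum>i\<in>I. embed_fract (f i))"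
  by (induction I rule: infinite_finite_induct) (simp_all add: embed_fract_simps)

lemma embed_fract_inject: "embed_fract a = embed_fract b \<longleftrightarrow> a = b"
  by (simp add: embed_fract_def eq_fract)

lemma Fract_mult_embed: "b \<noteq> 0 \<Longrightarrow> Fraction_Field.Fract a b * embed_fract b = embed_fract a"
  by (simp add: embed_fract_def eq_fract)

text \<open>If \<open>a / b\<close> satisfies a monic equation of degree \<open>n\<close>, its powers are combinations of the first \<open>n\<close> ones,
for which \<open>b\<^sup>n\<close> is a common denominator.\<close>

lemma integral_imp_almost_integral:
  fixes a b :: "'k::field laurent" and m :: nat and \<gamma>
  defines "R \<equiv> semigroup_ring (semigroup_of \<gamma> m)"
  assumes a: "a \<in> R" and b: "b \<in> R" "b \<noteq> 0"
    and int: "integral_over (embed_fract ` R) (Fraction_Field.Fract a b)"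
  shows "\<exists>n. \<forall>k. \<exists>h\<in>R. b ^ n * a ^ k = b ^ k * h"
proof -
  let ?z = "Fraction_Field.Fract a b"
  obtain p where p: "lead_coeff p = 1" "\<forall>i. coeff p i \<in> embed_fract ` R" "poly p ?z = 0"
    using int by (auto simp: integral_over_def)
  define n where "n = degree p"
  obtain c where c: "\<And>i. c i \<in> R" "\<And>i. coeff p i = embed_fract (c i)"
    using p(2) unfolding image_iff by metis
  have "poly p ?z = (\<Sum>i<n. coeff p i * ?z ^ i) + ?z ^ n"
    using p(1) by (simp add: poly_altdef n_def flip: lessThan_Suc_atMost)
  with p(3) have zn: "?z ^ n = (\<Sum>i<n. embed_fract (- c i) * ?z ^ i)"
    by (simp add: c(2) embed_fract_simps sum_negf eq_neg_iff_add_eq_0 add.commute)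
  have "\<exists>h\<in>R. embed_fract (b ^ n) * ?z ^ k = embed_fract h" for k
  proof (induction k rule: less_induct)
    case (less k)
    show ?case
    proof (cases "k < n")
      case True
      then have "b ^ n = b ^ (n - k) * b ^ k" by (simp flip: power_add)
      then have "embed_fract (b ^ n) * ?z ^ k = embed_fract (b ^ (n - k)) * (?z * embed_fract b) ^ k"
        by (simp add: embed_fract_simps power_mult_distrib ac_simps)
      also have "\<dots> = embed_fract (b ^ (n - k) * a ^ k)"
        unfolding Fract_mult_embed[OF b(2)] by (simp add: embed_fract_simps)
      finally show ?thesis
        using a b(1) unfolding R_def by (blast intro: semigroup_ring_closed)
    next
      case False
      then have "?z ^ k = ?z ^ (k - n) * ?z ^ n" by (simp flip: power_add)
      also have "\<dots> = (\<Sum>i<n. embed_fract (- c i) * ?z ^ (k - n + i))"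
        unfolding zn by (simp add: sum_distrib_left power_add ac_simps)
      finally have zk: "embed_fract (b ^ n) * ?z ^ k
          = (\<Sum>i<n. embed_fract (- c i) * (embed_fract (b ^ n) * ?z ^ (k - n + i)))"
        by (simp add: sum_distrib_left ac_simps)
      have "\<forall>i. \<exists>h. i < n \<longrightarrow> h \<in> R \<and> embed_fract (b ^ n) * ?z ^ (k - n + i) = embed_fract h"
      proof
        fix i
        show "\<exists>h. i < n \<longrightarrow> h \<in> R \<and> embed_fract (b ^ n) * ?z ^ (k - n + i) = embed_fract h"
        proof (cases "i < n")
          case True
          with False have "k - n + i < k" by linarith
          from less[OF this] show ?thesis by blast
        qed simp
      qed
      then obtain h where h: "\<And>i. i < n \<Longrightarrow> h i \<in> R"
        "\<And>i. i < n \<Longrightarrow> embed_fract (b ^ n) * ?z ^ (k - n + i) = embed_fract (h i)" by metis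
      have "embed_fract (b ^ n) * ?z ^ k = embed_fract (\<Sum>i<n. - c i * h i)"
        unfolding zk embed_fract_sum by (intro sum.cong refl)
          (simp only: embed_fract_simps(2) h(2)[symmetric] lessThan_iff)
      moreover have "(\<Sum>i<n. - c i * h i) \<in> R"
        using c(1) h(1) unfolding R_def by (intro semigroup_ring_sum semigroup_ring_closed) auto
      ultimately show ?thesis by blast
    qed
  qed
  moreover have "b ^ n * a ^ k = b ^ k * h"
    if "embed_fract (b ^ n) * ?z ^ k = embed_fract h" for h k
  proof -
    have "embed_fract (b ^ n * a ^ k) = embed_fract (b ^ n) * (?z * embed_fract b) ^ k"
      unfolding Fract_mult_embed[OF b(2)] by (simp add: embed_fract_simps)
    also have "\<dots> = embed_fract (b ^ k * h)"
      using that by (simp add: embed_fract_simps power_mult_distrib ac_simps)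
    finally show ?thesis by (simp add: embed_fract_inject)
  qed
  ultimately show ?thesis by blast
qed

text \<open>If \<open>k (p - q)\<close> lies in the semigroup, then the quotient of the monomials with exponents \<open>p\<close> and \<open>q\<close> is a
root of \<open>X\<^sup>k - x\<close>, where \<open>x\<close> is the monomial with exponent \<open>k (p - q)\<close>. So a normal ring contains this
quotient. The converse is the division of an almost integral fraction.\<close>

theorem normal_domain_semigroup_ring_iff:
  assumes ht: "\<And>i. i < m \<Longrightarrow> Poly_Mapping.lookup (\<gamma> i) ht = 1"
  shows "normal_domain (semigroup_ring (semigroup_of \<gamma> m) :: 'k::field laurent set)
    \<longleftrightarrow> normal_semigroup \<gamma> m"
proof
  let ?S = "semigroup_of \<gamma> m" and ?R = "semigroup_ring (semigroup_of \<gamma> m) :: 'k laurent set"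
  {
    assume normal: "normal_semigroup \<gamma> m"
    show "normal_domain ?R"
      unfolding normal_domain_def
    proof (intro ballI impI)
      fix z assume "z \<in> fraction_field_of ?R" and int: "integral_over (embed_fract ` ?R) z"
      then obtain a b where ab: "z = Fraction_Field.Fract a b" "a \<in> ?R" "b \<in> ?R" "b \<noteq> 0"
        by (auto simp: fraction_field_of_def)
      obtain n where n: "\<forall>k. \<exists>h\<in>?R. b ^ n * a ^ k = b ^ k * h"
        using integral_imp_almost_integral[OF ab(2-4)] int ab(1) by blast
      have "b ^ n \<in> ?R" "b ^ n \<noteq> 0" using ab by (auto intro: semigroup_ring_closed)
      with almost_integral_divides[of m \<gamma> ht, OF ht normal ab(2-4)] n
      obtain c where "c \<in> ?R" "a = c * b" by blast
      then have "z = embed_fract c" using ab by (simp add: embed_fract_def eq_fract)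
      then show "z \<in> embed_fract ` ?R" using \<open>c \<in> ?R\<close> by blast
    qed
  }
  {
    assume nd: "normal_domain ?R"
    show "normal_semigroup \<gamma> m"
      unfolding normal_semigroup_def
    proof (intro ballI allI impI)
      fix p q k assume p: "p \<in> ?S" and q: "q \<in> ?S" and k: "0 < (k::nat)"
        and kS: "of_nat k * (p - q) \<in> ?S"
      let ?x = "\<lambda>s. Poly_Mapping.single s (1::'k)"
      let ?z = "Fraction_Field.Fract (?x p) (?x q)"
      have q0: "?x q \<noteq> 0" by (metis lookup_single_eq lookup_zero zero_neq_one)
      have R: "?x s \<in> ?R" if "s \<in> ?S" for s using that by (rule semigroup_ring_closed)
      have "?z ^ k * embed_fract (?x q) ^ k = embed_fract (?x (of_nat k * (p - q))) * embed_fract (?x q) ^ k"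
        unfolding power_mult_distrib[symmetric] Fract_mult_embed[OF q0]
        by (simp flip: embed_fract_simps add: laurent_monomial_power mult_single algebra_simps)
      moreover have "embed_fract (?x q) \<noteq> 0"
        using q0 embed_fract_inject[of "?x q" 0] by (simp add: embed_fract_simps)
      ultimately have zk: "?z ^ k = embed_fract (?x (of_nat k * (p - q)))" by simp
      define P where "P = Polynomial.monom 1 k + [:- (?z ^ k):]"
      have deg: "degree P = k" unfolding P_def
        using k by (subst degree_add_eq_left) (auto simp: degree_monom_eq)
      have co: "coeff P i = (if i = k then 1 else 0) + (if i = 0 then - (?z ^ k) else 0)" for i
        unfolding P_def by (cases i) auto
      have "integral_over (embed_fract ` ?R) ?z"
        unfolding integral_over_def
      proof (intro exI[of _ P] conjI allI)
        show "lead_coeff P = 1" using k by (simp add: deg co)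
        show "poly P ?z = 0" by (simp add: P_def poly_monom)
        fix i
        have "coeff P i = embed_fract (if i = k then 1 else if i = 0 then - ?x (of_nat k * (p - q)) else 0)"
          unfolding co using k by (simp add: embed_fract_simps zk)
        then show "coeff P i \<in> embed_fract ` ?R"
          by (rule image_eqI) (simp add: semigroup_ring_closed(3,6,7) R[OF kS])
      qed
      moreover have "?z \<in> fraction_field_of ?R"
        unfolding fraction_field_of_def using R p q q0 by blast
      ultimately obtain f where f: "f \<in> ?R" "?z = embed_fract f"
        using nd unfolding normal_domain_def by blast
      then have "?x p = f * ?x q" using q0 by (simp add: embed_fract_def eq_fract)
      then have "f = ?x (- q) * ?x p" by (simp add: mult_single ac_simps flip: mult.assoc)
      then have "f = ?x (p - q)" by (simp add: mult_single)
      then show "p - q \<in> ?S" using f(1) by (simp add: semigroup_ring_def)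
    qed
  }
qed

section \<open>Sign-compatible kernel vectors and squarefree initial ideals\<close>

definition kernel_vector :: "int mat \<Rightarrow> (nat \<Rightarrow> int) \<Rightarrow> bool" where
  "kernel_vector A w \<longleftrightarrow> (\<forall>i<dim_row A. (\<Sum>j<dim_col A. A $$ (i, j) * w j) = 0)"

text \<open>Subtracting such vectors \<open>z\<close> one by one writes every integer kernel vector as a sum, without cancellation,
of kernel vectors with entries \<open>0, \<plusminus>1\<close>. This property of unimodular matrices is what their connection
with squarefree initial ideals rests on.\<close>

definition unit_conformal :: "int mat \<Rightarrow> bool" where
  "unit_conformal A \<longleftrightarrow> (\<forall>w. kernel_vector A w \<and> (\<exists>j<dim_col A. w j \<noteq> 0) \<longrightarrow>
     (\<exists>z. kernel_vector A z \<and> (\<exists>j<dim_col A. z j \<noteq> 0) \<and> (\<forall>j. z j = 0 \<or> z j = sgn (w j))))"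

lemma kernel_vector_diff: "kernel_vector A x \<Longrightarrow> kernel_vector A y \<Longrightarrow> kernel_vector A (\<lambda>j. x j - y j)"
  by (simp add: kernel_vector_def right_diff_distrib sum_subtractf)

lemma centrally_symmetric_dims:
  "dim_row (centrally_symmetric A) = Suc (dim_row A)"
  "dim_col (centrally_symmetric A) = Suc (dim_col A + dim_col A)"
  by (simp_all add: centrally_symmetric_def)

lemma centrally_symmetric_entry:
  assumes "i \<le> dim_row A" "j \<le> dim_col A + dim_col A"
  shows "centrally_symmetric A $$ (i, j) =
    (if i = dim_row A then 1 else if j = 0 then 0
     else if j \<le> dim_col A then A $$ (i, j - 1) else - A $$ (i, j - 1 - dim_col A))"
proof -
  let ?n = "dim_col A"
  define L where "L = 0\<^sub>v (dim_row A) # cols A @ map uminus (cols A)"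
  have L: "L ! j =
     (if j = 0 then 0\<^sub>v (dim_row A) else if j \<le> ?n then col A (j - 1) else - col A (j - 1 - ?n))"
    using assms(2) unfolding L_def by (cases j) (auto simp: nth_append)
  have len: "j < length L" using assms(2) by (simp add: L_def)
  have dim: "dim_vec (L ! j) = dim_row A" unfolding L by auto
  have "centrally_symmetric A $$ (i, j) = map (\<lambda>a. a @\<^sub>v vec_of_list [1]) L ! j $ i"
    unfolding centrally_symmetric_def L_def[symmetric]
    by (rule mat_of_cols_index) (use assms len in auto)
  also have "\<dots> = (if i = dim_row A then 1 else L ! j $ i)"
    using assms(1) by (simp add: nth_map[OF len] index_append_vec dim)
  finally show ?thesis using assms unfolding L by auto
qed

lemma sum_lessThan_add: "(\<Sum>i<n + k. g i) = (\<Sum>i<n. g i) + (\<Sum>i<k. g (n + i :: nat) :: 'a::comm_monoid_add)"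
  by (induction k) (simp_all add: ac_simps)

text \<open>The variables are indexed as the columns of the configuration: \<open>0\<close> belongs to the zero column, \<open>Suc j\<close>
to column \<open>j\<close> of the matrix with \<open>n\<close> columns, and \<open>Suc (n + j)\<close> to its negative.\<close>

definition net_exponent :: "nat \<Rightarrow> (nat \<Rightarrow>\<^sub>0 nat) \<Rightarrow> nat \<Rightarrow> int" where
  "net_exponent n u j = int (Poly_Mapping.lookup u (Suc j)) - int (Poly_Mapping.lookup u (Suc (n + j)))"

definition total_degree :: "nat \<Rightarrow> (nat \<Rightarrow>\<^sub>0 nat) \<Rightarrow> nat" where
  "total_degree m u = (\<Sum>i<m. Poly_Mapping.lookup u i)"

lemma lookup_multidegree_centrally_symmetric:
  fixes A
  defines "C \<equiv> centrally_symmetric A"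
  shows "Poly_Mapping.lookup (multidegree (column_exponent C) (dim_col C) u) i =
    (if i < dim_row A then \<Sum>j<dim_col A. A $$ (i, j) * net_exponent (dim_col A) u j
     else if i = dim_row A then int (total_degree (dim_col C) u) else 0)"
proof -
  let ?n = "dim_col A"
  have m: "dim_col C = Suc (?n + ?n)" by (simp add: C_def centrally_symmetric_dims)
  have "Poly_Mapping.lookup (multidegree (column_exponent C) (dim_col C) u) i
      = (\<Sum>j<Suc (?n + ?n). int (Poly_Mapping.lookup u j) *
          (if i < Suc (dim_row A) then C $$ (i, j) else 0))"
    unfolding multidegree_def m
    by (simp only: lookup_sum lookup_of_nat_mult, intro sum.cong refl)
      (simp add: lookup_column_exponent m C_def centrally_symmetric_dims)
  also have "\<dots> = (if i < dim_row A then \<Sum>j<?n. A $$ (i, j) * net_exponent ?n u j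
     else if i = dim_row A then int (total_degree (dim_col C) u) else 0)"
  proof -
    consider "i < dim_row A" | "i = dim_row A" | "i > dim_row A" by linarith
    then show ?thesis
    proof cases
      case 1
      then have "(\<Sum>j<Suc (?n + ?n). int (Poly_Mapping.lookup u j) *
            (if i < Suc (dim_row A) then C $$ (i, j) else 0))
        = (\<Sum>j<?n. int (Poly_Mapping.lookup u (Suc j)) * A $$ (i, j))
          + (\<Sum>j<?n. int (Poly_Mapping.lookup u (Suc (?n + j))) * - A $$ (i, j))"
        unfolding sum.lessThan_Suc_shift sum_lessThan_add C_def
        by (simp add: centrally_symmetric_entry)
      with 1 show ?thesis
        by (simp add: net_exponent_def algebra_simps sum_subtractf sum_negf)
    next
      case 2
      have "C $$ (i, j) = 1" if "j < Suc (?n + ?n)" for j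
        using that 2 unfolding C_def by (subst centrally_symmetric_entry) auto
      with 2 show ?thesis by (simp add: total_degree_def m)
    qed auto
  qed
  finally show ?thesis .
qed

lemma multidegree_centrally_symmetric_eq_iff:
  fixes A
  defines "C \<equiv> centrally_symmetric A"
  shows "multidegree (column_exponent C) (dim_col C) u = multidegree (column_exponent C) (dim_col C) v
    \<longleftrightarrow> total_degree (dim_col C) u = total_degree (dim_col C) v \<and>
        kernel_vector A (\<lambda>j. net_exponent (dim_col A) u j - net_exponent (dim_col A) v j)"
    (is "?l \<longleftrightarrow> ?r")
proof
  assume l: ?l
  have "Poly_Mapping.lookup (multidegree (column_exponent C) (dim_col C) u) i
      = Poly_Mapping.lookup (multidegree (column_exponent C) (dim_col C) v) i" for i
    using l by simp
  note * = this[unfolded C_def lookup_multidegree_centrally_symmetric, folded C_def]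
  have "(\<Sum>j<dim_col A. A $$ (i, j) * net_exponent (dim_col A) u j)
      = (\<Sum>j<dim_col A. A $$ (i, j) * net_exponent (dim_col A) v j)" if "i < dim_row A" for i
    using *[of i] that by simp
  with *[of "dim_row A"] show ?r
    by (simp add: kernel_vector_def right_diff_distrib sum_subtractf)
next
  assume ?r
  then show ?l
    by (intro poly_mapping_eqI)
      (auto simp: C_def lookup_multidegree_centrally_symmetric kernel_vector_def
        right_diff_distrib sum_subtractf)
qed

lemma total_degree_add: "total_degree m (u + v) = total_degree m u + total_degree m v"
  by (simp add: total_degree_def lookup_add sum.distrib)

text \<open>The tail of a monomial is its part without the variable of the zero column.\<close>

definition tail_degree :: "nat \<Rightarrow> (nat \<Rightarrow>\<^sub>0 nat) \<Rightarrow> nat" where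
  "tail_degree m u = (\<Sum>i\<in>{1..<m}. Poly_Mapping.lookup u i)"

lemma tail_degree_add: "tail_degree m (u + v) = tail_degree m u + tail_degree m v"
  by (simp add: tail_degree_def lookup_add sum.distrib)

lemma total_degree_tail: "m > 0 \<Longrightarrow> total_degree m u = Poly_Mapping.lookup u 0 + tail_degree m u"
proof -
  assume "m > 0"
  then have "{..<m} = insert 0 {1..<m}" by auto
  then show ?thesis by (simp add: total_degree_def tail_degree_def)
qed

definition tail_less :: "nat \<Rightarrow> (nat \<Rightarrow>\<^sub>0 nat) \<Rightarrow> (nat \<Rightarrow>\<^sub>0 nat) \<Rightarrow> bool" where
  "tail_less m u v \<longleftrightarrow> tail_degree m u < tail_degree m v \<or> (tail_degree m u = tail_degree m v \<and> u < v)"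

text \<open>Among monomials of equal total degree, those with more of the variable of the zero column are smaller. So
the product of two opposite variables exceeds the square of that variable, and a least monomial of
a multidegree has a signed exponent vector with the least sum of absolute values.\<close>

definition tail_order :: "nat \<Rightarrow> (nat \<Rightarrow>\<^sub>0 nat) rel" where
  "tail_order m = {(u, v). u \<in> monomials m \<and> v \<in> monomials m \<and>
     (u = v \<or> total_degree m u < total_degree m v \<or>
      (total_degree m u = total_degree m v \<and> tail_less m u v))}"

lemma tail_less_trans: "tail_less m u v \<Longrightarrow> tail_less m v w \<Longrightarrow> tail_less m u w"
  by (auto simp: tail_less_def)

lemma tail_less_irrefl: "\<not> tail_less m u u"
  by (auto simp: tail_less_def)

lemma tail_less_linear: "tail_less m u v \<or> u = v \<or> tail_less m v u"
  by (auto simp: tail_less_def)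

lemma tail_less_add_right: "tail_less m (u + w) (v + w) \<longleftrightarrow> tail_less m u v"
  by (auto simp: tail_less_def tail_degree_add)

lemma tail_less_add_left: "tail_less m (w + u) (w + v) \<longleftrightarrow> tail_less m u v"
  using tail_less_add_right[of m u w v] by (simp add: add.commute)

lemma zero_le_exponent: "0 \<le> (u :: nat \<Rightarrow>\<^sub>0 nat)"
proof (rule ccontr)
  assume "\<not> 0 \<le> u"
  then have "u < 0" by simp
  then show False by (auto simp: less_poly_mapping.rep_eq less_fun_def)
qed

lemma tail_less_add_nonneg: "\<not> tail_less m (u + w) u"
  using zero_le_exponent[of w] add_left_mono[of 0 w u] by (auto simp: tail_less_def tail_degree_add not_less)

lemma tail_less_drop:
  assumes "tail_less m (u + v) w"
  shows "tail_less m u w"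
proof -
  have "tail_less m u (u + v) \<or> u = u + v"
    using tail_less_linear[of m u "u + v"] tail_less_add_nonneg[of m u v] by blast
  then show ?thesis using assms tail_less_trans by auto
qed

lemma monomial_order_tail_order: "monomial_order m (tail_order m)"
  unfolding monomial_order_def
proof (intro conjI allI ballI impI)
  show "linear_order_on (monomials m) (tail_order m)"
    unfolding linear_order_on_def partial_order_on_def preorder_on_def
  proof (intro conjI)
    show "tail_order m \<subseteq> monomials m \<times> monomials m" by (auto simp: tail_order_def)
    show "refl_on (monomials m) (tail_order m)" by (auto simp: tail_order_def refl_on_def)
    show "trans (tail_order m)"
      by (rule transI) (auto simp: tail_order_def intro: tail_less_trans)
    show "antisym (tail_order m)"
      by (rule antisymI) (auto simp: tail_order_def dest: tail_less_trans simp: tail_less_irrefl)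
    show "total_on (monomials m) (tail_order m)"
      using tail_less_linear[of m] by (auto simp: total_on_def tail_order_def)
  qed
next
  fix u assume "u \<in> monomials m"
  moreover have "\<not> tail_less m u 0" using tail_less_add_nonneg[of m 0 u] by simp
  ultimately show "(0, u) \<in> tail_order m"
    using tail_less_linear[of m 0 u] by (auto simp: tail_order_def total_degree_def)
next
  fix u v w assume "w \<in> monomials m" "(u, v) \<in> tail_order m"
  then show "(u + w, v + w) \<in> tail_order m"
    by (auto simp: tail_order_def total_degree_add tail_less_add_right)
qed

text \<open>The monomial without the variable of the zero column and without opposite variables whose signed exponent
vector is \<open>x\<close>.\<close>

definition monomial_of :: "nat \<Rightarrow> (nat \<Rightarrow> int) \<Rightarrow> (nat \<Rightarrow>\<^sub>0 nat)" where
  "monomial_of n x = (\<Sum>j<n. Poly_Mapping.single (Suc j) (nat (x j))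
     + Poly_Mapping.single (Suc (n + j)) (nat (- x j)))"

lemma lookup_monomial_of:
  "Poly_Mapping.lookup (monomial_of n x) i =
    (if i = 0 then 0 else if i \<le> n then nat (x (i - 1))
     else if i \<le> n + n then nat (- x (i - 1 - n)) else 0)"
proof -
  have "Poly_Mapping.lookup (monomial_of n x) i =
     (\<Sum>j<n. if j = i - 1 then (if i = 0 then 0 else nat (x j)) else 0)
     + (\<Sum>j<n. if j = i - 1 - n then (if i \<le> n then 0 else nat (- x j)) else 0)"
    unfolding monomial_of_def lookup_sum lookup_add sum.distrib lookup_single when_def
    by (intro arg_cong2[where f = "(+)"] sum.cong refl) auto
  also have "\<dots> = (if i = 0 then 0 else if i \<le> n then nat (x (i - 1))
     else if i \<le> n + n then nat (- x (i - 1 - n)) else 0)"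
    by (subst (1 2) sum.delta) auto
  finally show ?thesis .
qed

lemma monomial_of_in_monomials [simp]: "monomial_of n x \<in> monomials (Suc (n + n))"
  by (auto simp: monomials_iff lookup_monomial_of split: if_splits)

lemma net_exponent_monomial_of: "j < n \<Longrightarrow> net_exponent n (monomial_of n x) j = x j"
  by (auto simp: net_exponent_def lookup_monomial_of)

lemma monomial_of_cong: "(\<And>j. j < n \<Longrightarrow> x j = y j) \<Longrightarrow> monomial_of n x = monomial_of n y"
  unfolding monomial_of_def by (intro sum.cong refl) simp

text \<open>Here \<open>v\<close> collects the products of opposite variables.\<close>

lemma monomial_of_net_exponent:
  assumes u: "u \<in> monomials (Suc (n + n))"
  shows "\<exists>v\<in>monomials (Suc (n + n)).
    u = Poly_Mapping.single 0 (Poly_Mapping.lookup u 0) + (monomial_of n (net_exponent n u) + v) \<and>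
    ((\<forall>j<n. Poly_Mapping.lookup u (Suc j) = 0 \<or> Poly_Mapping.lookup u (Suc (n + j)) = 0) \<longrightarrow> v = 0)"
proof -
  let ?s = "Poly_Mapping.single 0 (Poly_Mapping.lookup u 0) + monomial_of n (net_exponent n u)"
  have le: "Poly_Mapping.lookup ?s i \<le> Poly_Mapping.lookup u i" for i
    by (auto simp: lookup_add lookup_single lookup_monomial_of net_exponent_def when_def)
  have eq: "Poly_Mapping.lookup ?s i = Poly_Mapping.lookup u i"
    if dj: "\<forall>j<n. Poly_Mapping.lookup u (Suc j) = 0 \<or> Poly_Mapping.lookup u (Suc (n + j)) = 0" for i
  proof -
    consider "i = 0" | j where "j < n" "i = Suc j" | j where "j < n" "i = Suc (n + j)"
      | "i \<ge> Suc (n + n)"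
    proof -
      have "i = 0 \<or> (\<exists>j<n. i = Suc j) \<or> (\<exists>j<n. i = Suc (n + j)) \<or> i \<ge> Suc (n + n)"
      proof (cases "i \<le> n")
        case True
        then show ?thesis by (cases i) auto
      next
        case False
        then have "i \<ge> Suc (n + n) \<or> (i - 1 - n < n \<and> i = Suc (n + (i - 1 - n)))" by auto
        then show ?thesis by blast
      qed
      then show thesis using that by blast
    qed
    then show ?thesis
    proof cases
      case 4
      then show ?thesis using lookup_outside_monomials[OF u, of i]
        by (auto simp: lookup_add lookup_single lookup_monomial_of)
    qed (use dj in \<open>auto simp: lookup_add lookup_single lookup_monomial_of net_exponent_def\<close>)
  qed
  have "u = ?s + (u - ?s)"
    by (rule poly_mapping_eqI) (simp only: lookup_add[of ?s] lookup_minus le le_add_diff_inverse)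
  moreover have "u - ?s = 0"
    if "\<forall>j<n. Poly_Mapping.lookup u (Suc j) = 0 \<or> Poly_Mapping.lookup u (Suc (n + j)) = 0"
    by (rule poly_mapping_eqI) (simp only: lookup_minus eq[OF that] diff_self_eq_0 lookup_zero)
  ultimately show ?thesis using u
    by (intro bexI[of _ "u - ?s"] conjI) (auto simp only: add.assoc intro: diff_in_monomials)
qed

text \<open>Positive and negative parts are convex, and \<open>z\<close> and \<open>D - z\<close> have compatible signs, so taking both steps
from \<open>x\<close> costs at least the sum of the costs of the single steps.\<close>

lemma monomial_of_convex:
  assumes "\<And>j. j < n \<Longrightarrow> z j = 0 \<or> z j = sgn (D j)"
  shows "\<exists>v. monomial_of n (\<lambda>j. x j - D j) + monomial_of n x
    = monomial_of n (\<lambda>j. x j - z j) + monomial_of n (\<lambda>j. x j - (D j - z j)) + v"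
proof -
  let ?l = "monomial_of n (\<lambda>j. x j - D j) + monomial_of n x"
  let ?r = "monomial_of n (\<lambda>j. x j - z j) + monomial_of n (\<lambda>j. x j - (D j - z j))"
  have pos: "nat (a - e) + nat (a - (b - e)) \<le> nat (a - b) + nat a"
    and neg: "nat (- (a - e)) + nat (- (a - (b - e))) \<le> nat (- (a - b)) + nat (- a)"
    if "e = 0 \<or> e = sgn b" for a b e :: int
    using that by (auto simp: sgn_if split: if_splits)
  have "Poly_Mapping.lookup ?r i \<le> Poly_Mapping.lookup ?l i" for i
  proof -
    consider "i = 0 \<or> i > n + n" | "1 \<le> i" "i \<le> n" | "n < i" "i \<le> n + n" by linarith
    then show ?thesis
    proof cases
      case 2
      with pos[of "z (i - 1)" "D (i - 1)" "x (i - 1)"] assms[of "i - 1"] show ?thesis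
        by (simp add: lookup_add lookup_monomial_of)
    next
      case 3
      with neg[of "z (i - 1 - n)" "D (i - 1 - n)" "x (i - 1 - n)"] assms[of "i - 1 - n"] show ?thesis
        by (simp add: lookup_add lookup_monomial_of)
    qed (auto simp: lookup_add lookup_monomial_of)
  qed
  then have "?l = ?r + (?l - ?r)"
    by (intro poly_mapping_eqI) (simp only: lookup_add[of ?r] lookup_minus le_add_diff_inverse)
  then show ?thesis by blast
qed

text \<open>If \<open>z\<close> does not lower the monomial of \<open>x\<close>, then by convexity the remaining part \<open>D - z\<close> does, and its entries
have a smaller sum of absolute values.\<close>

lemma conformal_exchange:
  assumes U: "unit_conformal A" and n: "n = dim_col A"
    and D: "kernel_vector A D" and less: "tail_less m (monomial_of n (\<lambda>j. x j - D j)) (monomial_of n x)"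
  shows "\<exists>z. kernel_vector A z \<and> (\<forall>j. \<bar>z j\<bar> \<le> 1) \<and>
    tail_less m (monomial_of n (\<lambda>j. x j - z j)) (monomial_of n x)"
  using D less
proof (induction "\<Sum>j<n. nat \<bar>D j\<bar>" arbitrary: D rule: less_induct)
  case (less D)
  have "\<exists>j<n. D j \<noteq> 0"
  proof (rule ccontr)
    assume "\<not> ?thesis"
    then have "monomial_of n (\<lambda>j. x j - D j) = monomial_of n x"
      by (intro monomial_of_cong) auto
    with less.prems(2) show False by (simp add: tail_less_irrefl)
  qed
  then obtain z where z: "kernel_vector A z" "\<exists>j<n. z j \<noteq> 0" "\<And>j. z j = 0 \<or> z j = sgn (D j)"
    using U less.prems(1) unfolding unit_conformal_def n by blast
  show ?case
  proof (cases "tail_less m (monomial_of n (\<lambda>j. x j - z j)) (monomial_of n x)")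
    case True
    moreover have "\<bar>z j\<bar> \<le> 1" for j using z(3)[of j] by (auto simp: sgn_if)
    ultimately show ?thesis using z(1) by blast
  next
    case False
    let ?D = "\<lambda>j. D j - z j"
    let ?p = "\<lambda>y. monomial_of n (\<lambda>j. x j - y j)" and ?x = "monomial_of n x"
    obtain v where v: "?p D + ?x = ?p z + ?p ?D + v"
      using monomial_of_convex[of n z D x] z(3) by blast
    have "tail_less m (?p z + ?p ?D) (?x + ?x)"
    proof -
      have "tail_less m (?p z + ?p ?D + v) (?x + ?x)"
        unfolding v[symmetric] tail_less_add_right by (rule less.prems)
      then show ?thesis by (rule tail_less_drop)
    qed
    moreover have "?x = ?p z \<or> tail_less m (?x + ?x) (?p z + ?x)"
      using False tail_less_linear[of m ?x "?p z"] by (auto simp: tail_less_add_right)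
    ultimately have "tail_less m (?p z + ?p ?D) (?p z + ?x)" by (auto intro: tail_less_trans)
    then have tl: "tail_less m (?p ?D) ?x" by (simp add: tail_less_add_left)
    have kD: "kernel_vector A ?D" using kernel_vector_diff[OF less.prems(1) z(1)] .
    have "(\<Sum>j<n. nat \<bar>?D j\<bar>) < (\<Sum>j<n. nat \<bar>D j\<bar>)"
    proof (rule sum_strict_mono_ex1)
      show "\<forall>j\<in>{..<n}. nat \<bar>?D j\<bar> \<le> nat \<bar>D j\<bar>"
      proof
        fix j show "nat \<bar>?D j\<bar> \<le> nat \<bar>D j\<bar>" using z(3)[of j] by (auto simp: sgn_if)
      qed
      obtain j where j: "j < n" "z j \<noteq> 0" using z(2) by blast
      then have "nat \<bar>?D j\<bar> < nat \<bar>D j\<bar>" using z(3)[of j] by (auto simp: sgn_if split: if_splits)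
      with j(1) show "\<exists>j\<in>{..<n}. nat \<bar>?D j\<bar> < nat \<bar>D j\<bar>" by blast
    qed simp
    from less.hyps[of ?D, OF this kD tl] show ?thesis .
  qed
qed

text \<open>A step of size at most one changes an entry \<open>x j \<noteq> 0\<close> in the same way as its sign: neither of them crosses
zero.\<close>

lemma monomial_of_sgn_exchange:
  assumes "\<And>j. \<bar>z j\<bar> \<le> 1"
  shows "monomial_of n x + monomial_of n (\<lambda>j. sgn (x j) - z j)
    = monomial_of n (\<lambda>j. sgn (x j)) + monomial_of n (\<lambda>j. x j - z j)"
proof -
  have *: "nat a + nat (sgn a - e) = nat (sgn a) + nat (a - e)"
    "nat (- a) + nat (e - sgn a) = nat (- sgn a) + nat (e - a)"
    if "\<bar>e\<bar> \<le> 1" for a e :: int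
  proof -
    have "e = 0 \<or> e = 1 \<or> e = -1" using that by arith
    then show "nat a + nat (sgn a - e) = nat (sgn a) + nat (a - e)"
      "nat (- a) + nat (e - sgn a) = nat (- sgn a) + nat (e - a)"
      by (elim disjE; auto simp: sgn_if)+
  qed
  show ?thesis
    by (rule poly_mapping_eqI) (simp add: lookup_add lookup_monomial_of * assms)
qed

text \<open>A monomial with two opposite variables has their product as a squarefree nonstandard divisor. Any other
nonstandard monomial is, up to the variable of the zero column, the monomial of its signed exponent
vector \<open>x\<close>; a \<open>0, \<plusminus>1\<close> step lowers it, and the same step lowers the squarefree monomial of the
signs of \<open>x\<close>.\<close>

theorem unit_conformal_imp_squarefree:
  fixes A
  defines "C \<equiv> centrally_symmetric A"
  assumes U: "unit_conformal A"
  shows "has_squarefree_initial_ideal (dim_col C) (toric_ideal C :: 'k::field mpoly set)"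
  unfolding squarefree_initial_ideal_iff
proof (intro exI[of _ "tail_order (dim_col C)"] conjI monomial_order_tail_order allI impI)
  define n where "n = dim_col A"
  let ?m = "dim_col C" and ?ns = "nonstandard (column_exponent C) (dim_col C) (tail_order (dim_col C))"
  have m: "?m = Suc (n + n)" by (simp add: C_def centrally_symmetric_dims n_def)
  note deg_iff = multidegree_centrally_symmetric_eq_iff[of A, folded C_def n_def]
  fix w assume ns: "?ns w"
  then have wm: "w \<in> monomials ?m" by (simp add: nonstandard_def)
  have "\<exists>u. squarefree_monomial u \<and> ?ns u \<and> (\<forall>i. Poly_Mapping.lookup u i \<le> Poly_Mapping.lookup w i)"
  proof (cases "\<forall>j<n. Poly_Mapping.lookup w (Suc j) = 0 \<or> Poly_Mapping.lookup w (Suc (n + j)) = 0")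
    case False
    then obtain j where j: "j < n" "Poly_Mapping.lookup w (Suc j) > 0" "Poly_Mapping.lookup w (Suc (n + j)) > 0"
      by auto
    let ?u = "Poly_Mapping.single (Suc j) 1 + Poly_Mapping.single (Suc (n + j)) (1::nat)"
    let ?v = "Poly_Mapping.single (0::nat) (2::nat)"
    have lk: "Poly_Mapping.lookup ?u i = (if i = Suc j \<or> i = Suc (n + j) then 1 else 0)" for i
      using j(1) by (auto simp: lookup_add lookup_single when_def)
    have lkv: "Poly_Mapping.lookup ?v i = (if i = 0 then 2 else 0)" for i
      by (auto simp: lookup_single when_def simp del: single_numeral)
    have td: "total_degree ?m (Poly_Mapping.single i c) = c" "tail_degree ?m (Poly_Mapping.single i c)
        = (if i = 0 then 0 else c)" if "i < ?m" for i c
      using that by (auto simp: total_degree_def tail_degree_def lookup_single when_def sum.delta')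
    have "?ns ?u"
      unfolding nonstandard_def
    proof (intro conjI bexI[of _ ?v])
      show "?u \<in> monomials ?m" using j(1) m by auto
      show "?v \<in> monomials ?m" by (rule single_in_monomials) (simp add: m)
      have "net_exponent n ?v i = net_exponent n ?u i" if "i < n" for i
        unfolding net_exponent_def lk lkv using j(1) that by auto
      moreover have deg: "total_degree ?m ?v = total_degree ?m ?u"
        using j(1) by (simp add: total_degree_add td[unfolded m] m del: single_numeral One_nat_def)
      ultimately show "multidegree (column_exponent C) ?m ?v = multidegree (column_exponent C) ?m ?u"
        unfolding deg_iff by (simp add: kernel_vector_def n_def)
      show "?v \<noteq> ?u"
      proof
        assume "?v = ?u"
        then have "Poly_Mapping.lookup ?v 0 = Poly_Mapping.lookup ?u 0" by (simp only:)
        then show False unfolding lk lkv by simp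
      qed
      have "tail_less ?m ?v ?u" using j(1) unfolding tail_less_def
        by (simp add: tail_degree_add td[unfolded m] m del: single_numeral One_nat_def)
      then show "(?v, ?u) \<in> tail_order ?m"
        using deg \<open>?u \<in> monomials ?m\<close> \<open>?v \<in> monomials ?m\<close> by (simp add: tail_order_def)
    qed
    moreover have "squarefree_monomial ?u" unfolding squarefree_monomial_def lk by simp
    moreover have "\<forall>i. Poly_Mapping.lookup ?u i \<le> Poly_Mapping.lookup w i" unfolding lk using j by simp
    ultimately show ?thesis by blast
  next
    case True
    define x where "x = net_exponent n w"
    obtain v where v: "v \<in> monomials ?m" "multidegree (column_exponent C) ?m v = multidegree (column_exponent C) ?m w"
      "v \<noteq> w" "(v, w) \<in> tail_order ?m" using ns by (auto simp: nonstandard_def)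
    have deg: "total_degree ?m v = total_degree ?m w" and ker: "kernel_vector A (\<lambda>j. net_exponent n v j - x j)"
      using v(2) by (simp_all add: deg_iff x_def)
    define D where "D = (\<lambda>j. x j - net_exponent n v j)"
    have kD: "kernel_vector A D" unfolding D_def using ker
      by (simp add: kernel_vector_def right_diff_distrib sum_subtractf)
    obtain w1 where w1: "w = Poly_Mapping.single 0 (Poly_Mapping.lookup w 0) + monomial_of n x"
      using monomial_of_net_exponent[of w n] wm True by (auto simp: m x_def)
    obtain \<nu> where \<nu>: "v = Poly_Mapping.single 0 (Poly_Mapping.lookup v 0) + (monomial_of n (net_exponent n v) + \<nu>)"
      using monomial_of_net_exponent[of v n] v(1) by (auto simp: m)
    have lt: "tail_less ?m v w" using v(3,4) deg by (auto simp: tail_order_def)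
    have td0: "tail_degree ?m (Poly_Mapping.single 0 c) = 0" for c
      by (simp add: tail_degree_def lookup_single)
    have "tail_less ?m (monomial_of n (net_exponent n v) + \<nu>) (monomial_of n x)"
    proof (cases "tail_degree ?m v < tail_degree ?m w")
      case True
      then have "tail_degree ?m (monomial_of n (net_exponent n v) + \<nu>) < tail_degree ?m (monomial_of n x)"
        by (subst (asm) w1, subst (asm) \<nu>) (simp add: tail_degree_add td0)
      then show ?thesis by (simp add: tail_less_def)
    next
      case False
      then have "tail_degree ?m v = tail_degree ?m w" using lt by (auto simp: tail_less_def)
      then have "Poly_Mapping.lookup v 0 = Poly_Mapping.lookup w 0"
        using deg by (simp add: total_degree_tail m)
      then have "tail_less ?m (Poly_Mapping.single 0 (Poly_Mapping.lookup w 0) + (monomial_of n (net_exponent n v) + \<nu>))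
          (Poly_Mapping.single 0 (Poly_Mapping.lookup w 0) + monomial_of n x)"
        using lt \<nu> w1 by simp
      then show ?thesis by (simp only: tail_less_add_left)
    qed
    then have "tail_less ?m (monomial_of n (net_exponent n v)) (monomial_of n x)"
      by (rule tail_less_drop)
    then have "tail_less ?m (monomial_of n (\<lambda>j. x j - D j)) (monomial_of n x)"
      by (simp add: D_def)
    from conformal_exchange[OF U n_def kD this] obtain z where z: "kernel_vector A z" "\<And>j. \<bar>z j\<bar> \<le> 1"
      "tail_less ?m (monomial_of n (\<lambda>j. x j - z j)) (monomial_of n x)" by blast
    let ?u = "monomial_of n (\<lambda>j. sgn (x j))" and ?v = "monomial_of n (\<lambda>j. sgn (x j) - z j)"
    have "tail_less ?m (?u + monomial_of n (\<lambda>j. x j - z j)) (?u + monomial_of n x)"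
      using z(3) by (simp only: tail_less_add_left)
    then have "tail_less ?m (monomial_of n x + ?v) (monomial_of n x + ?u)"
      unfolding monomial_of_sgn_exchange[of z n x, OF z(2)] by (simp only: add.commute)
    then have lt: "tail_less ?m ?v ?u" by (simp only: tail_less_add_left)
    then have tle: "tail_degree ?m ?v \<le> tail_degree ?m ?u" by (auto simp: tail_less_def)
    (* the power of the variable of the zero column that equalizes the total degrees *)
    define c where "c = tail_degree ?m ?u - tail_degree ?m ?v"
    let ?v' = "Poly_Mapping.single 0 c + ?v"
    have um: "?u \<in> monomials ?m" and vm: "?v' \<in> monomials ?m" by (simp_all add: m)
    have deg': "total_degree ?m ?v' = total_degree ?m ?u"
      using tle by (simp add: total_degree_tail tail_degree_add td0[unfolded m] m lookup_add lookup_monomial_of c_def)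
    have "?ns ?u"
      unfolding nonstandard_def
    proof (intro conjI bexI[of _ ?v'] um vm)
      have "net_exponent n ?v' j = sgn (x j) - z j" "net_exponent n ?u j = sgn (x j)" if "j < n" for j
        using that net_exponent_monomial_of[of j n]
        by (simp_all add: net_exponent_def lookup_add lookup_single)
      then have "kernel_vector A (\<lambda>j. net_exponent n ?v' j - net_exponent n ?u j)"
        using z(1) by (simp add: kernel_vector_def n_def sum_negf)
      then show "multidegree (column_exponent C) ?m ?v' = multidegree (column_exponent C) ?m ?u"
        unfolding deg_iff using deg' by simp
      have lt': "tail_less ?m ?v' ?u"
      proof (cases "c = 0")
        case False
        then show ?thesis using tle by (simp add: tail_less_def tail_degree_add td0 c_def)
      qed (use lt in simp)
      then show "?v' \<noteq> ?u" by (auto simp: tail_less_irrefl)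
      show "(?v', ?u) \<in> tail_order ?m" using lt' um vm deg' by (simp add: tail_order_def)
    qed
    moreover have "squarefree_monomial ?u"
      by (auto simp: squarefree_monomial_def lookup_monomial_of sgn_if)
    moreover have "Poly_Mapping.lookup ?u i \<le> Poly_Mapping.lookup w i" for i
      by (subst w1) (auto simp: lookup_add lookup_monomial_of sgn_if)
    ultimately show ?thesis by blast
  qed
  then obtain u where u: "squarefree_monomial u" "?ns u"
    "\<And>i. Poly_Mapping.lookup u i \<le> Poly_Mapping.lookup w i" by blast
  then have "w = u + (w - u)" by (intro poly_mapping_eqI) (simp add: lookup_add lookup_minus)
  then show "\<exists>u v. v \<in> monomials ?m \<and> w = u + v \<and> squarefree_monomial u \<and> ?ns u"
    using u wm diff_in_monomials by blast
qed

section \<open>Alternating closed walks in graphs without disjoint odd cycles\<close>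

text \<open>A closed walk, listed without repeating its first element at the end.\<close>

definition closed_chain :: "('a \<Rightarrow> 'a \<Rightarrow> bool) \<Rightarrow> 'a list \<Rightarrow> bool" where
  "closed_chain D ps \<longleftrightarrow> ps \<noteq> [] \<and> successively D (ps @ [hd ps])"

lemma closed_chain_split:
  assumes "closed_chain D (xs @ [y] @ ys @ [y] @ zs)"
  shows "closed_chain D (y # ys)" and "closed_chain D (xs @ y # zs)"
proof -
  let ?h = "hd (xs @ [y] @ ys @ [y] @ zs)"
  have s: "successively D (xs @ (y # ys @ [y]) @ zs @ [?h])"
    using assms by (simp add: closed_chain_def)
  have mid: "successively D (y # ys @ [y])"
    using s unfolding successively_append_iff by blast
  then show "closed_chain D (y # ys)" by (simp add: closed_chain_def)
  have "successively D ((y # ys) @ (y # zs @ [?h]))"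
    using s unfolding successively_append_iff[of D xs] by simp
  then have right: "successively D (y # zs @ [?h])"
    unfolding successively_append_iff by blast
  have "successively D xs \<and> (xs = [] \<or> D (last xs) y)"
    using s unfolding successively_append_iff[of D xs] by auto
  with right have "successively D (xs @ (y # zs @ [?h]))"
    unfolding successively_append_iff[of D xs] by auto
  moreover have "?h = hd (xs @ y # zs)" by (cases xs) auto
  ultimately show "closed_chain D (xs @ y # zs)" by (simp add: closed_chain_def)
qed

lemma closed_chain_rotate:
  assumes "closed_chain D (xs @ ys)"
  shows "closed_chain D (ys @ xs)"
proof (cases "xs = [] \<or> ys = []")
  case False
  with assms show ?thesis
    by (auto simp: closed_chain_def successively_append_iff)
qed (use assms in auto)

text \<open>A repeated vertex splits the walk into two shorter closed walks, one of which has odd length.\<close>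

lemma odd_closed_walk_contains_odd_cycle:
  assumes "\<forall>e\<in>E. card e = 2" "closed_chain (\<lambda>a b. {a, b} \<in> E) vs" "odd (length vs)"
  shows "\<exists>c. odd_cycle E c \<and> set c \<subseteq> set vs"
  using assms(2,3)
proof (induction "length vs" arbitrary: vs rule: less_induct)
  case less
  show ?case
  proof (cases "distinct vs")
    case True
    let ?L = "length vs"
    have step: "{vs ! i, vs ! (Suc i mod ?L)} \<in> E" if "i < ?L" for i
    proof -
      have "vs \<noteq> []" using that by auto
      have "{(vs @ [hd vs]) ! i, (vs @ [hd vs]) ! Suc i} \<in> E"
        using less.prems(1) that by (auto simp: closed_chain_def successively_conv_nth)
      moreover have "(vs @ [hd vs]) ! Suc i = vs ! (Suc i mod ?L)"
        using that \<open>vs \<noteq> []\<close> by (cases "Suc i = ?L") (auto simp: nth_append hd_conv_nth)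
      ultimately show ?thesis using that by (simp add: nth_append)
    qed
    have "?L \<noteq> 1"
    proof
      assume "?L = 1"
      with step[of 0] have "{vs ! 0} \<in> E" by simp
      with assms(1) show False by fastforce
    qed
    moreover have "?L \<noteq> 2" "?L \<noteq> 0" using less.prems(2) by auto
    ultimately have "3 \<le> ?L" by linarith
    with True step less.prems(2) have "odd_cycle E vs" by (simp add: odd_cycle_def is_cycle_def)
    then show ?thesis by blast
  next
    case False
    then obtain xs ys zs y where vs: "vs = xs @ [y] @ ys @ [y] @ zs"
      using not_distinct_decomp by blast
    note split = closed_chain_split[OF less.prems(1)[unfolded vs]]
    have "odd (length (y # ys)) \<or> odd (length (xs @ y # zs))"
      using less.prems(2) unfolding vs by auto
    then show ?thesis
    proof
      assume "odd (length (y # ys))"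
      from less.hyps[OF _ split(1) this] show ?thesis by (auto simp: vs)
    next
      assume "odd (length (xs @ y # zs))"
      from less.hyps[OF _ split(2) this] show ?thesis by (auto simp: vs)
    qed
  qed
qed

text \<open>Walks with alternating signs are walks in a directed graph on states \<open>(v, b)\<close>, where \<open>b\<close> is the sign
required of the edge by which the vertex \<open>v\<close> is left next. Traversing an edge backwards reverses the
step and flips both states, so this directed graph is skew-symmetric.\<close>

definition flip :: "'a \<times> bool \<Rightarrow> 'a \<times> bool" where
  "flip p = (fst p, \<not> snd p)"

lemma flip_simps [simp]: "flip (flip p) = p" "fst (flip p) = fst p" "snd (flip p) \<longleftrightarrow> \<not> snd p"
  "flip p \<noteq> p" "p \<noteq> flip p"
  by (auto simp: flip_def prod_eq_iff)

lemma same_fst_cases: "fst p = fst q \<Longrightarrow> q = p \<or> q = flip p"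
  by (auto simp: flip_def prod_eq_iff)

lemma shortest_closed_chain_distinct:
  assumes "closed_chain D ps" and min: "\<And>qs. closed_chain D qs \<Longrightarrow> length ps \<le> length qs"
  shows "distinct ps"
proof (rule ccontr)
  assume "\<not> distinct ps"
  then obtain xs ys zs y where ps: "ps = xs @ [y] @ ys @ [y] @ zs"
    using not_distinct_decomp by blast
  from min[OF closed_chain_split(1)[OF assms(1)[unfolded ps]]] show False by (simp add: ps)
qed

text \<open>A vertex common to \<open>W1\<close> and \<open>W2\<close> occurs as \<open>r\<close> in the former and as \<open>flip r\<close> in the latter, because a
shortest closed walk repeats no state. Following \<open>W1\<close> up to \<open>r\<close> and then the flipped reverse of the
part of \<open>W2\<close> before \<open>flip r\<close> leads back to \<open>p\<close>, which is a shorter closed walk.\<close>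

lemma shortest_closed_chain_disjoint:
  assumes skew: "\<And>p q. D p q \<Longrightarrow> D (flip q) (flip p)"
    and cc: "closed_chain D (p # W1 @ W2)"
    and min: "\<And>qs. closed_chain D qs \<Longrightarrow> length (p # W1 @ W2) \<le> length qs"
    and W1: "W1 \<noteq> []" and W2: "W2 \<noteq> []" "hd W2 = flip p"
  shows "fst ` set W1 \<inter> fst ` set W2 = {}"
proof (rule ccontr)
  assume "\<not> ?thesis"
  then obtain r r' where r: "r \<in> set W1" "r' \<in> set W2" "fst r = fst r'" by auto
  have dist: "distinct (p # W1 @ W2)" using shortest_closed_chain_distinct[OF cc min] by blast
  then have "r' = flip r" using r same_fst_cases[of r r'] by auto
  obtain A B where AB: "W1 = A @ r # B" using r(1) by (meson split_list)
  obtain A' B' where AB': "W2 = A' @ flip r # B'"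
    using r(2) unfolding \<open>r' = flip r\<close> by (meson split_list)
  let ?N = "A @ r # map flip (rev A')"
  have s: "successively D (p # (A @ r # B) @ (A' @ flip r # B') @ [p])"
    using cc by (simp add: closed_chain_def AB AB')
  have "successively D ((p # A @ [r]) @ (B @ W2 @ [p]))"
    and "successively D ((p # W1) @ (A' @ [flip r]) @ (B' @ [p]))"
    using s by (simp_all add: AB AB')
  then have sA: "successively D (p # A @ [r])" and sA': "successively D (A' @ [flip r])"
    unfolding successively_append_iff by blast+
  have "successively (\<lambda>x y. D y x) (rev (A' @ [flip r]))"
    using sA' by (simp only: successively_rev)
  then have "successively D (map flip (rev (A' @ [flip r])))"
    unfolding successively_map by (rule successively_mono) (rule skew)
  then have sN: "successively D (r # map flip (rev A'))" by simp
  have lastN: "last (r # map flip (rev A')) = p"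
  proof (cases A')
    case Nil
    then have "flip p = flip r" using W2(2) AB' by simp
    then have "p = r" by (metis flip_simps(1))
    then show ?thesis using Nil by simp
  next
    case (Cons a as)
    then have "a = flip p" using W2(2) AB' by simp
    then show ?thesis using Cons by (simp add: last_map)
  qed
  have "D p (hd (A @ [r]))" using sA by (cases A) (auto simp: successively_Cons)
  then have close: "D p (hd ?N)" by (cases A) auto
  have "successively D (A @ r # map flip (rev A'))"
    using sA sN by (auto simp: successively_append_iff successively_Cons)
  moreover have "last ?N = p" using lastN by simp
  ultimately have "successively D (?N @ [hd ?N])"
    unfolding successively_append_iff[of D ?N] using close by simp
  then have "closed_chain D ?N" by (simp add: closed_chain_def)
  from min[OF this] show False by (simp add: AB AB')
qed

lemma alternating_chain_snd:
  assumes "successively D P" "\<And>p q. D p q \<Longrightarrow> snd q = (\<not> snd p)" "i < length P"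
  shows "snd (P ! i) = (if even i then snd (hd P) else \<not> snd (hd P))"
  using assms(3)
proof (induction i)
  case 0
  then show ?case by (simp add: hd_conv_nth)
next
  case (Suc i)
  have "D (P ! i) (P ! Suc i)" using assms(1) Suc.prems by (simp add: successively_conv_nth)
  from assms(2)[OF this] Suc show ?case by auto
qed

text \<open>The signs alternate along the walk and differ at its ends, so the underlying closed walk on the vertices
has odd length.\<close>

lemma flip_chain_odd_cycle:
  assumes E: "\<forall>e\<in>E. card e = 2" and P: "successively D P" "P \<noteq> []" "last P = flip (hd P)"
    and D: "\<And>p q. D p q \<Longrightarrow> snd q = (\<not> snd p)" "\<And>p q. D p q \<Longrightarrow> {fst p, fst q} \<in> E"
  shows "\<exists>c. odd_cycle E c \<and> set c \<subseteq> fst ` set (butlast P)"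
proof -
  have "length P \<noteq> 1" using P(3) by (cases P) auto
  then have bl: "butlast P \<noteq> []" using P(2) by (cases P) (auto split: if_splits)
  have "snd (P ! (length P - 1)) = (\<not> snd (hd P))"
    using P(3) last_conv_nth[OF P(2)] by simp
  then have odd: "odd (length P - 1)"
    using alternating_chain_snd[OF P(1) D(1), of "length P - 1"] P(2) by (auto split: if_splits)
  have hd: "hd (butlast P) = hd P" using bl by (cases P) auto
  have "map fst P = map fst (butlast P @ [last P])" using P(2) by simp
  also have "\<dots> = map fst (butlast P) @ [hd (map fst (butlast P))]"
    using P(3) bl hd by (simp add: hd_map del: append_butlast_last_id)
  finally have "map fst P = map fst (butlast P) @ [hd (map fst (butlast P))]" .
  moreover have "successively (\<lambda>a b. {a, b} \<in> E) (map fst P)"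
    unfolding successively_map using P(1) by (rule successively_mono) (rule D(2))
  ultimately have "closed_chain (\<lambda>a b. {a, b} \<in> E) (map fst (butlast P))"
    using bl by (simp add: closed_chain_def)
  from odd_closed_walk_contains_odd_cycle[OF E this] odd show ?thesis by simp
qed

lemma finite_no_sink_closed_chain:
  assumes "finite T" "p0 \<in> T" "\<And>p. p \<in> T \<Longrightarrow> \<exists>q\<in>T. D p q"
  shows "\<exists>ps. closed_chain D ps"
proof -
  obtain s where s: "\<And>p. p \<in> T \<Longrightarrow> s p \<in> T \<and> D p (s p)" using assms(3) by metis
  define f where "f i = (s ^^ i) p0" for i
  have fT: "f i \<in> T" for i unfolding f_def by (induction i) (auto simp: assms(2) s)
  have fD: "D (f i) (f (Suc i))" for i using s[OF fT[of i]] by (simp add: f_def)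
  have "\<not> inj f"
  proof
    assume "inj f"
    moreover have "finite (range f)" using fT assms(1) by (meson finite_subset image_subsetI)
    ultimately show False using finite_imageD by blast
  qed
  then obtain i j where ij: "i < j" "f i = f j" unfolding inj_def by (metis linorder_neqE_nat)
  have "map f [i..<j] @ [hd (map f [i..<j])] = map f [i..<Suc j]"
    using ij by (simp add: hd_map)
  moreover have "successively D (map f [i..<Suc j])"
    unfolding successively_conv_nth using fD by (auto simp del: upt_Suc)
  ultimately have "closed_chain D (map f [i..<j])" using ij by (simp add: closed_chain_def)
  then show ?thesis by blast
qed

definition sign_of :: "bool \<Rightarrow> int" where
  "sign_of b = (if b then 1 else -1)"

lemma sign_of_simps [simp]: "sign_of (\<not> b) = - sign_of b" "sign_of b = sign_of c \<longleftrightarrow> b = c" "sign_of b \<noteq> 0"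
  by (auto simp: sign_of_def)

definition alternating_step :: "'a set set \<Rightarrow> ('a set \<Rightarrow> int) \<Rightarrow> 'a \<times> bool \<Rightarrow> 'a \<times> bool \<Rightarrow> bool" where
  "alternating_step E w p q \<longleftrightarrow>
     {fst p, fst q} \<in> E \<and> sgn (w {fst p, fst q}) = sign_of (snd p) \<and> snd q = (\<not> snd p)"

lemma alternating_step_flip:
  "alternating_step E w p q \<Longrightarrow> alternating_step E w (flip q) (flip p)"
  by (simp add: alternating_step_def insert_commute)

text \<open>If all nonzero weights at \<open>v\<close> had the same sign, their sum would not vanish.\<close>

lemma opposite_edge_exists:
  fixes w :: "'a set \<Rightarrow> int"
  assumes E: "finite E" and e: "e \<in> E" "v \<in> e" "sgn (w e) = sign_of b"
    and sum0: "(\<Sum>e\<in>{e \<in> E. v \<in> e}. w e) = 0"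
  shows "\<exists>e'\<in>E. v \<in> e' \<and> sgn (w e') = sign_of (\<not> b)"
proof (rule ccontr)
  assume *: "\<not> ?thesis"
  have nn: "0 \<le> sign_of b * w e'" if "e' \<in> {e \<in> E. v \<in> e}" for e'
    using * that by (auto simp: sign_of_def sgn_if split: if_splits)
  have "0 = (\<Sum>e\<in>{e \<in> E. v \<in> e}. sign_of b * w e)" using sum0 by (simp flip: sum_distrib_left)
  then have "\<forall>e\<in>{e \<in> E. v \<in> e}. sign_of b * w e = 0"
    using sum_nonneg_eq_0_iff[of "{e \<in> E. v \<in> e}" "\<lambda>e. sign_of b * w e"] nn E by auto
  then have "w e = 0" using e by auto
  with e(3) show False by simp
qed

lemma alternating_closed_chain_exists:
  fixes w :: "'a set \<Rightarrow> int"
  assumes V: "finite V" and E: "\<forall>e\<in>E. e \<subseteq> V \<and> card e = 2"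
    and ker: "\<And>v. v \<in> V \<Longrightarrow> (\<Sum>e\<in>{e \<in> E. v \<in> e}. w e) = 0"
    and e0: "e0 \<in> E" "w e0 \<noteq> 0"
  shows "\<exists>ps. closed_chain (alternating_step E w) ps"
proof -
  let ?D = "alternating_step E w"
  define T where "T = {p. fst p \<in> V \<and> (\<exists>q. ?D p q)}"
  have "finite E" using V E by (intro finite_subset[of E "Pow V"]) auto
  have other: "\<exists>u. e = {v, u}" if "e \<in> E" "v \<in> e" for e v
    using E that by (metis card_2_iff' doubleton_eq_iff insert_iff card_2_iff singletonD)
  have stepT: "(v, b) \<in> T" if "e \<in> E" "v \<in> e" "sgn (w e) = sign_of b" for e v b
  proof -
    obtain u where "e = {v, u}" using other \<open>e \<in> E\<close> \<open>v \<in> e\<close> by blast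
    with that have "?D (v, b) (u, \<not> b)" by (simp add: alternating_step_def)
    moreover have "v \<in> V" using E that by blast
    ultimately show ?thesis unfolding T_def by force
  qed
  have "finite T" by (rule finite_subset[of _ "V \<times> UNIV"]) (auto simp: T_def V)
  moreover obtain v where "v \<in> e0" using E e0(1) by (metis card.empty equals0I zero_neq_numeral)
  then have "(v, w e0 > 0) \<in> T"
    using e0 by (intro stepT[of e0]) (auto simp: sgn_if sign_of_def)
  moreover have "\<exists>q\<in>T. ?D p q" if "p \<in> T" for p
  proof -
    obtain q where q: "?D p q" using \<open>p \<in> T\<close> by (auto simp: T_def)
    then have e: "{fst p, fst q} \<in> E" "sgn (w {fst p, fst q}) = sign_of (snd p)" "snd q = (\<not> snd p)"
      by (auto simp: alternating_step_def)
    have "fst q \<in> V" using e(1) E by auto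
    from opposite_edge_exists[OF \<open>finite E\<close> e(1) _ e(2) ker[OF this]]
    obtain e' where "e' \<in> E" "fst q \<in> e'" "sgn (w e') = sign_of (snd q)" using e(3) by auto
    from stepT[OF this] q show ?thesis by auto
  qed
  ultimately show ?thesis by (rule finite_no_sink_closed_chain)
qed

text \<open>An edge determines the sign of its states, so an edge that is used twice is used in both directions, by
\<open>p \<rightarrow> q\<close> and by \<open>flip q \<rightarrow> flip p\<close>. The walk from \<open>q\<close> to \<open>flip q\<close> and the one from \<open>flip p\<close> back to \<open>p\<close>
have no common vertex, and each contains an odd cycle.\<close>

lemma shortest_alternating_edges_distinct:
  fixes w :: "nat set \<Rightarrow> int" and E
  defines "D \<equiv> alternating_step E w"
  assumes E: "\<forall>e\<in>E. card e = 2"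
    and no_disjoint: "\<And>c c'. odd_cycle E c \<Longrightarrow> odd_cycle E c' \<Longrightarrow> set c \<inter> set c' \<noteq> {}"
    and cc: "closed_chain D ps" and min: "\<And>qs. closed_chain D qs \<Longrightarrow> length ps \<le> length qs"
    and "i < j" and j: "j < length ps"
  shows "{fst (ps ! i), fst ((ps @ [hd ps]) ! Suc i)} \<noteq> {fst (ps ! j), fst ((ps @ [hd ps]) ! Suc j)}"
proof
  let ?qs = "ps @ [hd ps]"
  assume eq: "{fst (ps ! i), fst (?qs ! Suc i)} = {fst (ps ! j), fst (?qs ! Suc j)}"
  have i: "i < length ps" "i \<noteq> j" using \<open>i < j\<close> j by auto
  have step: "D (ps ! k) (?qs ! Suc k)" if "k < length ps" for k
  proof -
    have "D (?qs ! k) (?qs ! Suc k)" using cc that by (auto simp: closed_chain_def successively_conv_nth)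
    then show ?thesis using that by (simp add: nth_append)
  qed
  have dist: "distinct ps" using shortest_closed_chain_distinct[OF cc min] by blast
  note si = step[OF i(1)] and sj = step[OF j]
  have sgn: "snd (ps ! i) = snd (ps ! j)"
    using si sj eq unfolding D_def alternating_step_def by (metis sign_of_simps(2))
  have "fst (ps ! i) \<noteq> fst (ps ! j)"
  proof
    assume "fst (ps ! i) = fst (ps ! j)"
    with sgn have "ps ! i = ps ! j" by (simp add: prod_eq_iff)
    with dist i j show False by (simp add: nth_eq_iff_index_eq)
  qed
  with eq have x: "fst (ps ! i) = fst (?qs ! Suc j)" "fst (ps ! j) = fst (?qs ! Suc i)"
    by (auto simp: doubleton_eq_iff)
  define p q where "p = ps ! i" and "q = ?qs ! Suc i"
  have pj: "ps ! j = flip q" "?qs ! Suc j = flip p"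
    using x sgn si sj unfolding D_def alternating_step_def p_def q_def flip_def
    by (simp_all add: prod_eq_iff)
  (* the two steps sit at positions i and j; rotating the walk by i makes p its first state *)
  define X Y Z where "X = take i ps" and "Y = take (j - Suc i) (drop (Suc i) ps)" and "Z = drop (Suc j) ps"
  have ps: "ps = X @ p # Y @ flip q # Z"
  proof -
    have "drop (Suc i) ps = Y @ drop (Suc i) ps ! (j - Suc i) # drop (Suc (j - Suc i)) (drop (Suc i) ps)"
      unfolding Y_def using \<open>i < j\<close> j by (intro id_take_nth_drop) auto
    also have "drop (Suc i) ps ! (j - Suc i) = flip q" using \<open>i < j\<close> j pj by simp
    also have "drop (Suc (j - Suc i)) (drop (Suc i) ps) = Z" using \<open>i < j\<close> by (simp add: Z_def)
    finally show ?thesis using id_take_nth_drop[OF i(1)] by (simp add: X_def p_def)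
  qed
  have lens: "length X = i" "length Y = j - Suc i" using \<open>i < j\<close> j by (auto simp: X_def Y_def)
  define W1 W2 where "W1 = Y @ [flip q]" and "W2 = Z @ X"
  have ccr: "closed_chain D (p # W1 @ W2)"
    using cc closed_chain_rotate[of D X "p # W1 @ Z"] by (simp add: W1_def W2_def ps)
  have lenr: "length (p # W1 @ W2) = length ps" by (simp add: ps W1_def W2_def)
  have hdW1: "hd W1 = q"
  proof -
    have "?qs ! Suc i = hd W1"
      unfolding W1_def by (cases Y) (simp_all add: ps lens(1)[symmetric] nth_append)
    then show ?thesis by (simp add: q_def)
  qed
  have W2: "W2 \<noteq> [] \<and> hd W2 = flip p"
  proof -
    have "Suc j = length (X @ p # Y @ [flip q])" using lens \<open>i < j\<close> by simp
    moreover have "?qs = (X @ p # Y @ [flip q]) @ (Z @ [hd ps])" by (simp add: ps)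
    ultimately have "?qs ! Suc j = (Z @ [hd ps]) ! 0" by (metis nth_append_length_plus add_0_right)
    then have *: "hd (Z @ [hd ps]) = flip p" using pj(2) by (simp add: hd_conv_nth)
    have "hd ps = hd (X @ [p])" by (cases X) (simp_all add: ps)
    with * have "hd (Z @ X @ [p]) = flip p" by (cases Z; cases X) simp_all
    then show ?thesis unfolding W2_def by (cases Z; cases X) auto
  qed
  have disj: "fst ` set W1 \<inter> fst ` set W2 = {}"
  proof (rule shortest_closed_chain_disjoint[of D])
    show "D (flip q) (flip p)" if "D p q" for p q
      using that unfolding D_def by (rule alternating_step_flip)
    show "closed_chain D (p # W1 @ W2)" by (rule ccr)
    show "length (p # W1 @ W2) \<le> length qs" if "closed_chain D qs" for qs
      using min[OF that] lenr by simp
  qed (use W2 in \<open>auto simp: W1_def\<close>)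
  have s: "successively D (p # W1 @ W2 @ [p])" using ccr by (simp add: closed_chain_def)
  have sW1: "successively D W1" and sW2: "successively D (W2 @ [p])"
    using s by (auto simp: successively_append_iff successively_Cons)
  have D1: "snd q = (\<not> snd p)" and D2: "{fst p, fst q} \<in> E" if "D p q" for p q
    using that by (auto simp: D_def alternating_step_def)
  have "\<exists>c. odd_cycle E c \<and> set c \<subseteq> fst ` set (butlast W1)"
    by (rule flip_chain_odd_cycle[OF E sW1 _ _ D1 D2]) (auto simp: hdW1, auto simp: W1_def)
  moreover have "\<exists>c. odd_cycle E c \<and> set c \<subseteq> fst ` set (butlast (W2 @ [p]))"
    by (rule flip_chain_odd_cycle[OF E sW2 _ _ D1 D2]) (use W2 in auto)
  ultimately obtain c c' where c: "odd_cycle E c" "set c \<subseteq> fst ` set (butlast W1)"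
    "odd_cycle E c'" "set c' \<subseteq> fst ` set W2" by auto
  from c(2) have "set c \<subseteq> fst ` set W1" using in_set_butlastD[of _ W1] by blast
  with c(1,3,4) show False using no_disjoint[of c c'] disj by blast
qed

section \<open>Edge functions and the edge matrix\<close>

lemma edge_matrix_dims [simp]:
  "dim_row (edge_matrix d es) = d" "dim_col (edge_matrix d es) = length es"
  by (simp_all add: edge_matrix_def)

lemma edge_matrix_entry:
  "k < d \<Longrightarrow> j < length es \<Longrightarrow> edge_matrix d es $$ (k, j) = (if Suc k \<in> es ! j then 1 else 0)"
  by (simp add: edge_matrix_def edge_vec_def mat_of_cols_index)

text \<open>The edge matrix applied to a function on the edges, evaluated at the vertex \<open>v\<close>.\<close>

definition boundary :: "nat set set \<Rightarrow> (nat set \<Rightarrow> int) \<Rightarrow> nat \<Rightarrow> int" where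
  "boundary E f v = (\<Sum>e\<in>{e \<in> E. v \<in> e}. f e)"

lemma boundary_add: "boundary E (\<lambda>e. f e + g e) v = boundary E f v + boundary E g v"
  by (simp add: boundary_def sum.distrib)

lemma boundary_diff: "boundary E (\<lambda>e. f e - g e) v = boundary E f v - boundary E g v"
  by (simp add: boundary_def sum_subtractf)

lemma boundary_mult: "boundary E (\<lambda>e. c * f e) v = c * boundary E f v"
  by (simp add: boundary_def sum_distrib_left)

lemma boundary_sum: "boundary E (\<lambda>e. \<Sum>i\<in>I. f i e) v = (\<Sum>i\<in>I. boundary E (f i) v)"
  unfolding boundary_def by (rule sum.swap)

definition edge_indicator :: "nat set \<Rightarrow> nat set \<Rightarrow> int" where
  "edge_indicator e0 e = (if e = e0 then 1 else 0)"

lemma boundary_edge_indicator: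
  assumes "finite E" "{a, b} \<in> E" "a \<noteq> b"
  shows "boundary E (edge_indicator {a, b}) v = (if v = a then 1 else 0) + (if v = b then 1 else 0)"
proof -
  have "boundary E (edge_indicator {a, b}) v = (if v \<in> {a, b} then 1 else 0)"
    unfolding boundary_def edge_indicator_def using assms by (simp add: sum.delta)
  then show ?thesis using assms(3) by auto
qed

lemma edge_matrix_mult:
  assumes "distinct es" "k < d"
  shows "(\<Sum>j<length es. edge_matrix d es $$ (k, j) * f (es ! j)) = boundary (set es) f (Suc k)"
proof -
  have "(\<Sum>j<length es. edge_matrix d es $$ (k, j) * f (es ! j))
      = (\<Sum>j<length es. (if Suc k \<in> es ! j then f (es ! j) else 0))"
    by (intro sum.cong refl) (auto simp: edge_matrix_entry assms(2))
  also have "\<dots> = (\<Sum>e\<in>set es. (if Suc k \<in> e then f e else 0))"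
    by (rule sum.reindex_bij_betw[OF bij_betw_nth[OF assms(1) refl refl]])
  also have "\<dots> = boundary (set es) f (Suc k)"
    unfolding boundary_def by (rule sum.inter_filter[symmetric]) simp
  finally show ?thesis .
qed

definition edge_index :: "nat set list \<Rightarrow> nat set \<Rightarrow> nat" where
  "edge_index es e = (THE j. j < length es \<and> es ! j = e)"

lemma edge_index_nth: "distinct es \<Longrightarrow> j < length es \<Longrightarrow> edge_index es (es ! j) = j"
  unfolding edge_index_def by (rule the_equality) (auto simp: nth_eq_iff_index_eq)

lemma edge_matrix_mult_index:
  assumes "distinct es" "k < d"
  shows "(\<Sum>j<length es. edge_matrix d es $$ (k, j) * x j)
    = boundary (set es) (\<lambda>e. x (edge_index es e)) (Suc k)"
  unfolding edge_matrix_mult[OF assms, symmetric]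
  by (intro sum.cong refl) (simp add: edge_index_nth assms(1))

lemma kernel_vector_edge_matrix:
  assumes "distinct es"
  shows "kernel_vector (edge_matrix d es) (\<lambda>j. f (es ! j)) \<longleftrightarrow> (\<forall>v\<in>{1..d}. boundary (set es) f v = 0)"
proof -
  have "(\<forall>v\<in>{1..d}. boundary (set es) f v = 0) \<longleftrightarrow> (\<forall>k<d. boundary (set es) f (Suc k) = 0)"
    unfolding image_Suc_lessThan[symmetric] by auto
  then show ?thesis by (simp add: kernel_vector_def edge_matrix_mult[OF assms])
qed

text \<open>The edges of a shortest alternating closed walk, with their signs, form a kernel vector: at every vertex
the contributions of the incoming and the outgoing edges cancel because consecutive signs differ.
As no edge is used twice, its entries are the signs of the weights.\<close>

theorem no_disjoint_odd_cycles_imp_unit_conformal: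
  assumes G: "simple_graph {1..d} E" and es: "distinct es" "set es = E"
    and no_disjoint: "\<And>c c'. odd_cycle E c \<Longrightarrow> odd_cycle E c' \<Longrightarrow> set c \<inter> set c' \<noteq> {}"
  shows "unit_conformal (edge_matrix d es)"
  unfolding unit_conformal_def
proof (intro allI impI)
  fix w' assume w': "kernel_vector (edge_matrix d es) w' \<and> (\<exists>j<dim_col (edge_matrix d es). w' j \<noteq> 0)"
  define w where "w = (\<lambda>e. w' (edge_index es e))"
  have w: "w (es ! j) = w' j" if "j < length es" for j using that es by (simp add: w_def edge_index_nth)
  have E: "\<forall>e\<in>E. e \<subseteq> {1..d} \<and> card e = 2" using G by (simp add: simple_graph_def)
  have finE: "finite E" using es by auto
  have ker: "boundary E w v = 0" if "v \<in> {1..d}" for v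
  proof -
    have "boundary E w (Suc (v - 1)) = 0"
      using w' edge_matrix_mult_index[OF es(1), of "v - 1" d w'] that es(2)
      by (auto simp: kernel_vector_def w_def)
    then show ?thesis using that by simp
  qed
  obtain j0 where j0: "j0 < length es" "w' j0 \<noteq> 0" using w' by auto
  let ?D = "alternating_step E w"
  have "\<exists>ps. closed_chain ?D ps"
  proof (rule alternating_closed_chain_exists[OF _ E])
    show "es ! j0 \<in> E" "w (es ! j0) \<noteq> 0" using j0 es w by auto
  qed (use ker in \<open>auto simp: boundary_def\<close>)
  then obtain ps where ps: "closed_chain ?D ps"
    and min: "\<And>qs. closed_chain ?D qs \<Longrightarrow> length ps \<le> length qs"
    using ex_has_least_nat[of "closed_chain ?D" _ length] by blast
  define L qs where "L = length ps" and "qs = ps @ [hd ps]"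
  define edge where "edge i = {fst (qs ! i), fst (qs ! Suc i)}" for i
  have pse: "ps \<noteq> []" using ps by (simp add: closed_chain_def)
  have edge: "edge i = {fst (ps ! i), fst ((ps @ [hd ps]) ! Suc i)}" if "i < L" for i
    using that by (simp add: edge_def qs_def L_def nth_append)
  have "edge i \<noteq> edge j" if "i < j" "j < L" for i j
    using shortest_alternating_edges_distinct[OF _ no_disjoint ps min \<open>i < j\<close>] that E
    by (simp add: edge L_def)
  then have inj: "inj_on edge {..<L}" by (metis (no_types, lifting) inj_onI lessThan_iff linorder_neqE_nat)
  have step: "?D (qs ! i) (qs ! Suc i)" if "i < L" for i
    using ps that by (auto simp: closed_chain_def successively_conv_nth qs_def L_def)
  then have edgeE: "edge i \<in> E" and sgn: "sgn (w (edge i)) = sign_of (snd (qs ! i))"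
    and alt: "snd (qs ! Suc i) = (\<not> snd (qs ! i))" if "i < L" for i
    using that by (auto simp: alternating_step_def edge_def)
  have neq: "fst (qs ! i) \<noteq> fst (qs ! Suc i)" if "i < L" for i
    using E edgeE[OF that] by (auto simp: edge_def)
  define z where "z e = (if e \<in> edge ` {..<L} then sgn (w e) else 0)" for e
  have "boundary E z v = 0" for v
  proof -
    define g where "g i = (if fst (qs ! i) = v then sign_of (snd (qs ! i)) else 0)" for i
    have "boundary E z v = (\<Sum>e\<in>E. if v \<in> e \<and> e \<in> edge ` {..<L} then sgn (w e) else 0)"
      unfolding boundary_def z_def by (subst sum.inter_filter[OF finE]) (auto intro!: sum.cong)
    also have "\<dots> = (\<Sum>e\<in>edge ` {..<L}. if v \<in> e then sgn (w e) else 0)"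
      using edgeE finE by (intro sum.mono_neutral_cong_right) auto
    also have "\<dots> = (\<Sum>i<L. if v \<in> edge i then sgn (w (edge i)) else 0)"
      by (simp add: sum.reindex[OF inj])
    (* both end points of an edge are counted with the sign of the edge, which is opposite to the sign
       of the next state *)
    also have "\<dots> = (\<Sum>i<L. g i - g (Suc i))"
    proof (intro sum.cong refl)
      fix i assume "i \<in> {..<L}"
      then have i: "i < L" by simp
      show "(if v \<in> edge i then sgn (w (edge i)) else 0) = g i - g (Suc i)"
        unfolding sgn[OF i] g_def alt[OF i] using neq[OF i] by (auto simp: edge_def)
    qed
    also have "\<dots> = g 0 - g L" by (rule sum_lessThan_telescope')
    also have "qs ! 0 = qs ! L" using pse by (simp add: qs_def L_def nth_append hd_conv_nth)
    then have "g 0 - g L = 0" by (simp add: g_def)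
    finally show ?thesis .
  qed
  then have zk: "kernel_vector (edge_matrix d es) (\<lambda>j. z (es ! j))"
    by (simp add: kernel_vector_edge_matrix[OF es(1)] es(2))
  have "L > 0" using pse by (simp add: L_def)
  then have "edge 0 \<in> E" and "z (edge 0) \<noteq> 0"
    using edgeE sgn by (auto simp: z_def)
  then obtain j1 where "j1 < length es" "z (es ! j1) \<noteq> 0" using es(2) by (metis in_set_conv_nth)
  let ?z = "\<lambda>j. if j < length es then z (es ! j) else 0"
  show "\<exists>z. kernel_vector (edge_matrix d es) z \<and> (\<exists>j<dim_col (edge_matrix d es). z j \<noteq> 0) \<and>
      (\<forall>j. z j = 0 \<or> z j = sgn (w' j))"
  proof (intro exI[of _ ?z] conjI)
    show "kernel_vector (edge_matrix d es) ?z" using zk by (simp add: kernel_vector_def)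
    show "\<exists>j<dim_col (edge_matrix d es). ?z j \<noteq> 0"
      using \<open>j1 < length es\<close> \<open>z (es ! j1) \<noteq> 0\<close> by auto
    show "\<forall>j. ?z j = 0 \<or> ?z j = sgn (w' j)" using w by (auto simp: z_def)
  qed
qed

section \<open>Two disjoint odd cycles\<close>

definition cycle_edge :: "nat list \<Rightarrow> nat \<Rightarrow> nat set" where
  "cycle_edge c i = {c ! i, c ! (Suc i mod length c)}"

definition cycle_function :: "nat list \<Rightarrow> nat set \<Rightarrow> int" where
  "cycle_function c e = (\<Sum>i<length c. edge_indicator (cycle_edge c i) e)"

text \<open>Every second edge of an odd cycle, starting with the one after the first: a perfect matching of the
vertices other than the first.\<close>

definition matching_function :: "nat list \<Rightarrow> nat set \<Rightarrow> int" where
  "matching_function c e = (\<Sum>t<length c div 2. edge_indicator (cycle_edge c (Suc (2 * t))) e)"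

lemma cycle_edge_facts:
  assumes "is_cycle E c" "i < length c"
  shows "cycle_edge c i \<in> E" "c ! i \<noteq> c ! (Suc i mod length c)" "cycle_edge c i \<subseteq> set c"
proof -
  have l: "3 \<le> length c" "distinct c" using assms by (auto simp: is_cycle_def)
  show "cycle_edge c i \<in> E" using assms by (simp add: is_cycle_def cycle_edge_def)
  have m: "Suc i mod length c < length c" using l by (intro mod_less_divisor) linarith
  have "i \<noteq> Suc i mod length c"
    using l assms(2) by (cases "Suc i = length c") auto
  then show "c ! i \<noteq> c ! (Suc i mod length c)"
    using l(2) assms(2) m by (simp add: nth_eq_iff_index_eq)
  show "cycle_edge c i \<subseteq> set c" using assms(2) m by (simp add: cycle_edge_def)
qed

lemma cycle_vertices_subset:
  assumes "simple_graph V E" "is_cycle E c"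
  shows "set c \<subseteq> V"
proof
  fix v assume "v \<in> set c"
  then obtain i where "i < length c" "c ! i = v" by (metis in_set_conv_nth)
  with cycle_edge_facts(1)[OF assms(2), of i] assms(1) show "v \<in> V"
    by (auto simp: cycle_edge_def simple_graph_def)
qed

lemma sum_indicator_distinct:
  assumes "distinct c"
  shows "(\<Sum>i<length c. if v = c ! i then 1 else 0) = (if v \<in> set c then 1 else (0::int))"
proof -
  have "(\<Sum>i<length c. if v = c ! i then 1 else 0) = (\<Sum>x\<in>set c. if v = x then 1 else (0::int))"
    by (rule sum.reindex_bij_betw[OF bij_betw_nth[OF assms refl refl]])
  then show ?thesis by (simp add: sum.delta')
qed

lemma sum_cyclic_shift:
  assumes "0 < L"
  shows "(\<Sum>i<L. g (Suc i mod L)) = (\<Sum>i<L. g i :: int)"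
proof -
  obtain M where L: "L = Suc M" using assms by (cases L) auto
  have "(\<Sum>i<Suc M. g (Suc i mod Suc M)) = (\<Sum>i<M. g (Suc i)) + g 0"
    unfolding sum.lessThan_Suc by (intro arg_cong2[where f = "(+)"] sum.cong) auto
  also have "\<dots> = (\<Sum>i<Suc M. g i)" unfolding sum.lessThan_Suc_shift by simp
  finally show ?thesis by (simp add: L)
qed

lemma boundary_cycle_function:
  assumes "finite E" "is_cycle E c"
  shows "boundary E (cycle_function c) v = (if v \<in> set c then 2 else 0)"
proof -
  let ?L = "length c"
  have L: "0 < ?L" "distinct c" using assms by (auto simp: is_cycle_def)
  have "boundary E (cycle_function c) v = (\<Sum>i<?L. boundary E (edge_indicator (cycle_edge c i)) v)"
    unfolding cycle_function_def by (rule boundary_sum)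
  also have "\<dots> = (\<Sum>i<?L. (if v = c ! i then 1 else 0) + (if v = c ! (Suc i mod ?L) then 1 else 0))"
  proof (intro sum.cong refl)
    fix i assume "i \<in> {..<?L}"
    then show "boundary E (edge_indicator (cycle_edge c i)) v
        = (if v = c ! i then 1 else 0) + (if v = c ! (Suc i mod ?L) then 1 else 0)"
      using cycle_edge_facts[OF assms(2), of i] boundary_edge_indicator[OF assms(1)]
      by (simp add: cycle_edge_def)
  qed
  also have "\<dots> = 2 * (\<Sum>i<?L. if v = c ! i then 1 else 0)"
    unfolding sum.distrib using sum_cyclic_shift[OF L(1), of "\<lambda>i. if v = c ! i then 1 else 0"] by simp
  finally show ?thesis unfolding sum_indicator_distinct[OF L(2)] by simp
qed

lemma sum_pairs: "(\<Sum>t<T. g (2 * t) + g (Suc (2 * t))) = (\<Sum>i<2 * T. g i :: int)"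
  by (induction T) simp_all

lemma boundary_matching_function:
  assumes "finite E" "odd_cycle E c"
  shows "boundary E (matching_function c) v
    = (if v \<in> set c then 1 else 0) - (if v = c ! 0 then 1 else 0)"
proof -
  let ?L = "length c"
  have c: "is_cycle E c" "distinct c" "odd ?L" using assms(2) by (auto simp: odd_cycle_def is_cycle_def)
  define T where "T = ?L div 2"
  have L: "?L = Suc (2 * T)" using c(3) by (simp add: T_def)
  have "boundary E (matching_function c) v = (\<Sum>t<T. boundary E (edge_indicator (cycle_edge c (Suc (2 * t)))) v)"
    unfolding matching_function_def T_def by (rule boundary_sum)
  also have "\<dots> = (\<Sum>t<T. (if v = c ! Suc (2 * t) then 1 else 0) + (if v = c ! Suc (Suc (2 * t)) then 1 else 0))"
  proof (intro sum.cong refl)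
    fix t assume "t \<in> {..<T}"
    then have "Suc (2 * t) < ?L" "Suc (Suc (2 * t)) mod ?L = Suc (Suc (2 * t))" by (auto simp: L)
    then show "boundary E (edge_indicator (cycle_edge c (Suc (2 * t)))) v
        = (if v = c ! Suc (2 * t) then 1 else 0) + (if v = c ! Suc (Suc (2 * t)) then 1 else 0)"
      using cycle_edge_facts[OF c(1), of "Suc (2 * t)"] boundary_edge_indicator[OF assms(1)]
      by (simp add: cycle_edge_def)
  qed
  also have "\<dots> = (\<Sum>i<2 * T. if v = c ! Suc i then 1 else 0)"
    by (rule sum_pairs[of "\<lambda>i. if v = c ! Suc i then 1 else 0"])
  also have "\<dots> = (\<Sum>i<?L. if v = c ! i then 1 else 0) - (if v = c ! 0 then 1 else 0)"
    unfolding L sum.lessThan_Suc_shift by simp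
  finally show ?thesis unfolding sum_indicator_distinct[OF c(2)] .
qed

text \<open>Along a path from \<open>a\<close> to \<open>b\<close> the alternating sum of the edges has boundary \<open>\<plusminus>1\<close> at \<open>b\<close>; the sign depends
on the parity of the length.\<close>

lemma connected_boundary:
  assumes "finite E" "\<forall>e\<in>E. card e = 2" and path: "(a, b) \<in> {(x, y). {x, y} \<in> E}\<^sup>*"
  shows "\<exists>f s. (s = 1 \<or> s = -1) \<and>
    (\<forall>v. boundary E f v = (if v = a then 1 else 0) + s * (if v = b then 1 else 0))"
  using path
proof (induction rule: rtrancl_induct)
  case base
  show ?case by (rule exI[of _ "\<lambda>_. 0"], rule exI[of _ "-1"]) (simp add: boundary_def)
next
  case (step y z)
  then obtain f s where f: "s = 1 \<or> s = -1"
    "\<And>v. boundary E f v = (if v = a then 1 else 0) + s * (if v = y then 1 else 0)" by blast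
  have yz: "{y, z} \<in> E" using step by simp
  then have "y \<noteq> z" using assms(2) by fastforce
  note b = boundary_edge_indicator[OF assms(1) yz this]
  have "boundary E (\<lambda>e. f e - s * edge_indicator {y, z} e) v
      = (if v = a then 1 else 0) + - s * (if v = z then 1 else 0)" for v
    unfolding boundary_diff boundary_mult b f(2) by (simp add: algebra_simps)
  moreover have "- s = 1 \<or> - s = -1" using f(1) by auto
  ultimately show ?case by blast
qed

text \<open>The matchings reduce the claim to the difference of the two first vertices. A path between them gives the
difference or the sum; in the latter case, twice the first vertex of \<open>c'\<close> is corrected by all edges of
\<open>c'\<close> minus twice its matching.\<close>

lemma odd_cycles_half:
  assumes G: "simple_graph V E" "connected_graph V E"
    and c: "odd_cycle E c" and c': "odd_cycle E c'"
  shows "\<exists>f. \<forall>v. boundary E f v = (if v \<in> set c then 1 else 0) - (if v \<in> set c' then 1 else 0) \<and>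
    boundary E (\<lambda>e. cycle_function c e - cycle_function c' e) v = 2 * boundary E f v"
proof -
  have finE: "finite E"
    using G(1) by (intro finite_subset[of E "Pow V"]) (auto simp: simple_graph_def)
  have card2: "\<forall>e\<in>E. card e = 2" using G(1) by (simp add: simple_graph_def)
  have cyc: "is_cycle E c" "is_cycle E c'" using c c' by (simp_all add: odd_cycle_def)
  have "0 < length c" "0 < length c'" using cyc by (auto simp: is_cycle_def)
  then have "c ! 0 \<in> set c" "c' ! 0 \<in> set c'" by simp_all
  then have "(c ! 0, c' ! 0) \<in> {(x, y). {x, y} \<in> E}\<^sup>*"
    using G(2) cyc[THEN cycle_vertices_subset[OF G(1)]] unfolding connected_graph_def by blast
  from connected_boundary[OF finE card2 this] obtain g s where g: "s = 1 \<or> s = -1"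
    "\<And>v. boundary E g v = (if v = c ! 0 then 1 else 0) + s * (if v = c' ! 0 then 1 else 0)"
    by blast
  note bm = boundary_matching_function[OF finE c] boundary_matching_function[OF finE c']
  note bc = cyc[THEN boundary_cycle_function[OF finE]]
  let ?f0 = "\<lambda>e. matching_function c e - matching_function c' e + g e"
  let ?double = "\<lambda>e. cycle_function c' e - 2 * matching_function c' e"
  have "\<exists>f. \<forall>v. boundary E f v = (if v \<in> set c then 1 else 0) - (if v \<in> set c' then 1 else 0)"
  proof (cases "s = 1")
    case True
    then show ?thesis
      by (intro exI[of _ "\<lambda>e. ?f0 e - ?double e"])
        (auto simp: boundary_add boundary_diff boundary_mult bm bc g(2))
  next
    case False
    then show ?thesis
      using g(1) by (intro exI[of _ ?f0]) (auto simp: boundary_add boundary_diff bm g(2))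
  qed
  then obtain f where "\<forall>v. boundary E f v = (if v \<in> set c then 1 else 0) - (if v \<in> set c' then 1 else 0)"
    by blast
  then show ?thesis unfolding boundary_diff bc by (intro exI[of _ f]) simp
qed

section \<open>Column bases and unimodularity\<close>

text \<open>The columns are given by a list, so that a single column can be exchanged without reordering the others.\<close>

definition select_cols :: "'a mat \<Rightarrow> nat list \<Rightarrow> 'a mat" where
  "select_cols A js = mat (dim_row A) (length js) (\<lambda>(i, t). A $$ (i, js ! t))"

lemma select_cols_dims [simp]:
  "dim_row (select_cols A js) = dim_row A" "dim_col (select_cols A js) = length js"
  by (simp_all add: select_cols_def)

lemma select_cols_carrier [simp]:
  "length js = dim_row A \<Longrightarrow> select_cols A js \<in> carrier_mat (dim_row A) (dim_row A)"
  by (rule carrier_matI) simp_all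

lemma select_cols_index [simp]:
  "i < dim_row A \<Longrightarrow> t < length js \<Longrightarrow> select_cols A js $$ (i, t) = A $$ (i, js ! t)"
  by (simp add: select_cols_def)

lemma select_cols_mult_index:
  assumes "i < dim_row A" "v \<in> carrier_vec (length js)"
  shows "(select_cols A js *\<^sub>v v) $ i = (\<Sum>t<length js. A $$ (i, js ! t) * v $ t)"
  using assms by (simp add: scalar_prod_def lessThan_atLeast0)

lemma select_cols_unit:
  fixes A :: "'a::comm_ring_1 mat"
  assumes "length js = dim_row A" "s < length js"
  shows "select_cols A js *\<^sub>v unit_vec (dim_row A) s = col (select_cols A js) s"
  by (rule eq_vecI) (use assms in \<open>auto simp: scalar_prod_right_unit\<close>)

lemma select_cols_distinct:
  fixes A :: "'a::idom mat"
  assumes "length js = dim_row A" "det (select_cols A js) \<noteq> 0"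
  shows "distinct js"
proof (rule ccontr)
  assume "\<not> distinct js"
  then obtain s t where st: "s < length js" "t < length js" "s \<noteq> t" "js ! s = js ! t"
    by (auto simp: distinct_conv_nth)
  have "det (select_cols A js) = 0"
    by (rule det_identical_cols[of _ "dim_row A" s t]) (use st assms(1) in \<open>auto simp: col_def\<close>)
  with assms(2) show False by simp
qed

lemma submatrix_eq_select_cols:
  assumes J: "J \<subseteq> {..<dim_col A}" "card J = dim_row A"
  shows "\<exists>js. length js = dim_row A \<and> distinct js \<and> set js = J \<and>
    submatrix A {..<dim_row A} J = select_cols A js"
proof -
  let ?r = "dim_row A"
  define js where "js = map (pick J) [0..<?r]"
  have finJ: "finite J" using J(1) finite_subset by blast
  have inJ: "pick J t \<in> J" if "t < ?r" for t using that J(2) by (intro pick_in_set) auto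
  have dist: "distinct js"
  proof -
    have "strict_mono_on {..<?r} (pick J)"
      using pick_mono[of _ J] J(2) by (auto simp: strict_mono_on_def)
    then show ?thesis
      unfolding js_def distinct_map by (auto dest: strict_mono_on_imp_inj_on simp: lessThan_atLeast0)
  qed
  have "set js \<subseteq> J" using inJ by (auto simp: js_def)
  moreover have "card (set js) = card J" unfolding distinct_card[OF dist] by (simp add: js_def J(2))
  ultimately have "set js = J" using finJ by (simp add: card_subset_eq)
  have Jeq: "{j. j < dim_col A \<and> j \<in> J} = J" using J(1) by auto
  have pr: "pick {..<?r} i = i" if "i < ?r" for i
  proof -
    have "{a \<in> {..<?r}. a < i} = {..<i}" using that by auto
    then show ?thesis using pick_card_in_set[of i "{..<?r}"] that by simp
  qed
  have "submatrix A {..<?r} J = select_cols A js"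
    by (rule eq_matI) (auto simp: submatrix_def Jeq J(2) js_def pr)
  then show ?thesis using dist \<open>set js = J\<close> by (intro exI[of _ js]) (simp add: js_def)
qed

text \<open>The coefficients form an integer matrix \<open>M\<close> with \<open>B' = B * M\<close>.\<close>

lemma det_dvd_if_cols_in_span:
  fixes B B' :: "int mat"
  assumes B: "B \<in> carrier_mat r r" "B' \<in> carrier_mat r r"
    and span: "\<And>t. t < r \<Longrightarrow> \<exists>v\<in>carrier_vec r. col B' t = B *\<^sub>v v"
  shows "det B dvd det B'"
proof -
  obtain v where v: "\<And>t. t < r \<Longrightarrow> v t \<in> carrier_vec r" "\<And>t. t < r \<Longrightarrow> col B' t = B *\<^sub>v v t"
    using span by metis
  define M where "M = mat_of_cols r (map v [0..<r])"
  have M: "M \<in> carrier_mat r r" by (rule carrier_matI) (simp_all add: M_def)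
  have "B' = B * M"
  proof (rule eq_matI)
    fix i t assume it: "i < dim_row (B * M)" "t < dim_col (B * M)"
    then have t: "t < r" "i < r" using M B by auto
    have "col M t = v t" using t v(1) by (simp add: M_def)
    then have "col B' t = col (B * M) t" using v(2)[OF t(1)] by (simp only: col_mult2[OF B(1) M t(1)])
    then show "B' $$ (i, t) = (B * M) $$ (i, t)"
      using it t B M by (metis carrier_matD index_col mult_carrier_mat)
  qed (use B M in auto)
  then show ?thesis using det_mult[OF B(1) M] by simp
qed

lemma abs_det_select_cols_eq:
  fixes A :: "int mat"
  assumes "length js = dim_row A" "length js' = dim_row A" "set js = set js'"
  shows "\<bar>det (select_cols A js)\<bar> = \<bar>det (select_cols A js')\<bar>"
proof -
  have "det (select_cols A xs) dvd det (select_cols A ys)"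
    if l: "length xs = dim_row A" "length ys = dim_row A" and "set ys \<subseteq> set xs" for xs ys
  proof (rule det_dvd_if_cols_in_span[of _ "dim_row A"])
    fix t assume t: "t < dim_row A"
    then have "ys ! t \<in> set xs" using that by auto
    then obtain s where s: "s < length xs" "xs ! s = ys ! t" by (metis in_set_conv_nth)
    have "col (select_cols A ys) t = select_cols A xs *\<^sub>v unit_vec (dim_row A) s"
      using select_cols_unit[of xs A s] s l t by (intro eq_vecI) auto
    then show "\<exists>v\<in>carrier_vec (dim_row A). col (select_cols A ys) t = select_cols A xs *\<^sub>v v" by auto
  qed (use l in auto)
  from this[of js js'] this[of js' js] show ?thesis using assms by (auto intro: zdvd_antisym_abs)
qed

lemma adj_mult_vec:
  fixes B :: "'a::comm_ring_1 mat"
  assumes B: "B \<in> carrier_mat r r" and a: "a \<in> carrier_vec r"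
  shows "B *\<^sub>v (adj_mat B *\<^sub>v a) = det B \<cdot>\<^sub>v a"
proof -
  have "B *\<^sub>v (adj_mat B *\<^sub>v a) = (B * adj_mat B) *\<^sub>v a"
    using B adj_mat(1)[OF B] a by simp
  also have "\<dots> = (det B \<cdot>\<^sub>m 1\<^sub>m r) *\<^sub>v a" by (simp add: adj_mat(2)[OF B])
  also have "\<dots> = det B \<cdot>\<^sub>v a"
  proof (rule eq_vecI)
    fix i assume "i < dim_vec (det B \<cdot>\<^sub>v a)"
    then have i: "i < r" using a by simp
    have "((det B \<cdot>\<^sub>m 1\<^sub>m r) *\<^sub>v a) $ i = (\<Sum>j = 0..<r. det B * (if j = i then 1 else 0) * a $ j)"
      using i a by (simp add: scalar_prod_def)
    also have "\<dots> = (\<Sum>j = 0..<r. if j = i then det B * a $ j else 0)"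
      by (intro sum.cong) auto
    finally show "((det B \<cdot>\<^sub>m 1\<^sub>m r) *\<^sub>v a) $ i = (det B \<cdot>\<^sub>v a) $ i" using i a by simp
  qed (use a in simp)
  finally show ?thesis .
qed

lemma det_nonzero_injective:
  fixes B :: "'a::idom mat"
  assumes "B \<in> carrier_mat r r" "det B \<noteq> 0" "v \<in> carrier_vec r" "B *\<^sub>v v = 0\<^sub>v r"
  shows "v = 0\<^sub>v r"
  using det_0_iff_vec_prod_zero[OF assms(1)] assms(2-4) by blast

lemma sum_supported:
  fixes n :: nat
  assumes "distinct js" "set js \<subseteq> {..<n}" "k < n" "k \<notin> set js"
    and "\<And>j. j < n \<Longrightarrow> j \<noteq> k \<Longrightarrow> j \<notin> set js \<Longrightarrow> f j = 0"
  shows "(\<Sum>j<n. f j) = f k + (\<Sum>t<length js. f (js ! t) :: 'a::comm_monoid_add)"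
proof -
  have "(\<Sum>j<n. f j) = (\<Sum>j\<in>insert k (set js). f j)"
    using assms by (intro sum.mono_neutral_right) auto
  also have "\<dots> = f k + (\<Sum>j\<in>set js. f j)" using assms by simp
  also have "(\<Sum>j\<in>set js. f j) = (\<Sum>t<length js. f (js ! t))"
    by (rule sum.reindex_bij_betw[OF bij_betw_nth[OF assms(1) refl refl], symmetric])
  finally show ?thesis .
qed

text \<open>The adjugate expresses a multiple of column \<open>k\<close> by the basis, which gives a kernel vector supported on \<open>k\<close>
and the basis. The \<open>0, \<plusminus>1\<close> vector below it is nonzero at \<open>k\<close>, since the basis is independent; its other
entries are, up to a common sign, the coefficients of column \<open>k\<close>.\<close>

lemma unit_conformal_integer_span:
  assumes U: "unit_conformal A" and js: "length js = dim_row A" "set js \<subseteq> {..<dim_col A}"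
    and det: "det (select_cols A js) \<noteq> 0" and k: "k < dim_col A"
  shows "\<exists>v\<in>carrier_vec (dim_row A). col A k = select_cols A js *\<^sub>v v"
proof (cases "k \<in> set js")
  case True
  then obtain s where s: "s < length js" "js ! s = k" by (metis in_set_conv_nth)
  have "col A k = select_cols A js *\<^sub>v unit_vec (dim_row A) s"
    using select_cols_unit[of js A s] s js k by (intro eq_vecI) auto
  then show ?thesis by auto
next
  case False
  let ?r = "dim_row A" and ?n = "dim_col A" and ?B = "select_cols A js"
  have B: "?B \<in> carrier_mat ?r ?r" using js by simp
  have dist: "distinct js" by (rule select_cols_distinct[OF js(1) det])
  define y where "y = adj_mat ?B *\<^sub>v col A k"
  have y: "y \<in> carrier_vec ?r" unfolding y_def using adj_mat(1)[OF B] by auto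
  have By: "?B *\<^sub>v y = det ?B \<cdot>\<^sub>v col A k" unfolding y_def by (rule adj_mult_vec[OF B]) simp
  define w where "w j = (if j = k then - det ?B else if j \<in> set js then y $ (THE t. t < length js \<and> js ! t = j) else 0)" for j
  have wjs: "w (js ! t) = y $ t" if "t < length js" for t
  proof -
    have "(THE s. s < length js \<and> js ! s = js ! t) = t"
      by (rule the_equality) (use that dist in \<open>auto simp: nth_eq_iff_index_eq\<close>)
    moreover have "js ! t \<noteq> k" using False that by auto
    ultimately show ?thesis using that by (simp add: w_def)
  qed
  have sum: "(\<Sum>j<?n. A $$ (i, j) * z j) = A $$ (i, k) * z k + (\<Sum>t<length js. A $$ (i, js ! t) * z (js ! t))"
    if "\<And>j. j \<noteq> k \<Longrightarrow> j \<notin> set js \<Longrightarrow> z j = 0" for z i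
    using sum_supported[OF dist js(2) k False, of "\<lambda>j. A $$ (i, j) * z j"] that by simp
  have "kernel_vector A w"
    unfolding kernel_vector_def
  proof (intro allI impI)
    fix i assume i: "i < ?r"
    have "(\<Sum>t<length js. A $$ (i, js ! t) * w (js ! t)) = (?B *\<^sub>v y) $ i"
      using i y js by (subst select_cols_mult_index) (auto simp: wjs)
    also have "\<dots> = det ?B * A $$ (i, k)" unfolding By using i k by simp
    finally show "(\<Sum>j<?n. A $$ (i, j) * w j) = 0"
      by (subst sum) (auto simp: w_def)
  qed
  moreover have "w k \<noteq> 0" using det by (simp add: w_def)
  ultimately obtain z where z: "kernel_vector A z" "\<exists>j<?n. z j \<noteq> 0" "\<And>j. z j = 0 \<or> z j = sgn (w j)"
    using U k unfolding unit_conformal_def by blast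
  have zsupp: "z j = 0" if "j \<noteq> k" "j \<notin> set js" for j using z(3)[of j] that by (auto simp: w_def)
  have zker: "A $$ (i, k) * z k + (\<Sum>t<length js. A $$ (i, js ! t) * z (js ! t)) = 0" if "i < ?r" for i
    using z(1) sum[of z i, OF zsupp] that by (simp add: kernel_vector_def)
  have "z k \<noteq> 0"
  proof
    assume zk: "z k = 0"
    let ?v = "vec ?r (\<lambda>t. z (js ! t))"
    have "?B *\<^sub>v ?v = 0\<^sub>v ?r"
    proof (rule eq_vecI)
      fix i assume "i < dim_vec (0\<^sub>v ?r :: int vec)"
      then have i: "i < ?r" by simp
      have "(?B *\<^sub>v ?v) $ i = (\<Sum>t<length js. A $$ (i, js ! t) * z (js ! t))"
        using i js by (subst select_cols_mult_index) auto
      with zker[OF i] zk i show "(?B *\<^sub>v ?v) $ i = 0\<^sub>v ?r $ i" by simp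
    qed simp
    from det_nonzero_injective[OF B det vec_carrier this] have "?v = 0\<^sub>v ?r" .
    then have "z (js ! t) = 0" if "t < length js" for t
      using that js by (metis index_vec index_zero_vec(1))
    then have "z j = 0" for j using zsupp zk by (metis in_set_conv_nth)
    with z(2) show False by blast
  qed
  with z(3)[of k] have zk: "z k * z k = 1" by (auto simp: sgn_if split: if_splits)
  let ?v = "vec ?r (\<lambda>t. - z k * z (js ! t))"
  have "col A k = ?B *\<^sub>v ?v"
  proof (rule eq_vecI)
    fix i assume "i < dim_vec (?B *\<^sub>v ?v)"
    then have i: "i < ?r" by simp
    have "(?B *\<^sub>v ?v) $ i = (\<Sum>t<length js. A $$ (i, js ! t) * (- z k * z (js ! t)))"
      using i js by (subst select_cols_mult_index) auto
    also have "\<dots> = - z k * (\<Sum>t<length js. A $$ (i, js ! t) * z (js ! t))"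
      by (simp add: sum_distrib_left ac_simps)
    also have "(\<Sum>t<length js. A $$ (i, js ! t) * z (js ! t)) = - (A $$ (i, k) * z k)"
      using zker[OF i] by linarith
    also have "- z k * - (A $$ (i, k) * z k) = A $$ (i, k) * (z k * z k)" by simp
    also have "\<dots> = A $$ (i, k)" using zk by simp
    finally show "col A k $ i = (?B *\<^sub>v ?v) $ i" using i k by simp
  qed simp
  then show ?thesis by auto
qed

theorem unit_conformal_imp_unimodular:
  assumes U: "unit_conformal A" and rank: "mat_rank A = dim_row A"
  shows "unimodular A"
  unfolding unimodular_def
proof (intro conjI rank allI impI)
  fix J J'
  assume *: "J \<subseteq> {..<dim_col A} \<and> card J = dim_row A \<and> J' \<subseteq> {..<dim_col A} \<and> card J' = dim_row A \<and>
    det (submatrix A {..<dim_row A} J) \<noteq> 0 \<and> det (submatrix A {..<dim_row A} J') \<noteq> 0"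
  obtain js where js: "length js = dim_row A" "set js = J" "submatrix A {..<dim_row A} J = select_cols A js"
    using submatrix_eq_select_cols[of J A] * by blast
  obtain js' where js': "length js' = dim_row A" "set js' = J'" "submatrix A {..<dim_row A} J' = select_cols A js'"
    using submatrix_eq_select_cols[of J' A] * by blast
  have "det (select_cols A xs) dvd det (select_cols A ys)"
    if "length xs = dim_row A" "length ys = dim_row A" "set xs \<subseteq> {..<dim_col A}" "set ys \<subseteq> {..<dim_col A}"
      "det (select_cols A xs) \<noteq> 0" for xs ys
  proof (rule det_dvd_if_cols_in_span[of _ "dim_row A"])
    fix t assume t: "t < dim_row A"
    have "ys ! t < dim_col A" using that t by (metis lessThan_iff nth_mem subsetD)
    moreover have "col (select_cols A ys) t = col A (ys ! t)"
      using t that calculation by (intro eq_vecI) auto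
    ultimately show "\<exists>v\<in>carrier_vec (dim_row A). col (select_cols A ys) t = select_cols A xs *\<^sub>v v"
      using unit_conformal_integer_span[OF U, of xs "ys ! t"] that by simp
  qed (use that in auto)
  from this[of js js'] this[of js' js]
  show "\<bar>det (submatrix A {..<dim_row A} J)\<bar> = \<bar>det (submatrix A {..<dim_row A} J')\<bar>"
    using * js js' by (auto intro: zdvd_antisym_abs)
qed

section \<open>Integer expansions in a basis of a unimodular matrix\<close>

lemma unimodular_det_cases:
  assumes U: "unimodular A" and js: "length js = dim_row A" "set js \<subseteq> {..<dim_col A}"
    and js': "length js' = dim_row A" "set js' \<subseteq> {..<dim_col A}"
    and det: "det (select_cols A js) \<noteq> 0"
  shows "det (select_cols A js') = 0 \<or> \<bar>det (select_cols A js')\<bar> = \<bar>det (select_cols A js)\<bar>"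
proof (cases "det (select_cols A js') = 0")
  case False
  have sub: "\<bar>det (submatrix A {..<dim_row A} (set xs))\<bar> = \<bar>det (select_cols A xs)\<bar>"
    "card (set xs) = dim_row A"
    if xs: "length xs = dim_row A" "set xs \<subseteq> {..<dim_col A}" "det (select_cols A xs) \<noteq> 0" for xs
  proof -
    show c: "card (set xs) = dim_row A" using select_cols_distinct[of xs A] that by (simp add: distinct_card)
    obtain ys where "length ys = dim_row A" "set ys = set xs"
      "submatrix A {..<dim_row A} (set xs) = select_cols A ys"
      using submatrix_eq_select_cols[OF xs(2) c] by blast
    then show "\<bar>det (submatrix A {..<dim_row A} (set xs))\<bar> = \<bar>det (select_cols A xs)\<bar>"
      using abs_det_select_cols_eq[of ys A xs] that by simp
  qed
  have "det (submatrix A {..<dim_row A} (set js)) \<noteq> 0" "det (submatrix A {..<dim_row A} (set js')) \<noteq> 0"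
    using sub(1)[OF js det] sub(1)[OF js' False] det False by auto
  then show ?thesis
    using U sub[OF js det] sub[OF js' False] js js' unfolding unimodular_def by metis
qed simp

text \<open>The coefficients are the quotients of minors in Cramer's rule. As all nonzero maximal minors have the
same absolute value, these quotients are integers.\<close>

lemma unimodular_expansion:
  assumes U: "unimodular A" and js: "length js = dim_row A" "set js \<subseteq> {..<dim_col A}"
    and det: "det (select_cols A js) \<noteq> 0" and k: "k < dim_col A"
  shows "\<exists>v\<in>carrier_vec (dim_row A). col A k = select_cols A js *\<^sub>v v \<and>
    (\<forall>t<dim_row A. det (select_cols A (js[t := k])) = v $ t * det (select_cols A js))"
proof -
  let ?r = "dim_row A" and ?B = "select_cols A js"
  have B: "?B \<in> carrier_mat ?r ?r" using js by simp
  (* the entries of y are the numerators in Cramer's rule *)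
  define y where "y = adj_mat ?B *\<^sub>v col A k"
  have y: "y \<in> carrier_vec ?r" unfolding y_def using adj_mat(1)[OF B] by auto
  have By: "?B *\<^sub>v y = det ?B \<cdot>\<^sub>v col A k" unfolding y_def by (rule adj_mult_vec[OF B]) simp
  have rep: "replace_col ?B (col A k) t = select_cols A (js[t := k])" if "t < ?r" for t
    using that js k by (intro eq_matI) (auto simp: replace_col_def nth_list_update)
  have ydet: "det (select_cols A (js[t := k])) = y $ t" if t: "t < ?r" for t
  proof -
    have c: "cofactor (replace_col ?B b t) i t = cofactor ?B i t" if "i < ?r" for i b
    proof -
      have "mat_delete (replace_col ?B b t) i t = mat_delete ?B i t"
        using t js that by (intro eq_matI) (auto simp: mat_delete_def replace_col_def)
      then show ?thesis by (simp add: cofactor_def)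
    qed
    have "det (replace_col ?B (col A k) t) = (\<Sum>i<?r. replace_col ?B (col A k) t $$ (i, t) * cofactor (replace_col ?B (col A k) t) i t)"
      using t B by (intro laplace_expansion_column) (auto simp: replace_col_def)
    also have "replace_col ?B (col A k) t $$ (i, t) = A $$ (i, k)" if "i < ?r" for i
      using t k js that by (simp add: replace_col_def)
    then have "(\<Sum>i<?r. replace_col ?B (col A k) t $$ (i, t) * cofactor (replace_col ?B (col A k) t) i t)
        = (\<Sum>i<?r. cofactor ?B i t * A $$ (i, k))"
      by (intro sum.cong refl) (simp add: c mult.commute)
    also have "\<dots> = y $ t"
      unfolding y_def using t k js by (simp add: adj_mat_def scalar_prod_def lessThan_atLeast0)
    finally show ?thesis by (simp add: rep[OF t])
  qed
  have dv: "det ?B dvd y $ t" if t: "t < ?r" for t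
  proof -
    have "set (js[t := k]) \<subseteq> {..<dim_col A}" using js k set_update_subset_insert[of js t k] by auto
    with unimodular_det_cases[OF U js, of "js[t := k]"] js det ydet[OF t]
    have "y $ t = 0 \<or> \<bar>y $ t\<bar> = \<bar>det ?B\<bar>" by auto
    then show ?thesis by (auto simp: abs_eq_iff)
  qed
  define v where "v = vec ?r (\<lambda>t. y $ t div det ?B)"
  have yv: "y = det ?B \<cdot>\<^sub>v v" using dv y by (intro eq_vecI) (auto simp: v_def)
  have vc: "v \<in> carrier_vec ?r" by (simp add: v_def)
  have "(?B *\<^sub>v v) $ i = col A k $ i" if i: "i < ?r" for i
  proof -
    have "det ?B * (?B *\<^sub>v v) $ i = (?B *\<^sub>v y) $ i"
      using i js vc unfolding yv
      by (subst (1 2) select_cols_mult_index) (auto simp: sum_distrib_left ac_simps)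
    also have "\<dots> = det ?B * col A k $ i" unfolding By using i by simp
    finally show ?thesis using det by simp
  qed
  then have "col A k = ?B *\<^sub>v v" by (intro eq_vecI) auto
  moreover have "det (select_cols A (js[t := k])) = v $ t * det ?B" if "t < ?r" for t
    using ydet[OF that] yv vc that by simp
  ultimately show ?thesis using vc by blast
qed

text \<open>Take a basis with as many columns from \<open>S\<close> as possible. If column \<open>k \<in> S\<close> is missing, its expansion uses
only basis columns in \<open>S\<close>, because any other one could be exchanged for \<open>k\<close>. This is a linear
relation between columns of \<open>S\<close>.\<close>

lemma unimodular_basis_extension:
  assumes U: "unimodular A"
    and ex: "\<exists>js. length js = dim_row A \<and> set js \<subseteq> {..<dim_col A} \<and> det (select_cols A js) \<noteq> 0"
    and S: "S \<subseteq> {..<dim_col A}"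
    and indep: "\<And>w. kernel_vector A w \<Longrightarrow> (\<And>j. j \<notin> S \<Longrightarrow> w j = 0) \<Longrightarrow> \<forall>j<dim_col A. w j = 0"
  shows "\<exists>js. length js = dim_row A \<and> set js \<subseteq> {..<dim_col A} \<and> det (select_cols A js) \<noteq> 0 \<and> S \<subseteq> set js"
proof -
  let ?P = "\<lambda>js. length js = dim_row A \<and> set js \<subseteq> {..<dim_col A} \<and> det (select_cols A js) \<noteq> 0"
  have finS: "finite S" using S finite_subset by blast
  obtain js where js: "?P js" and max: "\<And>js'. ?P js' \<Longrightarrow> card (set js' \<inter> S) \<le> card (set js \<inter> S)"
    using ex_has_greatest_nat[of ?P _ "\<lambda>js. card (set js \<inter> S)" "Suc (card S)"] ex finS
    by (metis card_mono inf_le2 le_imp_less_Suc)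
  have dist: "distinct js" using select_cols_distinct js by blast
  have "S \<subseteq> set js"
  proof
    fix k assume "k \<in> S"
    show "k \<in> set js"
    proof (rule ccontr)
      assume kn: "k \<notin> set js"
      have k: "k < dim_col A" using S \<open>k \<in> S\<close> by auto
      obtain v where v: "v \<in> carrier_vec (dim_row A)" "col A k = select_cols A js *\<^sub>v v"
        "\<And>t. t < dim_row A \<Longrightarrow> det (select_cols A (js[t := k])) = v $ t * det (select_cols A js)"
        using unimodular_expansion[OF U _ _ _ k, of js] js by blast
      have vS: "v $ t = 0" if t: "t < dim_row A" "js ! t \<notin> S" for t
      proof (rule ccontr)
        assume "v $ t \<noteq> 0"
        let ?js' = "js[t := k]"
        have "set ?js' \<subseteq> {..<dim_col A}" using js k set_update_subset_insert[of js t k] by auto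
        then have "?P ?js'" using js v(3)[OF t(1)] \<open>v $ t \<noteq> 0\<close> by simp
        from max[OF this] have "card (set ?js' \<inter> S) \<le> card (set js \<inter> S)" .
        moreover have "insert k (set js \<inter> S) \<subseteq> set ?js' \<inter> S"
        proof -
          have "x \<in> set ?js'" if x: "x \<in> set js" "x \<in> S" for x
          proof -
            obtain s where s: "s < length js" "js ! s = x" using x by (metis in_set_conv_nth)
            then have "s \<noteq> t" using t x by auto
            then have "?js' ! s = x" using s by simp
            then show ?thesis using s by (metis length_list_update nth_mem)
          qed
          moreover have "k \<in> set ?js'" using t js by (metis set_update_memI)
          ultimately show ?thesis using \<open>k \<in> S\<close> by auto
        qed
        then have "card (insert k (set js \<inter> S)) \<le> card (set ?js' \<inter> S)" by (intro card_mono) auto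
        ultimately show False using kn by simp
      qed
      define w where "w j = (if j = k then -1 else if j \<in> set js then v $ (THE t. t < length js \<and> js ! t = j) else 0)" for j
      have wjs: "w (js ! t) = v $ t" if "t < length js" for t
      proof -
        have "(THE s. s < length js \<and> js ! s = js ! t) = t"
          by (rule the_equality) (use that dist in \<open>auto simp: nth_eq_iff_index_eq\<close>)
        moreover have "js ! t \<noteq> k" using kn that by auto
        ultimately show ?thesis using that by (simp add: w_def)
      qed
      have "kernel_vector A w"
        unfolding kernel_vector_def
      proof (intro allI impI)
        fix i assume i: "i < dim_row A"
        have "(\<Sum>t<length js. A $$ (i, js ! t) * w (js ! t)) = (select_cols A js *\<^sub>v v) $ i"
          using i v(1) js by (subst select_cols_mult_index) (auto simp: wjs)
        also have "\<dots> = A $$ (i, k)" unfolding v(2)[symmetric] using i k by simp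
        finally show "(\<Sum>j<dim_col A. A $$ (i, j) * w j) = 0"
          using js k kn by (subst sum_supported[OF dist _ k kn]) (auto simp: w_def)
      qed
      moreover have "w j = 0" if "j \<notin> S" for j
      proof (cases "j \<in> set js")
        case True
        then obtain t where "t < length js" "js ! t = j" by (metis in_set_conv_nth)
        then show ?thesis using wjs vS that js by metis
      qed (use that \<open>k \<in> S\<close> in \<open>auto simp: w_def\<close>)
      ultimately have "w k = 0" using indep k by blast
      then show False by (simp add: w_def)
    qed
  qed
  with js show ?thesis by blast
qed

text \<open>In a basis containing the columns of \<open>S\<close>, the vector \<open>A f\<close> has integer coordinates \<open>u\<close>, while the
coordinates of \<open>2 A f\<close> are the values of \<open>f'\<close>; so \<open>f' = 2 u\<close> on \<open>S\<close>.\<close>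

lemma unimodular_even_coefficients:
  assumes U: "unimodular A"
    and ex: "\<exists>js. length js = dim_row A \<and> set js \<subseteq> {..<dim_col A} \<and> det (select_cols A js) \<noteq> 0"
    and S: "S \<subseteq> {..<dim_col A}"
    and indep: "\<And>w. kernel_vector A w \<Longrightarrow> (\<And>j. j \<notin> S \<Longrightarrow> w j = 0) \<Longrightarrow> \<forall>j<dim_col A. w j = 0"
    and f': "\<And>j. j \<notin> S \<Longrightarrow> f' j = 0"
    and double: "kernel_vector A (\<lambda>j. f' j - 2 * f j)"
  shows "j < dim_col A \<Longrightarrow> even (f' j)"
proof -
  let ?r = "dim_row A" and ?n = "dim_col A"
  obtain js where js: "length js = ?r" "set js \<subseteq> {..<?n}" "det (select_cols A js) \<noteq> 0" "S \<subseteq> set js"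
    using unimodular_basis_extension[OF U ex S indep] by blast
  let ?B = "select_cols A js"
  have dist: "distinct js" using select_cols_distinct[OF js(1,3)] .
  have B: "?B \<in> carrier_mat ?r ?r" using js by simp
  have "\<exists>v\<in>carrier_vec ?r. col A k = ?B *\<^sub>v v" if "k < ?n" for k
    using unimodular_expansion[OF U js(1-3) that] by blast
  then obtain v where v: "\<And>k. k < ?n \<Longrightarrow> v k \<in> carrier_vec ?r" "\<And>k. k < ?n \<Longrightarrow> col A k = ?B *\<^sub>v v k"
    by metis
  define u where "u t = (\<Sum>k<?n. v k $ t * f k)" for t
  have Af: "(\<Sum>k<?n. A $$ (i, k) * f k) = (\<Sum>t<?r. A $$ (i, js ! t) * u t)" if i: "i < ?r" for i
  proof -
    have "A $$ (i, k) = (\<Sum>t<?r. A $$ (i, js ! t) * v k $ t)" if "k < ?n" for k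
    proof -
      have "A $$ (i, k) = (?B *\<^sub>v v k) $ i" using v(2)[OF that, symmetric] i that by simp
      then show ?thesis using v(1)[OF that] i js by (subst (asm) select_cols_mult_index) auto
    qed
    then have "(\<Sum>k<?n. A $$ (i, k) * f k) = (\<Sum>k<?n. \<Sum>t<?r. A $$ (i, js ! t) * v k $ t * f k)"
      by (simp add: sum_distrib_right)
    also have "\<dots> = (\<Sum>t<?r. \<Sum>k<?n. A $$ (i, js ! t) * v k $ t * f k)" by (rule sum.swap)
    also have "\<dots> = (\<Sum>t<?r. A $$ (i, js ! t) * u t)"
      by (simp add: u_def sum_distrib_left mult.assoc)
    finally show ?thesis .
  qed
  have Af': "(\<Sum>k<?n. A $$ (i, k) * f' k) = (\<Sum>t<?r. A $$ (i, js ! t) * f' (js ! t))" for i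
  proof -
    have "(\<Sum>k<?n. A $$ (i, k) * f' k) = (\<Sum>k\<in>set js. A $$ (i, k) * f' k)"
      using js f' by (intro sum.mono_neutral_right) auto
    also have "\<dots> = (\<Sum>t<?r. A $$ (i, js ! t) * f' (js ! t))"
      using sum.reindex_bij_betw[OF bij_betw_nth[OF dist refl refl], of "\<lambda>k. A $$ (i, k) * f' k"] js(1) by simp
    finally show ?thesis .
  qed
  let ?v = "vec ?r (\<lambda>t. f' (js ! t) - 2 * u t)"
  have "?B *\<^sub>v ?v = 0\<^sub>v ?r"
  proof (rule eq_vecI)
    fix i assume "i < dim_vec (0\<^sub>v ?r :: int vec)"
    then have i: "i < ?r" by simp
    have "(?B *\<^sub>v ?v) $ i = (\<Sum>t<?r. A $$ (i, js ! t) * f' (js ! t)) - 2 * (\<Sum>t<?r. A $$ (i, js ! t) * u t)"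
      using i js by (subst select_cols_mult_index)
        (auto simp: right_diff_distrib sum_subtractf sum_distrib_left ac_simps)
    also have "\<dots> = (\<Sum>k<?n. A $$ (i, k) * (f' k - 2 * f k))"
      unfolding Af[OF i, symmetric] Af'[symmetric]
      by (simp add: right_diff_distrib sum_subtractf sum_distrib_left ac_simps)
    also have "\<dots> = 0" using double i by (simp add: kernel_vector_def)
    finally show "(?B *\<^sub>v ?v) $ i = 0\<^sub>v ?r $ i" using i by simp
  qed simp
  from det_nonzero_injective[OF B js(3) vec_carrier this] have v0: "?v = 0\<^sub>v ?r" .
  assume "j < ?n"
  show "even (f' j)"
  proof (cases "j \<in> S")
    case True
    then obtain t where t: "t < ?r" "js ! t = j" using js by (metis in_set_conv_nth subsetD)
    from arg_cong[OF v0, of "\<lambda>x. x $ t"] t have "f' j = 2 * u t" by simp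
    then show ?thesis by simp
  qed (use f' in simp)
qed

section \<open>Full row rank and left kernels\<close>

lemma mat_rank_column_basis:
  fixes A :: "int mat"
  defines "r \<equiv> dim_row A"
  shows "\<exists>S. maximal S (\<lambda>T. T \<subseteq> set (cols (map_mat rat_of_int A)) \<and>
      module.lin_indpt class_ring (module_vec TYPE(rat) r) T) \<and> card S = mat_rank A \<and> finite S"
proof -
  interpret V: vec_space "TYPE(rat)" r .
  let ?Q = "map_mat rat_of_int A"
  have Q: "?Q \<in> carrier_mat r (dim_col A)" by (simp add: r_def)
  have "V.lin_indpt {}" by (simp add: V.lin_dep_def)
  then obtain S where S: "finite S" "maximal S (\<lambda>T. T \<subseteq> set (cols ?Q) \<and> V.lin_indpt T)"
    using maximal_exists_superset[of "set (cols ?Q)" "\<lambda>T. T \<subseteq> set (cols ?Q) \<and> V.lin_indpt T" "{}"]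
    by auto
  then show ?thesis
    using V.rank_card_indpt[OF Q S(2)] unfolding mat_rank_def r_def[symmetric] by auto
qed

lemma mat_rank_le: "mat_rank A \<le> dim_row A"
proof -
  let ?r = "dim_row A"
  interpret V: vec_space "TYPE(rat)" ?r .
  obtain S where S: "maximal S (\<lambda>T. T \<subseteq> set (cols (map_mat rat_of_int A)) \<and> V.lin_indpt T)"
    "card S = mat_rank A"
    using mat_rank_column_basis[of A] by blast
  then have "V.lin_indpt S" "S \<subseteq> carrier_vec ?r"
    using cols_dim[of "map_mat rat_of_int A"] by (auto simp: maximal_def)
  then show ?thesis using V.li_le_dim(2)[OF V.fin_dim, of S] S(2) V.dim_is_n by simp
qed

lemma map_mat_select_cols:
  "set js \<subseteq> {..<dim_col A} \<Longrightarrow> select_cols (map_mat f A) js = map_mat f (select_cols A js)"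
  by (rule eq_matI) (auto simp: subset_eq)

lemma full_rank_imp_column_basis:
  assumes "mat_rank A = dim_row A"
  shows "\<exists>js. length js = dim_row A \<and> set js \<subseteq> {..<dim_col A} \<and> det (select_cols A js) \<noteq> 0"
proof -
  let ?r = "dim_row A" and ?Q = "map_mat rat_of_int A"
  interpret V: vec_space "TYPE(rat)" ?r .
  obtain S where S: "maximal S (\<lambda>T. T \<subseteq> set (cols ?Q) \<and> V.lin_indpt T)" "card S = ?r" "finite S"
    using mat_rank_column_basis[of A] assms by auto
  then have SQ: "S \<subseteq> set (cols ?Q)" and indpt: "V.lin_indpt S" by (auto simp: maximal_def)
  obtain ss where ss: "set ss = S" "distinct ss" using finite_distinct_list[OF S(3)] by blast
  have len: "length ss = ?r" using ss S(2) distinct_card by fastforce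
  have "\<exists>j. j < dim_col A \<and> col ?Q j = s" if "s \<in> S" for s
    using SQ that by (metis cols_length cols_nth in_set_conv_nth index_map_mat(3) subsetD)
  then obtain idx where idx: "\<And>s. s \<in> S \<Longrightarrow> idx s < dim_col A \<and> col ?Q (idx s) = s" by metis
  define js where "js = map idx ss"
  have js: "length js = ?r" "set js \<subseteq> {..<dim_col A}" using len ss idx by (auto simp: js_def)
  let ?M = "select_cols ?Q js"
  have M: "?M \<in> carrier_mat ?r ?r" using js select_cols_carrier[of js ?Q] by simp
  have "col ?M t = ss ! t" if "t < ?r" for t
  proof -
    have s: "ss ! t \<in> S" using that len ss(1) by auto
    have "col ?M t = col ?Q (idx (ss ! t))"
      using that len conjunct1[OF idx[OF s]] by (intro eq_vecI) (auto simp: js_def)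
    then show ?thesis using idx[OF s] by metis
  qed
  then have "cols ?M = ss" using len js by (intro nth_equalityI) auto
  then have "V.rank ?M = ?r"
    using ss indpt by (intro V.lin_indpt_full_rank[OF M]) auto
  then have "det ?M \<noteq> 0" using V.det_rank_iff[OF M] by simp
  then have "det (select_cols A js) \<noteq> 0"
    unfolding map_mat_select_cols[OF js(2)] by simp
  with js show ?thesis by blast
qed

text \<open>A linear relation between the chosen columns of \<open>A\<close> restricts to the rows of \<open>A'\<close>, where the nonzero minor
excludes it.\<close>

lemma mat_rank_ge_if_row_minor:
  fixes A :: "int mat"
  assumes rows: "\<And>i. i < dim_row A' \<Longrightarrow> \<exists>i'<dim_row A. \<forall>j<dim_col A. A' $$ (i, j) = A $$ (i', j)"
    and js: "length js = dim_row A'" "set js \<subseteq> {..<dim_col A}" "dim_col A' = dim_col A"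
    and det: "det (select_cols A' js) \<noteq> 0"
  shows "dim_row A' \<le> mat_rank A"
proof -
  let ?r = "dim_row A" and ?k = "dim_row A'"
  let ?Q = "map_mat rat_of_int A" and ?Q' = "map_mat rat_of_int A'"
  interpret V: vec_space "TYPE(rat)" ?r .
  have Q: "?Q \<in> carrier_mat ?r (dim_col A)" by simp
  let ?M = "select_cols ?Q js" and ?M' = "select_cols ?Q' js"
  have M: "?M \<in> carrier_mat ?r ?k" using js by (intro carrier_matI) auto
  have M': "?M' \<in> carrier_mat ?k ?k" using js by (intro carrier_matI) auto
  have det': "det ?M' \<noteq> 0" using det js map_mat_select_cols[of js A' rat_of_int] by simp
  have jn: "js ! t < dim_col A" if "t < ?k" for t using js that by (metis lessThan_iff nth_mem subsetD)
  have inj: "v = 0\<^sub>v ?k" if v: "v \<in> carrier_vec ?k" "?M *\<^sub>v v = 0\<^sub>v ?r" for v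
  proof -
    have "?M' *\<^sub>v v = 0\<^sub>v ?k"
    proof (rule eq_vecI)
      fix i assume "i < dim_vec (0\<^sub>v ?k :: rat vec)"
      then have i: "i < ?k" by simp
      then obtain i' where i': "i' < ?r" "\<And>j. j < dim_col A \<Longrightarrow> A' $$ (i, j) = A $$ (i', j)"
        using rows by blast
      have "(?M' *\<^sub>v v) $ i = (?M *\<^sub>v v) $ i'"
        using i i' js v(1) jn by (subst (1 2) select_cols_mult_index) (auto intro!: sum.cong)
      then show "(?M' *\<^sub>v v) $ i = 0\<^sub>v ?k $ i" using v(2) i i' by simp
    qed (use M' in simp)
    from det_nonzero_injective[OF M' det' v(1) this] show ?thesis .
  qed
  have dist: "distinct (cols ?M)"
  proof (rule ccontr)
    assume "\<not> distinct (cols ?M)"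
    then obtain s t where st: "s < ?k" "t < ?k" "s \<noteq> t" "col ?M s = col ?M t"
      using M js by (auto simp: distinct_conv_nth)
    have "col ?M' s = col ?M' t"
    proof (rule eq_vecI)
      fix i assume "i < dim_vec (col ?M' t)"
      then have i: "i < ?k" by simp
      then obtain i' where i': "i' < ?r" "\<And>j. j < dim_col A \<Longrightarrow> A' $$ (i, j) = A $$ (i', j)"
        using rows by blast
      have "?M $$ (i', s) = ?M $$ (i', t)"
        using st(4) M i'(1) st(1,2) by (metis carrier_matD index_col)
      then show "col ?M' s $ i = col ?M' t $ i" using i i' st(1,2) jn js by simp
    qed simp
    from det_identical_cols[OF M' st(3,1,2) this] det' show False by simp
  qed
  have "V.lin_indpt (set (cols ?M))"
    using V.lin_depE[OF M _ dist] inj by metis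
  moreover have "set (cols ?M) \<subseteq> set (cols ?Q)"
  proof
    fix c assume "c \<in> set (cols ?M)"
    then obtain t where t: "t < ?k" "c = col ?M t" using js by (auto simp: cols_def)
    then have "c = col ?Q (js ! t)" using js jn[OF t(1)] by (intro eq_vecI) auto
    then show "c \<in> set (cols ?Q)" using jn[OF t(1)] by (auto simp: cols_def)
  qed
  ultimately have "card (set (cols ?M)) \<le> V.rank ?Q"
    using V.rank_ge_card_indpt[OF Q] by blast
  then show ?thesis using distinct_card[OF dist] js by (simp add: mat_rank_def)
qed

lemma left_kernel_imp_rank_deficient:
  fixes A :: "int mat"
  assumes y: "\<And>j. j < dim_col A \<Longrightarrow> (\<Sum>i<dim_row A. y i * A $$ (i, j)) = 0"
    and "i0 < dim_row A" "y i0 \<noteq> 0"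
  shows "mat_rank A < dim_row A"
proof (rule ccontr)
  let ?r = "dim_row A"
  assume "\<not> ?thesis"
  then have "mat_rank A = ?r" using mat_rank_le[of A] by simp
  from full_rank_imp_column_basis[OF this] obtain js where js: "length js = ?r"
    "set js \<subseteq> {..<dim_col A}" "det (select_cols A js) \<noteq> 0" by blast
  let ?B = "transpose_mat (select_cols A js)"
  have B: "?B \<in> carrier_mat ?r ?r" using js by simp
  have det: "det ?B \<noteq> 0" using js(3) det_transpose[OF select_cols_carrier[OF js(1)]] by simp
  have "?B *\<^sub>v vec ?r y = 0\<^sub>v ?r"
  proof (rule eq_vecI)
    fix t assume "t < dim_vec (0\<^sub>v ?r :: int vec)"
    then have t: "t < ?r" by simp
    then have jt: "js ! t < dim_col A" using js by (metis lessThan_iff nth_mem subsetD)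
    have "(?B *\<^sub>v vec ?r y) $ t = (\<Sum>i = 0..<?r. A $$ (i, js ! t) * y i)"
      using t js by (simp add: scalar_prod_def)
    also have "\<dots> = 0" using y[OF jt] by (simp add: lessThan_atLeast0 mult.commute)
    finally show "(?B *\<^sub>v vec ?r y) $ t = 0\<^sub>v ?r $ t" using t by simp
  qed (use js in simp)
  from det_nonzero_injective[OF B det vec_carrier this] have "vec ?r y $ i0 = 0"
    using assms(2) by simp
  with assms(2,3) show False by simp
qed

text \<open>A column basis with fewer than \<open>r\<close> elements, completed by zeros to a square matrix, is singular. So a
nonzero vector \<open>y\<close> is orthogonal to the basis and hence to all columns.\<close>

lemma trivial_left_kernel_imp_full_rank:
  fixes A :: "int mat"
  assumes triv: "\<And>y. (\<And>j. j < dim_col A \<Longrightarrow> (\<Sum>i<dim_row A. y i * rat_of_int (A $$ (i, j))) = 0)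
      \<Longrightarrow> \<forall>i<dim_row A. y i = 0"
  shows "mat_rank A = dim_row A"
proof (rule ccontr)
  let ?r = "dim_row A" and ?Q = "map_mat rat_of_int A"
  interpret V: vec_space "TYPE(rat)" ?r .
  assume "mat_rank A \<noteq> ?r"
  then have less: "mat_rank A < ?r" using mat_rank_le[of A] by simp
  obtain S where S: "maximal S (\<lambda>T. T \<subseteq> set (cols ?Q) \<and> V.lin_indpt T)"
    "card S = mat_rank A" "finite S"
    using mat_rank_column_basis[of A] by auto
  have SQ: "S \<subseteq> set (cols ?Q)" and indpt: "V.lin_indpt S" using S by (auto simp: maximal_def)
  have colsc: "set (cols ?Q) \<subseteq> carrier_vec ?r" using cols_dim[of ?Q] by simp
  then have Sc: "S \<subseteq> carrier_vec ?r" using SQ by blast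
  obtain ss where ss: "set ss = S" "distinct ss" using finite_distinct_list[OF S(3)] by blast
  have len: "length ss < ?r" using ss S(2) less distinct_card by fastforce
  define M where "M = mat ?r ?r (\<lambda>(t, i). if t < length ss then ss ! t $ i else 0)"
  have M: "M \<in> carrier_mat ?r ?r" by (simp add: M_def)
  have "transpose_mat M *\<^sub>v unit_vec ?r (?r - 1) = 0\<^sub>v ?r"
  proof (rule eq_vecI)
    fix i assume "i < dim_vec (0\<^sub>v ?r :: rat vec)"
    then have i: "i < ?r" by simp
    have "(transpose_mat M *\<^sub>v unit_vec ?r (?r - 1)) $ i = M $$ (?r - 1, i)"
      using i len M by (simp add: scalar_prod_right_unit)
    also have "\<dots> = 0" using i len by (simp add: M_def)
    finally show "(transpose_mat M *\<^sub>v unit_vec ?r (?r - 1)) $ i = 0\<^sub>v ?r $ i" using i by simp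
  qed (use M in simp)
  moreover have "unit_vec ?r (?r - 1) \<noteq> (0\<^sub>v ?r :: rat vec)" using len by (intro unit_vec_nonzero) auto
  ultimately have "det (transpose_mat M) = 0"
    using det_0_iff_vec_prod_zero[of "transpose_mat M" ?r] M
    by (metis transpose_carrier_mat unit_vec_carrier)
  then have "det M = 0" using det_transpose[OF M] by simp
  then obtain y where y: "y \<in> carrier_vec ?r" "y \<noteq> 0\<^sub>v ?r" "M *\<^sub>v y = 0\<^sub>v ?r"
    using det_0_iff_vec_prod_zero[OF M] by blast
  let ?N = "{v \<in> carrier_vec ?r. v \<bullet> y = 0}"
  have "s \<in> ?N" if "s \<in> S" for s
  proof -
    obtain t where t: "t < length ss" "ss ! t = s" using \<open>s \<in> S\<close> ss(1) by (metis in_set_conv_nth)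
    have sc: "s \<in> carrier_vec ?r" using Sc that by blast
    have "row M t = s" using t len sc by (intro eq_vecI) (auto simp: M_def)
    then have "s \<bullet> y = (M *\<^sub>v y) $ t" using t(1) len M by simp
    also have "\<dots> = 0" unfolding y(3) using t(1) len by simp
    finally show ?thesis using sc by blast
  qed
  moreover have "submodule class_ring ?N V.V"
    by (unfold_locales)
      (auto simp: module_vec_simps class_ring_simps y(1) add_scalar_prod_distrib[of _ ?r] smult_scalar_prod_distrib[of _ ?r])
  ultimately have span: "V.span S \<subseteq> ?N" by (intro V.span_is_subset) auto
  have colN: "c \<bullet> y = 0" if c: "c \<in> set (cols ?Q)" for c
  proof -
    have "c \<in> V.span S"
    proof (cases "c \<in> S")
      case True
      then show ?thesis using V.in_own_span[of S] Sc by auto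
    next
      case False
      have "\<not> V.lin_indpt (S \<union> {c})"
      proof
        assume "V.lin_indpt (S \<union> {c})"
        then have "S \<union> {c} = S" using S(1) SQ c unfolding maximal_def by blast
        with False show False by blast
      qed
      then show ?thesis using V.lin_dep_iff_in_span[of S c] Sc indpt False c colsc by auto
    qed
    with span show ?thesis by blast
  qed
  have "(\<Sum>i<?r. y $ i * rat_of_int (A $$ (i, j))) = 0" if j: "j < dim_col A" for j
  proof -
    have "col ?Q j \<bullet> y = 0" using colN j by (auto simp: cols_def)
    then show ?thesis using j y(1) by (simp add: scalar_prod_def lessThan_atLeast0 mult.commute)
  qed
  then have "\<forall>i<?r. y $ i = 0" by (rule triv)
  then have "y = 0\<^sub>v ?r" using y(1) by (intro eq_vecI) auto
  with y(2) show False by simp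
qed

section \<open>Deleting the first row\<close>

lemma delete_first_row:
  assumes "0 < dim_row A"
  shows "dim_row (delete_row A 0) = dim_row A - 1" "dim_col (delete_row A 0) = dim_col A"
    and "i < dim_row A - 1 \<Longrightarrow> j < dim_col A \<Longrightarrow> delete_row A 0 $$ (i, j) = A $$ (Suc i, j)"
proof -
  let ?I = "{..<dim_row A} - {0}"
  have I: "{i. i < dim_row A \<and> i \<in> ?I} = {1..<dim_row A}" by auto
  have J: "{j. j < dim_col A \<and> j \<in> {..<dim_col A}} = {..<dim_col A}" by auto
  show "dim_row (delete_row A 0) = dim_row A - 1" "dim_col (delete_row A 0) = dim_col A"
    unfolding delete_row_def dim_submatrix I J by simp_all
  assume ij: "i < dim_row A - 1" "j < dim_col A"
  have "{a \<in> ?I. a < Suc i} = {1..<Suc i}" using ij by auto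
  then have "pick ?I i = Suc i" using pick_card_in_set[of "Suc i" ?I] ij by simp
  moreover have "{a \<in> {..<dim_col A}. a < j} = {..<j}" using ij by auto
  then have "pick {..<dim_col A} j = j" using pick_card_in_set[of j "{..<dim_col A}"] ij by simp
  ultimately show "delete_row A 0 $$ (i, j) = A $$ (Suc i, j)"
    using submatrix_index[of i A ?I j "{..<dim_col A}"] ij unfolding delete_row_def I J by simp
qed

text \<open>A left kernel vector that is nonzero at the first row expresses this row by the others, so that deleting it
does not change the kernel.\<close>

lemma unit_conformal_delete_first_row:
  assumes U: "unit_conformal A" and r: "0 < dim_row A"
    and y: "\<And>j. j < dim_col A \<Longrightarrow> (\<Sum>i<dim_row A. y i * A $$ (i, j)) = 0" and y0: "y 0 \<noteq> 0"
  shows "unit_conformal (delete_row A 0)"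
proof -
  let ?A' = "delete_row A 0"
  note del = delete_first_row[OF r]
  obtain r' where r': "dim_row A = Suc r'" using r by (cases "dim_row A") auto
  have "kernel_vector ?A' w \<longleftrightarrow> kernel_vector A w" for w
  proof
    assume "kernel_vector A w"
    then show "kernel_vector ?A' w" using del r' by (simp add: kernel_vector_def)
  next
    assume w: "kernel_vector ?A' w"
    let ?R = "\<lambda>i. \<Sum>j<dim_col A. A $$ (i, j) * w j"
    have S: "?R (Suc i) = 0" if "i < r'" for i using w del that r' by (simp add: kernel_vector_def)
    have "(\<Sum>i<dim_row A. y i * ?R i) = (\<Sum>i<dim_row A. \<Sum>j<dim_col A. y i * A $$ (i, j) * w j)"
      by (simp add: sum_distrib_left mult.assoc)
    also have "\<dots> = (\<Sum>j<dim_col A. \<Sum>i<dim_row A. y i * A $$ (i, j) * w j)" by (rule sum.swap)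
    also have "\<dots> = 0" using y by (simp flip: sum_distrib_right)
    finally have "y 0 * ?R 0 = 0" using S by (simp add: r' sum.lessThan_Suc_shift del: sum.lessThan_Suc)
    then have R0: "?R 0 = 0" using y0 by simp
    show "kernel_vector A w"
      unfolding kernel_vector_def
    proof (intro allI impI)
      fix i assume "i < dim_row A"
      then show "?R i = 0" using R0 S r' by (cases i) auto
    qed
  qed
  then show ?thesis using U del(2) by (simp add: unit_conformal_def)
qed

section \<open>Disjoint odd cycles violate normality\<close>

lemma centrally_symmetric_height:
  assumes "j < dim_col (centrally_symmetric A)"
  shows "Poly_Mapping.lookup (column_exponent (centrally_symmetric A) j) (dim_row A) = 1"
  using assms by (simp add: lookup_column_exponent centrally_symmetric_dims centrally_symmetric_entry)

text \<open>The exponent \<open>(A x, h)\<close>, whose last coordinate is the height.\<close>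

definition height_point :: "int mat \<Rightarrow> (nat \<Rightarrow> int) \<Rightarrow> nat \<Rightarrow> (nat \<Rightarrow>\<^sub>0 int)" where
  "height_point A x h =
     (\<Sum>i<dim_row A. Poly_Mapping.single i (\<Sum>j<dim_col A. A $$ (i, j) * x j))
     + Poly_Mapping.single (dim_row A) (int h)"

lemma lookup_height_point:
  "Poly_Mapping.lookup (height_point A x h) i =
    (if i < dim_row A then \<Sum>j<dim_col A. A $$ (i, j) * x j else if i = dim_row A then int h else 0)"
  unfolding height_point_def lookup_add lookup_sum lookup_single when_def
  by (auto simp: sum.delta')

lemma total_degree_signed:
  "int (total_degree (Suc (n + n)) u) = int (Poly_Mapping.lookup u 0)
     + (\<Sum>j<n. int (Poly_Mapping.lookup u (Suc j)) + int (Poly_Mapping.lookup u (Suc (n + j))))"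
  unfolding total_degree_def sum.lessThan_Suc_shift sum_lessThan_add by (simp add: sum.distrib)

text \<open>The monomials of height \<open>h\<close> are the ways to write \<open>A x\<close> as a sum of at most \<open>h\<close> signed columns; the zero
column makes up the difference.\<close>

lemma height_point_in_semigroup_iff:
  fixes A
  defines "C \<equiv> centrally_symmetric A"
  shows "height_point A x h \<in> semigroup_of (column_exponent C) (dim_col C) \<longleftrightarrow>
    (\<exists>x'. kernel_vector A (\<lambda>j. x' j - x j) \<and> (\<Sum>j<dim_col A. \<bar>x' j\<bar>) \<le> int h)" (is "?l \<longleftrightarrow> ?r")
proof
  let ?n = "dim_col A"
  have m: "dim_col C = Suc (?n + ?n)" by (simp add: C_def centrally_symmetric_dims)
  note lookup = lookup_multidegree_centrally_symmetric[of A, folded C_def]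
  {
    assume ?l
    then obtain u where u: "height_point A x h = multidegree (column_exponent C) (dim_col C) u"
      by (auto simp: semigroup_of_def)
    have eq: "Poly_Mapping.lookup (height_point A x h) i
        = Poly_Mapping.lookup (multidegree (column_exponent C) (dim_col C) u) i" for i
      by (simp add: u)
    note eq = eq[unfolded lookup_height_point lookup]
    have "kernel_vector A (\<lambda>j. net_exponent ?n u j - x j)"
      unfolding kernel_vector_def
    proof (intro allI impI)
      fix i assume "i < dim_row A"
      with eq[of i] show "(\<Sum>j<?n. A $$ (i, j) * (net_exponent ?n u j - x j)) = 0"
        by (simp add: right_diff_distrib sum_subtractf)
    qed
    moreover have "int h = int (total_degree (dim_col C) u)" using eq[of "dim_row A"] by simp
    then have "(\<Sum>j<?n. \<bar>net_exponent ?n u j\<bar>) \<le> int h"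
      unfolding m total_degree_signed
      by (simp add: net_exponent_def) (rule order_trans[OF sum_mono], rule abs_triangle_ineq4, simp)
    ultimately show ?r by blast
  }
  {
    assume ?r
    then obtain x' where x': "kernel_vector A (\<lambda>j. x' j - x j)" "(\<Sum>j<?n. \<bar>x' j\<bar>) \<le> int h" by blast
    define a where "a = nat (\<Sum>j<?n. \<bar>x' j\<bar>)"
    have a: "int a = (\<Sum>j<?n. \<bar>x' j\<bar>)" unfolding a_def by (simp add: sum_nonneg)
    define u where "u = Poly_Mapping.single 0 (h - a) + monomial_of ?n x'"
    have um: "u \<in> monomials (dim_col C)" by (simp add: u_def m)
    have net: "net_exponent ?n u j = x' j" if "j < ?n" for j
      using that net_exponent_monomial_of[OF that] by (simp add: u_def net_exponent_def lookup_add lookup_single)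
    have "int (Poly_Mapping.lookup u (Suc j)) + int (Poly_Mapping.lookup u (Suc (?n + j))) = \<bar>x' j\<bar>"
      if "j < ?n" for j
      using that by (simp add: u_def lookup_add lookup_single lookup_monomial_of)
    moreover have "Poly_Mapping.lookup u 0 = h - a"
      by (simp add: u_def lookup_add lookup_monomial_of)
    ultimately have "int (total_degree (dim_col C) u) = int (h - a) + (\<Sum>j<?n. \<bar>x' j\<bar>)"
      unfolding m total_degree_signed by simp
    also have "\<dots> = int h" using x'(2) a by simp
    finally have td: "int (total_degree (dim_col C) u) = int h" .
    have "height_point A x h = multidegree (column_exponent C) (dim_col C) u"
    proof (rule poly_mapping_eqI)
      fix i
      have "(\<Sum>j<?n. A $$ (i, j) * x j) = (\<Sum>j<?n. A $$ (i, j) * x' j)" if "i < dim_row A"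
        using x'(1) that by (simp add: kernel_vector_def right_diff_distrib sum_subtractf)
      also have "\<dots> = (\<Sum>j<?n. A $$ (i, j) * net_exponent ?n u j)"
        by (intro sum.cong refl) (simp add: net)
      finally show "Poly_Mapping.lookup (height_point A x h) i
          = Poly_Mapping.lookup (multidegree (column_exponent C) (dim_col C) u) i"
        by (simp add: lookup_height_point lookup td)
    qed
    then show ?l using um by (simp add: semigroup_of_def)
  }
qed

text \<open>Every point \<open>(A x, h)\<close> lies in the group: raise the height until the point lies in the semigroup and
subtract a multiple of the zero column.\<close>

lemma normal_semigroup_vectors:
  fixes A
  defines "C \<equiv> centrally_symmetric A"
  assumes normal: "normal_semigroup (column_exponent C) (dim_col C)"
    and k: "k > 0" and x': "kernel_vector A (\<lambda>j. x' j - int k * x j)"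
    and le: "(\<Sum>j<dim_col A. \<bar>x' j\<bar>) \<le> int (k * h)"
  shows "\<exists>x''. kernel_vector A (\<lambda>j. x'' j - x j) \<and> (\<Sum>j<dim_col A. \<bar>x'' j\<bar>) \<le> int h"
proof -
  let ?S = "semigroup_of (column_exponent C) (dim_col C)"
  note iff = height_point_in_semigroup_iff[of A, folded C_def]
  define N where "N = nat (\<Sum>j<dim_col A. \<bar>x j\<bar>)"
  have N: "int N = (\<Sum>j<dim_col A. \<bar>x j\<bar>)" unfolding N_def by (simp add: sum_nonneg)
  have p: "height_point A x (h + N) \<in> ?S"
    unfolding iff by (rule exI[of _ x]) (simp add: kernel_vector_def N)
  have q: "height_point A (\<lambda>_. 0) N \<in> ?S"
    unfolding iff by (rule exI[of _ "\<lambda>_. 0"]) (simp add: kernel_vector_def)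
  have pq: "height_point A x (h + N) - height_point A (\<lambda>_. 0) N = height_point A x h"
    by (rule poly_mapping_eqI) (simp add: lookup_minus lookup_height_point)
  have "of_nat k * height_point A x h = height_point A (\<lambda>j. int k * x j) (k * h)"
    by (rule poly_mapping_eqI) (simp add: lookup_of_nat_mult lookup_height_point sum_distrib_left ac_simps)
  also have "\<dots> \<in> ?S" unfolding iff using x' le by blast
  finally have "height_point A x h \<in> ?S"
    using normal p q k pq unfolding normal_semigroup_def by metis
  then show ?thesis unfolding iff .
qed

lemma sum_boundary:
  assumes "finite E" "finite U"
  shows "(\<Sum>v\<in>U. boundary E f v) = (\<Sum>e\<in>E. f e * int (card (e \<inter> U)))"
proof -
  have "(\<Sum>v\<in>U. boundary E f v) = (\<Sum>v\<in>U. \<Sum>e\<in>E. if v \<in> e then f e else 0)"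
    unfolding boundary_def by (simp add: sum.inter_filter[OF assms(1)])
  also have "\<dots> = (\<Sum>e\<in>E. \<Sum>v\<in>U. if v \<in> e then f e else 0)" by (rule sum.swap)
  also have "\<dots> = (\<Sum>e\<in>E. f e * int (card (e \<inter> U)))"
  proof (intro sum.cong refl)
    fix e
    have "(\<Sum>v\<in>U. if v \<in> e then f e else 0) = (\<Sum>v\<in>{v \<in> U. v \<in> e}. f e)"
      by (rule sum.inter_filter[OF assms(2), symmetric])
    also have "{v \<in> U. v \<in> e} = e \<inter> U" by auto
    finally show "(\<Sum>v\<in>U. if v \<in> e then f e else 0) = f e * int (card (e \<inter> U))" by (simp add: mult.commute)
  qed
  finally show ?thesis .
qed

lemma sum_cycle_function:
  assumes "finite F" "\<And>i. i < length c \<Longrightarrow> cycle_edge c i \<in> F"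
  shows "(\<Sum>e\<in>F. cycle_function c e) = int (length c)"
proof -
  have "(\<Sum>e\<in>F. cycle_function c e) = (\<Sum>i<length c. \<Sum>e\<in>F. edge_indicator (cycle_edge c i) e)"
    unfolding cycle_function_def by (rule sum.swap)
  also have "\<dots> = (\<Sum>i<length c. 1)"
    using assms by (intro sum.cong refl) (simp add: edge_indicator_def sum.delta)
  finally show ?thesis by simp
qed

lemma sum_over_edges:
  "distinct es \<Longrightarrow> (\<Sum>j<length es. g (es ! j)) = (\<Sum>e\<in>set es. g e)"
  by (rule sum.reindex_bij_betw[OF bij_betw_nth[OF _ refl refl]])

text \<open>Suppose \<open>c\<close> and \<open>c'\<close> are disjoint and \<open>h\<close> is half the number of their vertices. The difference of their
vertex indicators is half the boundary of the edges of \<open>c\<close> minus those of \<open>c'\<close>. By normality it is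
the boundary of some \<open>g\<close> with values of absolute sum at most \<open>h\<close>. Pair it with the same difference:
the result is \<open>2 h\<close>, while an edge contributes at most \<open>2\<close> per unit of \<open>g\<close>. So every edge used by \<open>g\<close>
attains this bound and lies entirely in \<open>c\<close> or in \<open>c'\<close>. Summing the boundary over \<open>c\<close> therefore gives
an even number, although the sum is the length of \<open>c\<close>.\<close>

theorem normal_semigroup_imp_odd_cycles_meet:
  assumes G: "simple_graph {1..d} E" "connected_graph {1..d} E" and es: "distinct es" "set es = E"
    and normal: "normal_semigroup (column_exponent (centrally_symmetric (edge_matrix d es)))
      (dim_col (centrally_symmetric (edge_matrix d es)))"
    and c: "odd_cycle E c" and c': "odd_cycle E c'"
  shows "set c \<inter> set c' \<noteq> {}"
proof
  assume disj: "set c \<inter> set c' = {}"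
  let ?A = "edge_matrix d es"
  have E: "\<forall>e\<in>E. e \<subseteq> {1..d} \<and> card e = 2" using G(1) by (simp add: simple_graph_def)
  have finE: "finite E" using es by auto
  have cyc: "is_cycle E c" "is_cycle E c'" and odd: "odd (length c)" "odd (length c')"
    and dist: "distinct c" "distinct c'"
    using c c' by (auto simp: odd_cycle_def is_cycle_def)
  note sub = cycle_vertices_subset[OF G(1)]
  define f' where "f' = (\<lambda>e. cycle_function c e - cycle_function c' e)"
  obtain f where
    f: "\<And>v. boundary E f v = (if v \<in> set c then 1 else 0) - (if v \<in> set c' then 1 else 0)"
    and f': "\<And>v. boundary E f' v = 2 * boundary E f v"
    using odd_cycles_half[OF G c c'] unfolding f'_def by blast
  define h where "h = (length c + length c') div 2"
  have h: "2 * h = length c + length c'" using odd by (simp add: h_def)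
  have "kernel_vector ?A (\<lambda>j. f' (es ! j) - int 2 * f (es ! j))"
    using kernel_vector_edge_matrix[OF es(1), of d "\<lambda>e. f' e - 2 * f e"]
    by (simp add: boundary_diff boundary_mult es(2) f')
  moreover have "(\<Sum>j<dim_col ?A. \<bar>f' (es ! j)\<bar>) \<le> int (2 * h)"
  proof -
    have nn: "0 \<le> cycle_function a e" for a e
      by (simp add: cycle_function_def edge_indicator_def sum_nonneg)
    have "(\<Sum>j<dim_col ?A. \<bar>f' (es ! j)\<bar>) = (\<Sum>e\<in>E. \<bar>f' e\<bar>)"
      using sum_over_edges[OF es(1), of "\<lambda>e. \<bar>f' e\<bar>"] es(2) by simp
    also have "\<dots> \<le> (\<Sum>e\<in>E. cycle_function c e + cycle_function c' e)"
    proof (rule sum_mono)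
      fix e show "\<bar>f' e\<bar> \<le> cycle_function c e + cycle_function c' e"
        using nn[of c e] nn[of c' e] by (simp add: f'_def)
    qed
    also have "\<dots> = int (2 * h)"
      unfolding sum.distrib h
      using sum_cycle_function[OF finE, of c] sum_cycle_function[OF finE, of c']
        cycle_edge_facts(1)[OF cyc(1)] cycle_edge_facts(1)[OF cyc(2)] by simp
    finally show ?thesis .
  qed
  ultimately obtain x where x: "kernel_vector ?A (\<lambda>j. x j - f (es ! j))" "(\<Sum>j<dim_col ?A. \<bar>x j\<bar>) \<le> int h"
    using normal_semigroup_vectors[OF normal, of 2 "\<lambda>j. f' (es ! j)" "\<lambda>j. f (es ! j)" h] by auto
  define g where "g = (\<lambda>e. x (edge_index es e))"
  have gx: "g (es ! j) = x j" if "j < length es" for j using that es by (simp add: g_def edge_index_nth)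
  have "kernel_vector ?A (\<lambda>j. g (es ! j) - f (es ! j))"
    using x(1) by (simp add: kernel_vector_def gx)
  then have bg: "boundary E g v = boundary E f v" if "v \<in> {1..d}" for v
    using kernel_vector_edge_matrix[OF es(1), of d "\<lambda>e. g e - f e"] that
    by (simp add: boundary_diff es(2))
  have "(\<Sum>j<length es. \<bar>g (es ! j)\<bar>) \<le> int h" using x(2) by (simp add: gx)
  then have gh: "(\<Sum>e\<in>E. \<bar>g e\<bar>) \<le> int h"
    using sum_over_edges[OF es(1), of "\<lambda>e. \<bar>g e\<bar>"] es(2) by simp
  let ?N = "\<lambda>e. int (card (e \<inter> set c))" and ?N' = "\<lambda>e. int (card (e \<inter> set c'))"
  have N: "?N e + ?N' e \<le> 2" if "e \<in> E" for e
  proof -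
    have e: "finite e" "card e = 2" using E that card_gt_0_iff[of e] by auto
    have "card (e \<inter> set c) + card (e \<inter> set c') = card ((e \<inter> set c) \<union> (e \<inter> set c'))"
      using disj by (intro card_Un_disjoint[symmetric]) auto
    also have "\<dots> \<le> card e" using e by (intro card_mono) auto
    finally show ?thesis using e by simp
  qed
  have "(\<Sum>v\<in>set c. boundary E g v) = (\<Sum>v\<in>set c. 1)"
  proof (rule sum.cong)
    fix v assume "v \<in> set c"
    moreover from this have "v \<notin> set c'" "v \<in> {1..d}" using disj sub[OF cyc(1)] by blast+
    ultimately show "boundary E g v = 1" using bg[of v] f[of v] by simp
  qed simp
  then have sc: "(\<Sum>e\<in>E. g e * ?N e) = int (length c)"
    using sum_boundary[OF finE, of "set c" g] dist by (simp add: distinct_card)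
  have "(\<Sum>v\<in>set c'. boundary E g v) = (\<Sum>v\<in>set c'. -1)"
  proof (rule sum.cong)
    fix v assume "v \<in> set c'"
    moreover from this have "v \<notin> set c" "v \<in> {1..d}" using disj sub[OF cyc(2)] by blast+
    ultimately show "boundary E g v = -1" using bg[of v] f[of v] by simp
  qed simp
  then have sc': "(\<Sum>e\<in>E. g e * ?N' e) = - int (length c')"
    using sum_boundary[OF finE, of "set c'" g] dist by (simp add: distinct_card)
  have nn: "0 \<le> 2 * \<bar>g e\<bar> - g e * (?N e - ?N' e)" if "e \<in> E" for e
  proof -
    have "\<bar>g e * (?N e - ?N' e)\<bar> \<le> \<bar>g e\<bar> * 2"
      unfolding abs_mult using N[OF that] by (intro mult_left_mono) auto
    then show ?thesis by linarith
  qed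
  have "(\<Sum>e\<in>E. 2 * \<bar>g e\<bar> - g e * (?N e - ?N' e)) = 2 * (\<Sum>e\<in>E. \<bar>g e\<bar>) - int (2 * h)"
    using sc sc' by (simp add: sum_subtractf right_diff_distrib h flip: sum_distrib_left)
  then have "(\<Sum>e\<in>E. 2 * \<bar>g e\<bar> - g e * (?N e - ?N' e)) \<le> 0" using gh by simp
  moreover have "0 \<le> (\<Sum>e\<in>E. 2 * \<bar>g e\<bar> - g e * (?N e - ?N' e))"
    by (rule sum_nonneg) (rule nn)
  ultimately have "(\<Sum>e\<in>E. 2 * \<bar>g e\<bar> - g e * (?N e - ?N' e)) = 0" by (rule order_antisym)
  then have tight: "2 * \<bar>g e\<bar> = g e * (?N e - ?N' e)" if "e \<in> E" for e
    using sum_nonneg_eq_0_iff[OF finE, of "\<lambda>e. 2 * \<bar>g e\<bar> - g e * (?N e - ?N' e)"] nn that by auto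
  have "even (g e * ?N e)" if e: "e \<in> E" for e
  proof (cases "?N e = 1")
    case True
    then have "?N' e = 0 \<or> ?N' e = 1" using N[OF e] by linarith
    then have "g e = 0" using tight[OF e] unfolding True by auto
    then show ?thesis by simp
  next
    case False
    then have "?N e = 0 \<or> ?N e = 2" using N[OF e] by linarith
    then show ?thesis by auto
  qed
  then have "even (\<Sum>e\<in>E. g e * ?N e)" by (rule dvd_sum)
  with sc odd(1) show False by simp
qed

section \<open>Disjoint odd cycles violate unimodularity\<close>

text \<open>At each vertex of the cycle exactly two edges can carry a nonzero value, so the values alternate in sign
around the cycle, which has odd length.\<close>

lemma odd_cycle_edges_independent:
  assumes c: "odd_cycle E c" and finE: "finite E"
    and bd: "\<And>v. v \<in> set c \<Longrightarrow> boundary E g v = 0"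
    and supp: "\<And>e. e \<in> E \<Longrightarrow> e \<inter> set c \<noteq> {} \<Longrightarrow> g e \<noteq> 0 \<Longrightarrow> e \<in> cycle_edge c ` {..<length c}"
    and i: "i < length c"
  shows "g (cycle_edge c i) = 0"
proof -
  let ?L = "length c"
  have cyc: "is_cycle E c" and L: "3 \<le> ?L" "distinct c" "odd ?L"
    using c by (auto simp: odd_cycle_def is_cycle_def)
  have alt: "g (cycle_edge c (Suc i mod ?L)) = - g (cycle_edge c i)" if i: "i < ?L" for i
  proof -
    define p q where "p = Suc i mod ?L" and "q = Suc p mod ?L"
    have pq: "p < ?L" "q < ?L" using L unfolding p_def q_def by (auto intro!: mod_less_divisor)
    have "q \<noteq> i" "p \<noteq> i" using i L unfolding p_def q_def by (auto simp: mod_Suc split: if_splits)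
    have ne: "cycle_edge c i \<noteq> cycle_edge c p"
    proof
      assume "cycle_edge c i = cycle_edge c p"
      then have "c ! i \<in> {c ! p, c ! q}" unfolding cycle_edge_def q_def[symmetric] by blast
      then show False using \<open>q \<noteq> i\<close> \<open>p \<noteq> i\<close> i pq L(2) by (auto simp: nth_eq_iff_index_eq)
    qed
    have "0 = boundary E g (c ! p)" using bd[of "c ! p"] pq by simp
    also have "\<dots> = (\<Sum>e\<in>{cycle_edge c i, cycle_edge c p}. g e)"
      unfolding boundary_def
    proof (rule sum.mono_neutral_right)
      show "{cycle_edge c i, cycle_edge c p} \<subseteq> {e \<in> E. c ! p \<in> e}"
        using cycle_edge_facts(1)[OF cyc] i pq by (auto simp: cycle_edge_def p_def)
      show "\<forall>e\<in>{e \<in> E. c ! p \<in> e} - {cycle_edge c i, cycle_edge c p}. g e = 0"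
      proof (rule ballI, rule ccontr)
        fix e assume e: "e \<in> {e \<in> E. c ! p \<in> e} - {cycle_edge c i, cycle_edge c p}" "g e \<noteq> 0"
        then have "e \<inter> set c \<noteq> {}" using pq by auto
        with supp[of e] e obtain k where k: "k < ?L" "e = cycle_edge c k" by auto
        then have "c ! p = c ! k \<or> c ! p = c ! (Suc k mod ?L)" using e by (auto simp: cycle_edge_def)
        moreover have "Suc k mod ?L < ?L" using L by (intro mod_less_divisor) auto
        ultimately have "p = k \<or> p = Suc k mod ?L" using pq k L(2) by (auto simp: nth_eq_iff_index_eq)
        moreover have "k = i" if "p = Suc k mod ?L"
          using that k(1) i unfolding p_def by (auto simp: mod_Suc split: if_splits)
        ultimately show False using e k by auto
      qed
    qed (use finE in simp)
    also have "\<dots> = g (cycle_edge c i) + g (cycle_edge c p)" using ne by simp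
    finally show ?thesis by (simp add: p_def)
  qed
  have pow: "g (cycle_edge c i) = (-1) ^ i * g (cycle_edge c 0)" if "i < ?L" for i
    using that
  proof (induction i)
    case (Suc i)
    then show ?case using alt[of i] by simp
  qed simp
  have "?L - 1 < ?L" "Suc (?L - 1) mod ?L = 0" using L by auto
  with alt[of "?L - 1"] have "g (cycle_edge c 0) = - g (cycle_edge c (?L - 1))" by simp
  also have "\<dots> = - g (cycle_edge c 0)" using pow[of "?L - 1"] L by simp
  finally have "g (cycle_edge c 0) = 0" by simp
  with pow[OF i] show ?thesis by simp
qed

text \<open>The difference of the vertex indicators of disjoint odd cycles is an integer combination of columns, and
twice this vector is the signed sum \<open>f'\<close> of the edges of the cycles. As these columns are independent,
unimodularity makes all values of \<open>f'\<close> even, although they sum to an odd number over the edges inside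
\<open>c\<close>.\<close>

theorem unimodular_imp_odd_cycles_meet:
  assumes G: "simple_graph {1..d} E" "connected_graph {1..d} E" and es: "distinct es" "set es = E"
    and U: "unimodular (edge_matrix d es)"
    and c: "odd_cycle E c" and c': "odd_cycle E c'"
  shows "set c \<inter> set c' \<noteq> {}"
proof
  assume disj: "set c \<inter> set c' = {}"
  let ?A = "edge_matrix d es"
  have finE: "finite E" using es by auto
  have cyc: "is_cycle E c" "is_cycle E c'" and odd: "odd (length c)"
    using c c' by (auto simp: odd_cycle_def)
  note sub = cycle_vertices_subset[OF G(1)]
  define f' where "f' = (\<lambda>e. cycle_function c e - cycle_function c' e)"
  obtain f where
    f: "\<And>v. boundary E f v = (if v \<in> set c then 1 else 0) - (if v \<in> set c' then 1 else 0)"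
    and f': "\<And>v. boundary E f' v = 2 * boundary E f v"
    using odd_cycles_half[OF G c c'] unfolding f'_def by blast
  let ?F = "cycle_edge c ` {..<length c}" and ?F' = "cycle_edge c' ` {..<length c'}"
  have F: "e \<subseteq> set c" "e \<noteq> {}" if "e \<in> ?F" for e
    using that cycle_edge_facts(3)[OF cyc(1)] by (auto simp: cycle_edge_def)
  have F': "e \<subseteq> set c'" "e \<noteq> {}" if "e \<in> ?F'" for e
    using that cycle_edge_facts(3)[OF cyc(2)] by (auto simp: cycle_edge_def)
  have cf0: "cycle_function a e = 0" if "e \<notin> cycle_edge a ` {..<length a}" for a e
    unfolding cycle_function_def edge_indicator_def using that by (intro sum.neutral) auto
  define S where "S = {j. j < length es \<and> es ! j \<in> ?F \<union> ?F'}"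
  have indep: "\<forall>j<dim_col ?A. w j = 0" if w: "kernel_vector ?A w" "\<And>j. j \<notin> S \<Longrightarrow> w j = 0" for w
  proof -
    define g where "g = (\<lambda>e. w (edge_index es e))"
    have gw: "g (es ! j) = w j" if "j < length es" for j using that es by (simp add: g_def edge_index_nth)
    have "kernel_vector ?A (\<lambda>j. g (es ! j))" using w(1) by (simp add: kernel_vector_def gw)
    then have bd: "boundary E g v = 0" if "v \<in> {1..d}" for v
      using kernel_vector_edge_matrix[OF es(1), of d g] that es(2) by simp
    have supp: "e \<in> ?F \<union> ?F'" if "e \<in> E" "g e \<noteq> 0" for e
    proof -
      obtain j where "j < length es" "es ! j = e" using \<open>e \<in> E\<close> es(2) by (metis in_set_conv_nth)
      then show ?thesis using w(2)[of j] gw[of j] \<open>g e \<noteq> 0\<close> by (auto simp: S_def)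
    qed
    have zF: "g (cycle_edge c i) = 0" if "i < length c" for i
    proof (rule odd_cycle_edges_independent[OF c finE _ _ that])
      show "e \<in> ?F" if "e \<in> E" "e \<inter> set c \<noteq> {}" "g e \<noteq> 0" for e
        using supp[OF that(1,3)] F'[of e] that(2) disj by blast
    qed (use bd sub[OF cyc(1)] in blast)
    have zF': "g (cycle_edge c' i) = 0" if "i < length c'" for i
    proof (rule odd_cycle_edges_independent[OF c' finE _ _ that])
      show "e \<in> ?F'" if "e \<in> E" "e \<inter> set c' \<noteq> {}" "g e \<noteq> 0" for e
        using supp[OF that(1,3)] F[of e] that(2) disj by blast
    qed (use bd sub[OF cyc(2)] in blast)
    have "g e = 0" if "e \<in> E" for e using supp[OF that] zF zF' by auto
    then show ?thesis using gw es(2) by (metis edge_matrix_dims(2) nth_mem)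
  qed
  have ex: "\<exists>js. length js = dim_row ?A \<and> set js \<subseteq> {..<dim_col ?A} \<and> det (select_cols ?A js) \<noteq> 0"
    using U by (intro full_rank_imp_column_basis) (simp add: unimodular_def)
  let ?f' = "\<lambda>j. if j < length es then f' (es ! j) else 0"
  have "kernel_vector ?A (\<lambda>j. f' (es ! j) - 2 * f (es ! j))"
    using kernel_vector_edge_matrix[OF es(1), of d "\<lambda>e. f' e - 2 * f e"]
    by (simp add: boundary_diff boundary_mult es(2) f')
  then have ker: "kernel_vector ?A (\<lambda>j. ?f' j - 2 * f (es ! j))" by (simp add: kernel_vector_def)
  have f'0: "?f' j = 0" if "j \<notin> S" for j using that by (auto simp: S_def f'_def cf0)
  have S: "S \<subseteq> {..<dim_col ?A}" by (auto simp: S_def)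
  have ev: "even (f' e)" if e: "e \<in> E" for e
  proof -
    obtain j where j: "j < length es" "es ! j = e" using e es(2) by (metis in_set_conv_nth)
    have "even (?f' j)"
      by (rule unimodular_even_coefficients[OF U ex S indep f'0 ker]) (use j in simp_all)
    with j show ?thesis by simp
  qed
  let ?E = "{e \<in> E. e \<subseteq> set c}"
  have "(\<Sum>e\<in>?E. f' e) = (\<Sum>e\<in>?E. cycle_function c e)"
  proof (intro sum.cong refl)
    fix e assume "e \<in> ?E"
    then have "e \<notin> ?F'" using F'[of e] disj by blast
    then show "f' e = cycle_function c e" by (simp add: f'_def cf0)
  qed
  also have "\<dots> = int (length c)"
    using cycle_edge_facts(1,3)[OF cyc(1)] finE by (intro sum_cycle_function) auto
  finally have "(\<Sum>e\<in>?E. f' e) = int (length c)" .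
  moreover have "even (\<Sum>e\<in>?E. f' e)" using ev by (intro dvd_sum) auto
  ultimately show False using odd by simp
qed

section \<open>The rank of the edge matrix\<close>

lemma edge_matrix_left_mult:
  fixes y :: "nat \<Rightarrow> 'a::comm_ring_1"
  assumes j: "j < length es" and e: "es ! j = {a, b}" "a \<noteq> b" "{a, b} \<subseteq> {1..d}"
  shows "(\<Sum>i<d. y i * of_int (edge_matrix d es $$ (i, j))) = y (a - 1) + y (b - 1)"
proof -
  have "(\<Sum>i<d. y i * of_int (edge_matrix d es $$ (i, j)))
      = (\<Sum>i<d. (if i = a - 1 then y i else 0) + (if i = b - 1 then y i else 0))"
  proof (intro sum.cong refl)
    fix i assume "i \<in> {..<d}"
    moreover have "Suc i = a \<longleftrightarrow> i = a - 1" "Suc i = b \<longleftrightarrow> i = b - 1" "a - 1 \<noteq> b - 1"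
      using e(2,3) by auto
    ultimately show "y i * of_int (edge_matrix d es $$ (i, j))
        = (if i = a - 1 then y i else 0) + (if i = b - 1 then y i else 0)"
      using edge_matrix_entry[of i d j es] j by (simp add: e(1))
  qed
  also have "a - 1 < d" "b - 1 < d" using e(3) by auto
  then have "(\<Sum>i<d. (if i = a - 1 then y i else 0) + (if i = b - 1 then y i else 0))
      = y (a - 1) + y (b - 1)" by (simp add: sum.distrib sum.delta)
  finally show ?thesis .
qed

lemma signs_constant_on_connected:
  fixes y :: "nat \<Rightarrow> 'a::ab_group_add"
  assumes "connected_graph V E" "\<And>a b. {a, b} \<in> E \<Longrightarrow> y a + y b = 0" "u \<in> V" "v \<in> V"
  shows "y v = y u \<or> y v = - y u"
proof -
  have "(u, v) \<in> {(a, b). {a, b} \<in> E}\<^sup>*" using assms by (simp add: connected_graph_def)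
  then show ?thesis
  proof (induction rule: rtrancl_induct)
    case (step a b)
    then have "y b = - y a" using assms(2)[of a b] by (simp add: eq_neg_iff_add_eq_0 add.commute)
    with step.IH show ?case by auto
  qed simp
qed

lemma left_kernel_edge_sums:
  fixes y :: "nat \<Rightarrow> 'a::comm_ring_1"
  assumes G: "simple_graph {1..d} E" and es: "set es = E"
    and y: "\<And>j. j < length es \<Longrightarrow> (\<Sum>i<d. y i * of_int (edge_matrix d es $$ (i, j))) = 0"
    and ab: "{a, b} \<in> E"
  shows "y (a - 1) + y (b - 1) = 0"
proof -
  have "card {a, b} = 2" "{a, b} \<subseteq> {1..d}" using G ab by (auto simp: simple_graph_def)
  then have "a \<noteq> b" by auto
  obtain j where j: "j < length es" "es ! j = {a, b}" using ab es by (metis in_set_conv_nth)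
  from edge_matrix_left_mult[OF j \<open>a \<noteq> b\<close> \<open>{a, b} \<subseteq> {1..d}\<close>, of y] y[OF j(1)] show ?thesis by simp
qed

text \<open>A left kernel vector takes opposite values at the ends of each edge. If it is nonzero, it is \<open>\<plusminus>\<close> a constant on
the connected graph, and the two signs form a bipartition.\<close>

lemma nonbipartite_full_rank:
  assumes G: "simple_graph {1..d} E" "connected_graph {1..d} E" and es: "set es = E"
    and nb: "\<not> bipartite_graph {1..d} E"
  shows "mat_rank (edge_matrix d es) = d"
proof -
  have "mat_rank (edge_matrix d es) = dim_row (edge_matrix d es)"
  proof (rule trivial_left_kernel_imp_full_rank)
    fix y :: "nat \<Rightarrow> rat"
    assume y: "\<And>j. j < dim_col (edge_matrix d es) \<Longrightarrow>
      (\<Sum>i<dim_row (edge_matrix d es). y i * rat_of_int (edge_matrix d es $$ (i, j))) = 0"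
    let ?y = "\<lambda>v. y (v - 1)"
    have edge: "?y a + ?y b = 0" if "{a, b} \<in> E" for a b
      using left_kernel_edge_sums[OF G(1) es, of y a b] y that by simp
    have const: "?y v = ?y u \<or> ?y v = - ?y u" if "u \<in> {1..d}" "v \<in> {1..d}" for u v
      using signs_constant_on_connected[OF G(2), of ?y u v] edge that by blast
    show "\<forall>i<dim_row (edge_matrix d es). y i = 0"
    proof (rule ccontr)
      assume "\<not> ?thesis"
      then obtain i where i: "i < d" "y i \<noteq> 0" by auto
      define u where "u = Suc i"
      have u: "u \<in> {1..d}" "?y u \<noteq> 0" using i by (auto simp: u_def)
      let ?X = "{v \<in> {1..d}. ?y v = ?y u}" and ?Y = "{v \<in> {1..d}. ?y v = - ?y u}"
      have union: "?X \<union> ?Y = {1..d}" using const[OF u(1)] by blast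
      have inter: "?X \<inter> ?Y = {}" using u(2) by auto
      have edges: "\<exists>x\<in>?X. \<exists>z\<in>?Y. e = {x, z}" if "e \<in> E" for e
      proof -
        obtain a b where ab: "e = {a, b}" "a \<in> {1..d}" "b \<in> {1..d}"
          using G(1) \<open>e \<in> E\<close> unfolding simple_graph_def by (metis card_2_iff insert_subset)
        have yb: "?y b = - ?y a" using edge[of a b] ab \<open>e \<in> E\<close> by (simp add: eq_neg_iff_add_eq_0 add.commute)
        from const[OF u(1) ab(2)] show ?thesis
        proof
          assume "?y a = ?y u"
          with yb have "a \<in> ?X" "b \<in> ?Y" using ab by auto
          then show ?thesis using ab(1) by blast
        next
          assume "?y a = - ?y u"
          with yb have "b \<in> ?X" "a \<in> ?Y" using ab by auto
          moreover have "e = {b, a}" using ab(1) by auto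
          ultimately show ?thesis by blast
        qed
      qed
      have "bipartite_graph {1..d} E"
        unfolding bipartite_graph_def
        by (intro exI[of _ ?X] exI[of _ ?Y] conjI ballI union inter edges)
      with nb show False ..
    qed
  qed
  then show ?thesis by simp
qed

text \<open>The indicator of one class minus that of the other.\<close>

lemma bipartite_left_kernel:
  assumes G: "simple_graph {1..d} E" and es: "set es = E" and b: "bipartite_graph {1..d} E"
  shows "\<exists>y :: nat \<Rightarrow> int. (\<forall>i. y i \<noteq> 0) \<and>
    (\<forall>j<length es. (\<Sum>i<d. y i * edge_matrix d es $$ (i, j)) = 0)"
proof -
  obtain X Y where XY: "X \<union> Y = {1..d}" "X \<inter> Y = {}" "\<forall>e\<in>E. \<exists>x\<in>X. \<exists>y\<in>Y. e = {x, y}"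
    using b by (auto simp: bipartite_graph_def)
  let ?y = "\<lambda>i. if Suc i \<in> X then 1 else (-1 :: int)"
  have "(\<Sum>i<d. ?y i * edge_matrix d es $$ (i, j)) = 0" if j: "j < length es" for j
  proof -
    obtain x z where xz: "x \<in> X" "z \<in> Y" "es ! j = {x, z}" using XY(3) j es by (metis nth_mem)
    then have "x \<noteq> z" "{x, z} \<subseteq> {1..d}" "z \<notin> X" using XY by auto
    then show ?thesis using edge_matrix_left_mult[OF j xz(3), of d ?y] xz(1) by auto
  qed
  then show ?thesis by (intro exI[of _ ?y]) auto
qed

text \<open>A left kernel vector, extended by \<open>0\<close> to the deleted vertex, is constant up to sign.\<close>

lemma reduced_edge_matrix_full_rank:
  assumes G: "simple_graph {1..d} E" "connected_graph {1..d} E" and es: "set es = E"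
  shows "mat_rank (delete_row (edge_matrix d es) 0) = d - 1"
proof -
  let ?A = "edge_matrix d es" and ?A' = "delete_row (edge_matrix d es) 0"
  have "{1..d} \<noteq> {}" using G(2) by (simp add: connected_graph_def)
  then have d: "0 < d" by auto
  then obtain d' where d': "d = Suc d'" by (cases d) auto
  have dim: "0 < dim_row ?A" using d by simp
  note del = delete_first_row[OF dim]
  have "mat_rank ?A' = dim_row ?A'"
  proof (rule trivial_left_kernel_imp_full_rank)
    fix y :: "nat \<Rightarrow> rat"
    assume y: "\<And>j. j < dim_col ?A' \<Longrightarrow> (\<Sum>i<dim_row ?A'. y i * rat_of_int (?A' $$ (i, j))) = 0"
    define z where "z i = (case i of 0 \<Rightarrow> 0 | Suc i \<Rightarrow> y i)" for i
    have zj: "(\<Sum>i<d. z i * rat_of_int (?A $$ (i, j))) = 0" if "j < length es" for j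
      using y[of j] that del unfolding d' sum.lessThan_Suc_shift by (simp add: z_def d')
    have edge: "z (a - 1) + z (b - 1) = 0" if "{a, b} \<in> E" for a b
      using left_kernel_edge_sums[OF G(1) es, of z a b] zj that by blast
    show "\<forall>i<dim_row ?A'. y i = 0"
    proof (intro allI impI)
      fix i assume "i < dim_row ?A'"
      then have "Suc (Suc i) \<in> {1..d}" "1 \<in> {1..d}" using del d' by auto
      then show "y i = 0"
        using signs_constant_on_connected[OF G(2), of "\<lambda>v. z (v - 1)" 1 "Suc (Suc i)"] edge
        by (auto simp: z_def)
    qed
  qed
  then show ?thesis using del by simp
qed

lemma bipartite_reduced_unimodular:
  assumes G: "simple_graph {1..d} E" "connected_graph {1..d} E" and es: "distinct es" "set es = E"
    and b: "bipartite_graph {1..d} E" and U: "unit_conformal (edge_matrix d es)"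
  shows "redundant_row (edge_matrix d es) 0 \<and> unimodular (delete_row (edge_matrix d es) 0)"
proof -
  let ?A = "edge_matrix d es" and ?A' = "delete_row (edge_matrix d es) 0"
  have "{1..d} \<noteq> {}" using G(2) by (simp add: connected_graph_def)
  then have d: "0 < d" by auto
  then have dim: "0 < dim_row ?A" by simp
  note del = delete_first_row[OF dim]
  obtain y :: "nat \<Rightarrow> int" where y: "\<And>i. y i \<noteq> 0"
    "\<And>j. j < length es \<Longrightarrow> (\<Sum>i<d. y i * ?A $$ (i, j)) = 0"
    using bipartite_left_kernel[OF G(1) es(2) b] by blast
  have r': "mat_rank ?A' = d - 1" by (rule reduced_edge_matrix_full_rank[OF G es(2)])
  have "mat_rank ?A < dim_row ?A"
    using y d by (intro left_kernel_imp_rank_deficient[of ?A y 0]) auto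
  moreover have "dim_row ?A' \<le> mat_rank ?A"
  proof -
    have "mat_rank ?A' = dim_row ?A'" using r' del by simp
    from full_rank_imp_column_basis[OF this] obtain js where js: "length js = dim_row ?A'"
      "set js \<subseteq> {..<dim_col ?A'}" "det (select_cols ?A' js) \<noteq> 0" by blast
    show ?thesis
    proof (rule mat_rank_ge_if_row_minor[OF _ js(1) _ _ js(3)])
      fix i assume "i < dim_row ?A'"
      then show "\<exists>i'<dim_row ?A. \<forall>j<dim_col ?A. ?A' $$ (i, j) = ?A $$ (i', j)"
        using del by (intro exI[of _ "Suc i"]) auto
    qed (use js del in auto)
  qed
  ultimately have "mat_rank ?A = d - 1" using del d by simp
  then have "redundant_row ?A 0" using r' dim by (simp add: redundant_row_def)
  moreover have "unit_conformal ?A'"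
    using y by (intro unit_conformal_delete_first_row[OF U dim, of y]) auto
  then have "unimodular ?A'" using r' del by (intro unit_conformal_imp_unimodular) auto
  ultimately show ?thesis ..
qed

lemma bipartite_no_odd_cycle:
  assumes b: "bipartite_graph V E" and c: "odd_cycle E c"
  shows False
proof -
  obtain X Y where XY: "X \<inter> Y = {}" "\<forall>e\<in>E. \<exists>x\<in>X. \<exists>y\<in>Y. e = {x, y}"
    using b by (auto simp: bipartite_graph_def)
  have cyc: "is_cycle E c" and L: "3 \<le> length c" "odd (length c)"
    using c by (auto simp: odd_cycle_def is_cycle_def)
  have swap: "c ! (Suc i mod length c) \<in> X \<longleftrightarrow> c ! i \<notin> X" if i: "i < length c" for i
  proof -
    have "{c ! i, c ! (Suc i mod length c)} \<in> E"
      using cycle_edge_facts(1)[OF cyc i] by (simp add: cycle_edge_def)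
    with XY(2) obtain x y where "x \<in> X" "y \<in> Y" "{c ! i, c ! (Suc i mod length c)} = {x, y}" by blast
    with XY(1) show ?thesis by (auto simp: doubleton_eq_iff)
  qed
  have "c ! i \<in> X \<longleftrightarrow> (even i \<longleftrightarrow> c ! 0 \<in> X)" if "i < length c" for i
    using that
  proof (induction i)
    case (Suc i)
    then show ?case using swap[of i] by auto
  qed simp
  moreover have "length c - 1 < length c" "even (length c - 1)" "Suc (length c - 1) mod length c = 0"
    using L by auto
  ultimately show False using swap[of "length c - 1"] by metis
qed

section \<open>The equivalence\<close>

theorem theorem3p3:
  fixes d :: nat and E :: "nat set set" and es :: "nat set list"
    and A C :: "int mat"
    and KC :: "'k::field laurent set" and IC :: "'k mpoly set"
  assumes "simple_graph {1..d} E" and "connected_graph {1..d} E"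
    and "distinct es" and "set es = E"
  defines "A \<equiv> edge_matrix d es"
    and "C \<equiv> centrally_symmetric A"
    and "KC \<equiv> toric_ring C"
    and "IC \<equiv> toric_ideal C"
  defines "cond_i \<equiv> normal_domain KC"
    and "cond_ii \<equiv> has_squarefree_initial_ideal (dim_col C) IC"
    and "cond_iii \<equiv> (if bipartite_graph {1..d} E
           then \<exists>i. redundant_row A i \<and> unimodular (delete_row A i)
           else unimodular A)"
    and "cond_iv \<equiv> (\<forall>c c'. odd_cycle E c \<and> odd_cycle E c' \<longrightarrow> set c \<inter> set c' \<noteq> {})"
  shows "(cond_i \<longleftrightarrow> cond_ii) \<and> (cond_ii \<longleftrightarrow> cond_iii) \<and> (cond_iii \<longleftrightarrow> cond_iv)"
proof -
  note G = assms(1,2) and es = assms(3,4)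
  define normal where "normal \<longleftrightarrow> normal_semigroup (column_exponent C) (dim_col C)"
  have ht: "Poly_Mapping.lookup (column_exponent C j) d = 1" if "j < dim_col C" for j
    using centrally_symmetric_height[of j A] that by (simp add: C_def A_def)
  have i_iff: "cond_i \<longleftrightarrow> normal"
    unfolding cond_i_def KC_def normal_def toric_ring_eq semigroup_ring_def[symmetric]
    by (rule normal_domain_semigroup_ring_iff[OF ht])
  have "cond_ii \<Longrightarrow> normal"
    unfolding cond_ii_def IC_def normal_def squarefree_initial_ideal_iff
    using squarefree_imp_normal_semigroup[where \<gamma> = "column_exponent C" and m = "dim_col C", OF ht]
    by blast
  moreover have "normal \<Longrightarrow> cond_iv"
    unfolding normal_def cond_iv_def C_def A_def
    using normal_semigroup_imp_odd_cycles_meet[OF G es] by blast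
  moreover have U: "unit_conformal A" if cond_iv
    unfolding A_def using that
    by (intro no_disjoint_odd_cycles_imp_unit_conformal[OF G(1) es]) (auto simp: cond_iv_def)
  then have "cond_iv \<Longrightarrow> cond_ii"
    unfolding cond_ii_def IC_def C_def by (rule unit_conformal_imp_squarefree)
  moreover have "cond_iii \<longleftrightarrow> cond_iv"
  proof (cases "bipartite_graph {1..d} E")
    case True
    then have cond_iv unfolding cond_iv_def using bipartite_no_odd_cycle by blast
    moreover from bipartite_reduced_unimodular[OF G es True U[OF this, unfolded A_def]]
    have cond_iii using True unfolding cond_iii_def A_def by auto
    ultimately show ?thesis by simp
  next
    case False
    have "cond_iv" if "unimodular A"
      using unimodular_imp_odd_cycles_meet[OF G es that[unfolded A_def]] by (auto simp: cond_iv_def)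
    moreover have "unimodular A" if cond_iv
      using unit_conformal_imp_unimodular[OF U[OF that]] nonbipartite_full_rank[OF G es(2) False]
      by (simp add: A_def)
    ultimately show ?thesis using False unfolding cond_iii_def by auto
  qed
  ultimately show ?thesis using i_iff by blast
qed

end
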